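(* Let $d=2$, $p,q\ge1$, and consider the space-time DGSEM on the time slab $(t^{(n)},t^{(n+1)})$, $\Delta t^{(n)}=t^{(n+1)}-t^{(n)}>0$: given the DOFs $U_\kappa^{ij}(t_{n-1}^q)\in[m,M]$, find the DOFs $U_\kappa^{ij}(t_n^r)$ such that for all $\kappa\in\Omega_h$, $0\le i,j\le p$, $0\le r\le q$, $$\omega_i\omega_jJ_\kappa^{ij}\,T_\kappa^r\big(u_h(\mathbf x_\kappa^{ij},\cdot)\big)+\frac{\omega_r\Delta t^{(n)}}2\Big(R_\kappa^{ij}\big(u_h(\cdot,t_n^r)\big)+V_\kappa^{ij}\big(u_h(\cdot,t_n^r)\big)\Big)=0,$$ where the entropy conservative fluxes $h_{ec}$ (in space) and $U_{ec}$ (in time) are those associated with a given entropy pair $(\vartheta,\mathbf g)$ with $\vartheta''>0$, and the graph viscosity coefficients $d_\kappa$ (in $V_\kappa^{ij}$) and $d_n$ (in $T_\kappa^r$) satisfy $$d_\kappa\ge4L_fL_u\max_{k\ne l}\frac{|D^p_{kl}|}{\omega_l}\quad\forall\kappa\in\Omega_h,\qquad d_n\ge2L_u\max_{r\ne m}\frac{|D^q_{rm}|}{\omega_m}\quad\forall n\ge0,$$ with $L_u:=\sup_{m\le u^+\ne u^-\le M}\frac{\vartheta''(u^+)(u^+-u^-)}{v(u^+)-v(u^-)}$, $v=\vartheta'$. Then, for every $n\ge 0$, the scheme has a unique solution satisfying the maximum principle $$m\le U_\kappa^{ij}(t_n^r)\le M\qquad\forall\kappa\in\Omega_h,\ 0\le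 i,j\le p,\ 0\le r\le q.$$
   Context: **Continuous problem.** $\partial_tu+\nabla\cdot\mathbf f(u)=0$ in $\Omega\times(0,\infty)$, $u(\cdot,0)=u_0$, with $\Omega\subset\mathbb R^2$, $\mathbf f:\mathbb R\to\mathbb R^2$ locally Lipschitz, $u_0\in L^\infty$, $m:=\operatorname{ess\,inf}u_0$, $M:=\operatorname{ess\,sup}u_0$ (when $m$ appears as a summation or matrix index it is an integer in $\{0,\dots,q\}$). Lipschitz constant of the flux: $L_f:=\sup_{m\le u^+\neq u^-\le M}\sup_{\mathbf n\in\mathbb S^{1}}\frac{|(\mathbf f(u^+)-\mathbf f(u^-))\cdot\mathbf n|}{|u^+-u^-|}$. **One-dimensional operators.** For a degree $s\ge1$ ($s=p$ in space, $s=q$ in time): $-1=\xi_0<\dots<\xi_s=1$ are the $s+1$ Gauss-Lobatto nodes on $I=[-1,1]$, $\omega_k>0$ the associated quadrature weights ($\sum_k\omega_k=2$), $\ell_k$ the Lagrange polynomials with $\ell_k(\xi_l)=\delta_{kl}$; $D^s_{kl}=\ell_l'(\xi_k)$, $Q^s_{kl}=\omega_kD^s_{kl}$. The dependence of nodes/weights on $s$ is dropped: indices $i,j,k,l\in\{0,\dots,p\}$ refer to the degree-$p$ rule and indices $r,m\in\{0,\dots,q\}$ to the degree-$q$ rule. **Mesh.** $\Omega_h$ is a mesh of nonoverlapping nonempty open elements $\kappa$ partitioning $\Omega$ (possibly countably infinitely many). Each $\kappa$ is the image of $I^2$ under a mapping $\mathbf x_\kappa(\xi,\zeta)=\sum_{i,j=0}^p\ell_i(\xi)\ell_j(\zeta)\mathbf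 x_\kappa^{ij}$, with $\mathbf x_\kappa^{ij}=\mathbf x_\kappa(\xi_i,\xi_j)$ and $J_\kappa^{ij}=\det\mathbf x_\kappa'(\xi_i,\xi_j)>0$. Each edge $e\subset\partial\kappa$ is the image of $I$ under $\mathbf x_e$; $\mathbf x_e^k=\mathbf x_e(\xi_k)$, $J_e^k=|\mathbf x_e'(\xi_k)|>0$, $\mathbf n_e^k$ is the unit normal to $e$ at $\mathbf x_e^k$ pointing outward from $\kappa$. Metric terms ($\nabla\xi,\nabla\zeta$ are the physical gradients of the reference coordinates): $\mathbf n_\kappa^{(ik)j}=\frac12\big(J_\kappa^{ij}\nabla\xi(\xi_i,\xi_j)+J_\kappa^{kj}\nabla\xi(\xi_k,\xi_j)\big)$, $\mathbf n_\kappa^{i(jk)}=\frac12\big(J_\kappa^{ij}\nabla\zeta(\xi_i,\xi_j)+J_\kappa^{ik}\nabla\zeta(\xi_i,\xi_k)\big)$. The discrete metric identities hold: $\sum_{k=0}^p D^p_{ik}\mathbf n_\kappa^{(ik)j}+D^p_{jk}\mathbf n_\kappa^{i(jk)}=0$ for all $\kappa,i,j$. The mesh is watertight (geometry continuous across faces, face nodes of neighbours coincide) and at faces $\mathbf n_\kappa^{(pp)j}=J_e\mathbf n_e$ at $\mathbf x_\kappa^{pj}$, $\mathbf n_\kappa^{(00)j}=-J_e\mathbf n_e$ at $\mathbf x_\kappa^{0j}$, $\mathbf n_\kappa^{i(pp)}=J_e\mathbf n_e$ at $\mathbf x_\kappa^{ip}$, $\mathbf n_\kappa^{i(00)}=-J_e\mathbf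 n_e$ at $\mathbf x_\kappa^{i0}$. Every face is shared with a neighbouring element. Mesh regularity: $h:=\sup_\kappa\operatorname{diam}\kappa<\infty$ and there is a finite constant $b>0$ with $J_\kappa^{ij}\ge\frac{b}{2d}h^d$ and $\frac1{4db}h^{d-1}\ge J_e^k,|\mathbf n_\kappa^{(ik)j}|,|\mathbf n_\kappa^{i(jk)}|>0$ for all $\kappa,i,j,k$ (here $d=2$). **Discrete functions.** $u_h(\mathbf x,t)=\sum_{i,j=0}^p\sum_{r=0}^q\phi_\kappa^{ij}(\mathbf x)\phi_n^r(t)U_\kappa^{ij}(t_n^r)$ on $\kappa\times(t^{(n)},t^{(n+1)})$, with $\phi_\kappa^{ij}(\mathbf x_\kappa(\xi,\zeta))=\ell_i(\xi)\ell_j(\zeta)$, $\phi_n^r(t)=\ell_r\big(2\frac{t-t^{(n)}}{\Delta t^{(n)}}-1\big)$, $t_n^r=t^{(n)}+\frac{\Delta t^{(n)}}2(1+\xi_r)$; thus $t_n^0=t^{(n)+}$, $t_n^q=t^{(n+1)-}$, $t^{(0)}=0$. The initial data are $U_\kappa^{ij}(t_{-1}^q)=u_0(\mathbf x_\kappa^{ij})\in[m,M]$. At a face node $\mathbf x_e^k$, $e\subset\partial\kappa$, $u_h^-$ is the trace from $\kappa$ and $u_h^+$ the trace from the neighbour; $\phi_\kappa^{ij}(\mathbf x_e^k)=1$ if $\mathbf x_\kappa^{ij}=\mathbf x_e^k$ and $0$ otherwise. **Space discretization** (evaluated at each fixed time $t_n^r$, writing $U_\kappa^{ij}$ for the DOFs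 at that time): $$R_\kappa^{ij}(u_h)=2\Big(\omega_j\sum_{k=0}^pQ^p_{ik}h_{ec}(U_\kappa^{ij},U_\kappa^{kj},\mathbf n_\kappa^{(ik)j})+\omega_i\sum_{k=0}^pQ^p_{jk}h_{ec}(U_\kappa^{ij},U_\kappa^{ik},\mathbf n_\kappa^{i(jk)})\Big)+\sum_{e\in\partial\kappa}\sum_{k=0}^p\phi_\kappa^{ij}(\mathbf x_e^k)\omega_kJ_e^k\Big(h(U_\kappa^{ij},u_h^+(\mathbf x_e^k),\mathbf n_e^k)-\mathbf f(U_\kappa^{ij})\cdot\mathbf n_e^k\Big),$$ $$V_\kappa^{ij}(u_h)=d_\kappa\omega_i\omega_j\sum_{k=0}^p\Big(\frac{\omega_k}2|\mathbf n_\kappa^{(ik)j}|(U_\kappa^{ij}-U_\kappa^{kj})+\frac{\omega_k}2|\mathbf n_\kappa^{i(jk)}|(U_\kappa^{ij}-U_\kappa^{ik})\Big).$$ **Time discretization.** $$T_\kappa^r\big(u_h(\mathbf x_\kappa^{ij},\cdot)\big)=\sum_{m=0}^q2Q^q_{rm}U_{ec}\big(U_\kappa^{ij}(t_n^r),U_\kappa^{ij}(t_n^m)\big)+\delta_{r0}\big(U_\kappa^{ij}(t_n^0)-U_\kappa^{ij}(t_{n-1}^q)\big)+d_n\omega_r\sum_{m=0}^q\omega_m\big(U_\kappa^{ij}(t_n^r)-U_\kappa^{ij}(t_n^m)\big),$$ with $U_{ec}(u^-,u^+)=\int_0^1u\big(\theta v(u^+)+(1-\theta)v(u^-)\big)d\theta$,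 where $v(u)=\vartheta'(u)$ and $u(\cdot)$ denotes the inverse function of $v$. **Cell flux $h_{ec}$.** With $\mathbf g(u)=\int^u\vartheta'(w)\mathbf f'(w)\,dw$ and $\boldsymbol\psi(u)=v(u)\mathbf f(u)-\mathbf g(u)$, $h_{ec}$ is smooth, consistent ($h_{ec}(u,u,\mathbf n)=\mathbf f(u)\cdot\mathbf n$), symmetric in its first two arguments, linear in $\mathbf n\in\mathbb R^2$, and entropy conservative: $(v(u^+)-v(u^-))h_{ec}(u^-,u^+,\mathbf n)=(\boldsymbol\psi(u^+)-\boldsymbol\psi(u^-))\cdot\mathbf n$. **Interface flux $h$.** $h$ is Lipschitz continuous, consistent ($h(u,u,\mathbf n)=\mathbf f(u)\cdot\mathbf n$), conservative ($h(u^-,u^+,\mathbf n)=-h(u^+,u^-,-\mathbf n)$), and monotone (nondecreasing in $u^-$, nonincreasing in $u^+$); its Lipschitz constants $L_1,L_2$ in its first two arguments satisfy $L_1+L_2\ge L_f$; and for all $u^-,u,u^+\in[m,M]$, $\mathbf n\in\mathbb S^1$, $\alpha\ge L_f$: $m\le u-\frac{h(u,u^+,\mathbf n)-h(u^-,u,\mathbf n)}{2\alpha}\le M$. *)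

theory Defs
  imports
    "HOL-Analysis.Analysis"
    "HOL-Probability.Essential_Supremum"
    "HOL-Computational_Algebra.Polynomial"
begin

section \<open>One-dimensional Gauss-Lobatto operators\<close>

text \<open>The Gauss-Lobatto rule with \<open>s + 1\<close> points is the quadrature rule that contains both end
  points and is exact on polynomials of degree at most \<open>2 s - 1\<close>; this determines the nodes and the
  weights.\<close>

definition gauss_lobatto :: "nat \<Rightarrow> (nat \<Rightarrow> real) \<Rightarrow> (nat \<Rightarrow> real) \<Rightarrow> bool" where
  "gauss_lobatto s \<xi> \<omega> \<longleftrightarrow>
     \<xi> 0 = -1 \<and> \<xi> s = 1 \<and> (\<forall>k<s. \<xi> k < \<xi> (Suc k)) \<and> (\<forall>k\<le>s. 0 < \<omega> k) \<and>
     (\<forall>P::real poly. degree P \<le> 2 * s - 1 \<longrightarrow>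
        (\<Sum>k\<le>s. \<omega> k * poly P (\<xi> k)) = integral {-1..1} (poly P))"

definition lagrange :: "nat \<Rightarrow> (nat \<Rightarrow> real) \<Rightarrow> nat \<Rightarrow> real poly" where
  "lagrange s \<xi> k = (\<Prod>l\<in>{..s} - {k}. smult (1 / (\<xi> k - \<xi> l)) [:- \<xi> l, 1:])"

definition Dmat :: "nat \<Rightarrow> (nat \<Rightarrow> real) \<Rightarrow> nat \<Rightarrow> nat \<Rightarrow> real" where
  "Dmat s \<xi> k l = poly (pderiv (lagrange s \<xi> l)) (\<xi> k)"

definition Qmat :: "nat \<Rightarrow> (nat \<Rightarrow> real) \<Rightarrow> (nat \<Rightarrow> real) \<Rightarrow> nat \<Rightarrow> nat \<Rightarrow> real" where
  "Qmat s \<xi> \<omega> k l = \<omega> k * Dmat s \<xi> k l"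

definition max_D_over_weight :: "nat \<Rightarrow> (nat \<Rightarrow> real) \<Rightarrow> (nat \<Rightarrow> real) \<Rightarrow> real" where
  "max_D_over_weight s \<xi> \<omega> = Max {\<bar>Dmat s \<xi> k l\<bar> / \<omega> l | k l. k \<le> s \<and> l \<le> s \<and> k \<noteq> l}"

section \<open>Mesh\<close>

text \<open>An element is identified with the open set \<open>\<kappa>\<close> it occupies and an edge with the closed curve
  segment it occupies. \<open>node T \<kappa> i j\<close> is $\mathbf x_\kappa^{ij}$, \<open>emap T e\<close> is the
  parametrisation $\mathbf x_e$ on $[-1,1]$, which is common to the two elements sharing \<open>e\<close>, and
  \<open>enormal T \<kappa> e k\<close> is $\mathbf n_e^k$ seen from \<open>\<kappa>\<close>.\<close>

record mesh =
  elems :: "(real^2) set set"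
  node :: "(real^2) set \<Rightarrow> nat \<Rightarrow> nat \<Rightarrow> real^2"
  emap :: "(real^2) set \<Rightarrow> real \<Rightarrow> real^2"
  enormal :: "(real^2) set \<Rightarrow> (real^2) set \<Rightarrow> nat \<Rightarrow> real^2"

definition ref_square :: "(real^2) set" where
  "ref_square = cbox (-1) 1"

definition xmap :: "nat \<Rightarrow> (nat \<Rightarrow> real) \<Rightarrow> mesh \<Rightarrow> (real^2) set \<Rightarrow> real^2 \<Rightarrow> real^2" where
  "xmap p \<xi> T \<kappa> z =
     (\<Sum>i\<le>p. \<Sum>j\<le>p. (poly (lagrange p \<xi> i) (z $ 1) * poly (lagrange p \<xi> j) (z $ 2)) *\<^sub>R node T \<kappa> i j)"

definition xjac :: "nat \<Rightarrow> (nat \<Rightarrow> real) \<Rightarrow> mesh \<Rightarrow> (real^2) set \<Rightarrow> real^2 \<Rightarrow> real^2^2" where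
  "xjac p \<xi> T \<kappa> z = jacobian (xmap p \<xi> T \<kappa>) (at z)"

definition Jdet :: "nat \<Rightarrow> (nat \<Rightarrow> real) \<Rightarrow> mesh \<Rightarrow> (real^2) set \<Rightarrow> nat \<Rightarrow> nat \<Rightarrow> real" where
  "Jdet p \<xi> T \<kappa> i j = det (xjac p \<xi> T \<kappa> (vector [\<xi> i, \<xi> j]))"

text \<open>The physical gradients of the reference coordinates are the rows of the Jacobian matrix of
  the inverse mapping: \<open>ref_grad \<dots> 1\<close> is $\nabla\xi$ and \<open>ref_grad \<dots> 2\<close> is $\nabla\zeta$.\<close>

definition ref_grad ::
  "nat \<Rightarrow> (nat \<Rightarrow> real) \<Rightarrow> mesh \<Rightarrow> (real^2) set \<Rightarrow> 2 \<Rightarrow> nat \<Rightarrow> nat \<Rightarrow> real^2" where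
  "ref_grad p \<xi> T \<kappa> c i j = row c (matrix_inv (xjac p \<xi> T \<kappa> (vector [\<xi> i, \<xi> j])))"

text \<open>\<open>nvol1 \<dots> i k j\<close> is $\mathbf n_\kappa^{(ik)j}$ and \<open>nvol2 \<dots> i j k\<close> is $\mathbf n_\kappa^{i(jk)}$.\<close>

definition nvol1 ::
  "nat \<Rightarrow> (nat \<Rightarrow> real) \<Rightarrow> mesh \<Rightarrow> (real^2) set \<Rightarrow> nat \<Rightarrow> nat \<Rightarrow> nat \<Rightarrow> real^2" where
  "nvol1 p \<xi> T \<kappa> i k j =
     (1/2) *\<^sub>R (Jdet p \<xi> T \<kappa> i j *\<^sub>R ref_grad p \<xi> T \<kappa> 1 i j + Jdet p \<xi> T \<kappa> k j *\<^sub>R ref_grad p \<xi> T \<kappa> 1 k j)"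

definition nvol2 ::
  "nat \<Rightarrow> (nat \<Rightarrow> real) \<Rightarrow> mesh \<Rightarrow> (real^2) set \<Rightarrow> nat \<Rightarrow> nat \<Rightarrow> nat \<Rightarrow> real^2" where
  "nvol2 p \<xi> T \<kappa> i j k =
     (1/2) *\<^sub>R (Jdet p \<xi> T \<kappa> i j *\<^sub>R ref_grad p \<xi> T \<kappa> 2 i j + Jdet p \<xi> T \<kappa> i k *\<^sub>R ref_grad p \<xi> T \<kappa> 2 i k)"

datatype side = West | East | South | North

fun side_point :: "side \<Rightarrow> real \<Rightarrow> real^2" where
  "side_point West s = vector [-1, s]"
| "side_point East s = vector [1, s]"
| "side_point South s = vector [s, -1]"
| "side_point North s = vector [s, 1]"

fun side_outward :: "side \<Rightarrow> real^2" where
  "side_outward West = vector [-1, 0]"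
| "side_outward East = vector [1, 0]"
| "side_outward South = vector [0, -1]"
| "side_outward North = vector [0, 1]"

definition side_edge :: "nat \<Rightarrow> (nat \<Rightarrow> real) \<Rightarrow> mesh \<Rightarrow> (real^2) set \<Rightarrow> side \<Rightarrow> (real^2) set" where
  "side_edge p \<xi> T \<kappa> sd = (\<lambda>s. xmap p \<xi> T \<kappa> (side_point sd s)) ` {-1..1}"

definition edges :: "nat \<Rightarrow> (nat \<Rightarrow> real) \<Rightarrow> mesh \<Rightarrow> (real^2) set \<Rightarrow> (real^2) set set" where
  "edges p \<xi> T \<kappa> = side_edge p \<xi> T \<kappa> ` {West, East, South, North}"

text \<open>The tangent is one-sided at the two end points of the edge, which are quadrature nodes.\<close>

definition edge_tangent :: "(nat \<Rightarrow> real) \<Rightarrow> mesh \<Rightarrow> (real^2) set \<Rightarrow> nat \<Rightarrow> real^2" where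
  "edge_tangent \<xi> T e k = vector_derivative (emap T e) (at (\<xi> k) within {-1..1})"

definition Jedge :: "(nat \<Rightarrow> real) \<Rightarrow> mesh \<Rightarrow> (real^2) set \<Rightarrow> nat \<Rightarrow> real" where
  "Jedge \<xi> T e k = norm (edge_tangent \<xi> T e k)"

text \<open>A direction normal to an edge points outward when it lies on the same side of the tangent
  as the image of the outward reference direction under $\mathbf x_\kappa'$. (Testing whether
  \<open>x + \<epsilon> n\<close> leaves the element would be wrong at an element corner.)\<close>

definition outward_unit_normal ::
  "nat \<Rightarrow> (nat \<Rightarrow> real) \<Rightarrow> mesh \<Rightarrow> (real^2) set \<Rightarrow> side \<Rightarrow> nat \<Rightarrow> real^2 \<Rightarrow> bool" where
  "outward_unit_normal p \<xi> T \<kappa> sd k n \<longleftrightarrow>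
     norm n = 1 \<and> n \<bullet> edge_tangent \<xi> T (side_edge p \<xi> T \<kappa> sd) k = 0 \<and>
     (\<forall>s\<in>{-1..1}. xmap p \<xi> T \<kappa> (side_point sd s) = emap T (side_edge p \<xi> T \<kappa> sd) (\<xi> k) \<longrightarrow>
        0 < n \<bullet> (xjac p \<xi> T \<kappa> (side_point sd s) *v side_outward sd))"

definition neighbour ::
  "nat \<Rightarrow> (nat \<Rightarrow> real) \<Rightarrow> mesh \<Rightarrow> (real^2) set \<Rightarrow> (real^2) set \<Rightarrow> (real^2) set" where
  "neighbour p \<xi> T \<kappa> e = (THE \<kappa>'. \<kappa>' \<in> elems T \<and> \<kappa>' \<noteq> \<kappa> \<and> e \<in> edges p \<xi> T \<kappa>')"

text \<open>Nonoverlapping curvilinear quadrilaterals. An element is open, so it is the image of the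
  open square; its closure is the image of the closed square. The mapping is injective since the
  reference coordinates are functions of the physical ones.\<close>

definition mesh_partition ::
  "nat \<Rightarrow> (nat \<Rightarrow> real) \<Rightarrow> (real^2) set \<Rightarrow> mesh \<Rightarrow> bool" where
  "mesh_partition p \<xi> \<Omega> T \<longleftrightarrow>
     countable (elems T) \<and>
     (\<forall>\<kappa>\<in>elems T. open \<kappa> \<and> \<kappa> \<noteq> {}) \<and>
     pairwise disjnt (elems T) \<and>
     \<Union>(elems T) \<subseteq> \<Omega> \<and> \<Omega> \<subseteq> (\<Union>\<kappa>\<in>elems T. closure \<kappa>) \<and>
     (\<forall>\<kappa>\<in>elems T.
        inj_on (xmap p \<xi> T \<kappa>) ref_square \<and>
        \<kappa> = xmap p \<xi> T \<kappa> ` interior ref_square \<and>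
        (\<forall>i\<le>p. \<forall>j\<le>p. 0 < Jdet p \<xi> T \<kappa> i j))"

definition metric_identities :: "nat \<Rightarrow> (nat \<Rightarrow> real) \<Rightarrow> mesh \<Rightarrow> bool" where
  "metric_identities p \<xi> T \<longleftrightarrow>
     (\<forall>\<kappa>\<in>elems T. \<forall>i\<le>p. \<forall>j\<le>p.
        (\<Sum>k\<le>p. Dmat p \<xi> i k *\<^sub>R nvol1 p \<xi> T \<kappa> i k j + Dmat p \<xi> j k *\<^sub>R nvol2 p \<xi> T \<kappa> i j k) = 0)"

text \<open>Both elements adjacent to an edge \<open>e\<close> parametrise it by \<open>emap T e\<close>, possibly traversed in
  the opposite direction.\<close>

definition watertight :: "nat \<Rightarrow> (nat \<Rightarrow> real) \<Rightarrow> mesh \<Rightarrow> bool" where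
  "watertight p \<xi> T \<longleftrightarrow>
     (\<forall>\<kappa>\<in>elems T. \<forall>sd.
        (\<forall>s\<in>{-1..1}. emap T (side_edge p \<xi> T \<kappa> sd) s = xmap p \<xi> T \<kappa> (side_point sd s)) \<or>
        (\<forall>s\<in>{-1..1}. emap T (side_edge p \<xi> T \<kappa> sd) s = xmap p \<xi> T \<kappa> (side_point sd (- s)))) \<and>
     (\<forall>\<kappa>\<in>elems T. \<forall>e\<in>edges p \<xi> T \<kappa>. \<exists>!\<kappa>'. \<kappa>' \<in> elems T \<and> \<kappa>' \<noteq> \<kappa> \<and> e \<in> edges p \<xi> T \<kappa>')"

definition face_metrics :: "nat \<Rightarrow> (nat \<Rightarrow> real) \<Rightarrow> mesh \<Rightarrow> bool" where
  "face_metrics p \<xi> T \<longleftrightarrow>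
     (\<forall>\<kappa>\<in>elems T. \<forall>k\<le>p.
        (\<forall>sd. outward_unit_normal p \<xi> T \<kappa> sd k (enormal T \<kappa> (side_edge p \<xi> T \<kappa> sd) k)) \<and>
        (\<forall>j\<le>p. let e = side_edge p \<xi> T \<kappa> East in emap T e (\<xi> k) = node T \<kappa> p j \<longrightarrow>
           nvol1 p \<xi> T \<kappa> p p j = Jedge \<xi> T e k *\<^sub>R enormal T \<kappa> e k) \<and>
        (\<forall>j\<le>p. let e = side_edge p \<xi> T \<kappa> West in emap T e (\<xi> k) = node T \<kappa> 0 j \<longrightarrow>
           nvol1 p \<xi> T \<kappa> 0 0 j = - (Jedge \<xi> T e k *\<^sub>R enormal T \<kappa> e k)) \<and>
        (\<forall>i\<le>p. let e = side_edge p \<xi> T \<kappa> North in emap T e (\<xi> k) = node T \<kappa> i p \<longrightarrow>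
           nvol2 p \<xi> T \<kappa> i p p = Jedge \<xi> T e k *\<^sub>R enormal T \<kappa> e k) \<and>
        (\<forall>i\<le>p. let e = side_edge p \<xi> T \<kappa> South in emap T e (\<xi> k) = node T \<kappa> i 0 \<longrightarrow>
           nvol2 p \<xi> T \<kappa> i 0 0 = - (Jedge \<xi> T e k *\<^sub>R enormal T \<kappa> e k)))"

text \<open>With \<open>d = 2\<close>, the constants $b/(2d)\,h^d$ and $h^{d-1}/(4db)$ are \<open>b / 4 * h^2\<close> and
  \<open>h / (8 * b)\<close>.\<close>

definition mesh_regular :: "nat \<Rightarrow> (nat \<Rightarrow> real) \<Rightarrow> mesh \<Rightarrow> bool" where
  "mesh_regular p \<xi> T \<longleftrightarrow>
     bdd_above (diameter ` elems T) \<and>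
     (let h = (SUP \<kappa>\<in>elems T. diameter \<kappa>) in
      \<exists>b>0. \<forall>\<kappa>\<in>elems T. \<forall>i\<le>p. \<forall>j\<le>p. \<forall>k\<le>p.
        b / 4 * h^2 \<le> Jdet p \<xi> T \<kappa> i j \<and>
        (\<forall>e\<in>edges p \<xi> T \<kappa>. 0 < Jedge \<xi> T e k \<and> Jedge \<xi> T e k \<le> h / (8 * b)) \<and>
        0 < norm (nvol1 p \<xi> T \<kappa> i k j) \<and> norm (nvol1 p \<xi> T \<kappa> i k j) \<le> h / (8 * b) \<and>
        0 < norm (nvol2 p \<xi> T \<kappa> i j k) \<and> norm (nvol2 p \<xi> T \<kappa> i j k) \<le> h / (8 * b))"

definition dgsem_mesh :: "nat \<Rightarrow> (nat \<Rightarrow> real) \<Rightarrow> (real^2) set \<Rightarrow> mesh \<Rightarrow> bool" where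
  "dgsem_mesh p \<xi> \<Omega> T \<longleftrightarrow>
     mesh_partition p \<xi> \<Omega> T \<and> metric_identities p \<xi> T \<and> watertight p \<xi> T \<and>
     face_metrics p \<xi> T \<and> mesh_regular p \<xi> T"

section \<open>Fluxes and entropy\<close>

definition essinf :: "'a measure \<Rightarrow> ('a \<Rightarrow> ereal) \<Rightarrow> ereal" where
  "essinf N u = - esssup N (\<lambda>x. - u x)"

definition locally_Lipschitz :: "(real \<Rightarrow> real^2) \<Rightarrow> bool" where
  "locally_Lipschitz f \<longleftrightarrow> (\<forall>u. \<exists>\<epsilon>>0. \<exists>L. L-lipschitz_on (ball u \<epsilon>) f)"

text \<open>In the next two definitions all quotients are nonnegative; inserting \<open>0\<close> only fixes the
  supremum of the empty set, i.e. the case \<open>m = M\<close>.\<close>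

definition Lf :: "(real \<Rightarrow> real^2) \<Rightarrow> real \<Rightarrow> real \<Rightarrow> real" where
  "Lf f m M = Sup (insert 0 {\<bar>(f b - f a) \<bullet> n\<bar> / \<bar>b - a\<bar> | a b n.
       a \<in> {m..M} \<and> b \<in> {m..M} \<and> b \<noteq> a \<and> norm n = 1})"

definition Lu :: "(real \<Rightarrow> real) \<Rightarrow> real \<Rightarrow> real \<Rightarrow> real" where
  "Lu \<theta> m M = Sup (insert 0 {deriv (deriv \<theta>) b * (b - a) / (deriv \<theta> b - deriv \<theta> a) | a b.
       a \<in> {m..M} \<and> b \<in> {m..M} \<and> b \<noteq> a})"

text \<open>A $C^2$ entropy with positive second derivative, and an entropy flux $\mathbf g$ that is a
  primitive of $\vartheta'\mathbf f'$ (\<open>f\<close> is differentiable almost everywhere).\<close>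

definition entropy_pair :: "(real \<Rightarrow> real^2) \<Rightarrow> (real \<Rightarrow> real) \<Rightarrow> (real \<Rightarrow> real^2) \<Rightarrow> bool" where
  "entropy_pair f \<theta> g \<longleftrightarrow>
     (\<forall>u. \<theta> field_differentiable at u) \<and> (\<forall>u. deriv \<theta> field_differentiable at u) \<and>
     continuous_on UNIV (deriv (deriv \<theta>)) \<and> (\<forall>u. 0 < deriv (deriv \<theta>) u) \<and>
     (\<forall>a b. a \<le> b \<longrightarrow>
        ((\<lambda>w. deriv \<theta> w *\<^sub>R vector_derivative f (at w)) has_integral (g b - g a)) {a..b})"

definition entropy_potential ::
  "(real \<Rightarrow> real^2) \<Rightarrow> (real \<Rightarrow> real) \<Rightarrow> (real \<Rightarrow> real^2) \<Rightarrow> real \<Rightarrow> real^2" where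
  "entropy_potential f \<theta> g u = deriv \<theta> u *\<^sub>R f u - g u"

text \<open>Only continuous differentiability in the two states is required of the smooth flux
  $h_{ec}$.\<close>

definition ec_flux ::
  "(real \<Rightarrow> real^2) \<Rightarrow> (real \<Rightarrow> real) \<Rightarrow> (real \<Rightarrow> real^2) \<Rightarrow> (real \<Rightarrow> real \<Rightarrow> real^2 \<Rightarrow> real) \<Rightarrow> bool" where
  "ec_flux f \<theta> g hec \<longleftrightarrow>
     (\<forall>n. \<exists>h'. (\<forall>z. ((\<lambda>(a, b). hec a b n) has_derivative blinfun_apply (h' z)) (at z)) \<and>
               continuous_on UNIV h') \<and>
     (\<forall>u n. hec u u n = f u \<bullet> n) \<and>
     (\<forall>a b n. hec a b n = hec b a n) \<and>
     (\<forall>a b. linear (hec a b)) \<and>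
     (\<forall>a b n. (deriv \<theta> b - deriv \<theta> a) * hec a b n =
        (entropy_potential f \<theta> g b - entropy_potential f \<theta> g a) \<bullet> n)"

text \<open>Since \<open>f\<close> is only locally Lipschitz, the Lipschitz bounds and the monotonicity refer to
  states in \<open>[m, M]\<close>.\<close>

definition interface_flux ::
  "(real \<Rightarrow> real^2) \<Rightarrow> real \<Rightarrow> real \<Rightarrow> (real \<Rightarrow> real \<Rightarrow> real^2 \<Rightarrow> real) \<Rightarrow> bool" where
  "interface_flux f m M h \<longleftrightarrow>
     (\<exists>L. L-lipschitz_on ({m..M} \<times> {m..M} \<times> sphere 0 1) (\<lambda>(a, b, n). h a b n)) \<and>
     (\<exists>L1 L2. Lf f m M \<le> L1 + L2 \<and>
        (\<forall>b\<in>{m..M}. \<forall>n\<in>sphere 0 1. L1-lipschitz_on {m..M} (\<lambda>a. h a b n)) \<and>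
        (\<forall>a\<in>{m..M}. \<forall>n\<in>sphere 0 1. L2-lipschitz_on {m..M} (\<lambda>b. h a b n))) \<and>
     (\<forall>u. \<forall>n\<in>sphere 0 1. h u u n = f u \<bullet> n) \<and>
     (\<forall>a b. \<forall>n\<in>sphere 0 1. h a b n = - h b a (- n)) \<and>
     (\<forall>b\<in>{m..M}. \<forall>n\<in>sphere 0 1. mono_on {m..M} (\<lambda>a. h a b n)) \<and>
     (\<forall>a\<in>{m..M}. \<forall>n\<in>sphere 0 1. antimono_on {m..M} (\<lambda>b. h a b n)) \<and>
     (\<forall>a\<in>{m..M}. \<forall>u\<in>{m..M}. \<forall>b\<in>{m..M}. \<forall>n\<in>sphere 0 1. \<forall>\<alpha>>0. Lf f m M \<le> \<alpha> \<longrightarrow>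
        u - (h u b n - h a u n) / (2 * \<alpha>) \<in> {m..M})"

text \<open>\<open>the_inv\<close> is the inverse of the strictly increasing function $v = \vartheta'$.\<close>

definition Uec :: "(real \<Rightarrow> real) \<Rightarrow> real \<Rightarrow> real \<Rightarrow> real" where
  "Uec \<theta> a b = integral {0..1} (\<lambda>s. the_inv (deriv \<theta>) (s * deriv \<theta> b + (1 - s) * deriv \<theta> a))"

section \<open>Discretisation operators\<close>

definition basis ::
  "nat \<Rightarrow> (nat \<Rightarrow> real) \<Rightarrow> mesh \<Rightarrow> (real^2) set \<Rightarrow> nat \<Rightarrow> nat \<Rightarrow> real^2 \<Rightarrow> real" where
  "basis p \<xi> T \<kappa> i j x =
     (let z = the_inv_into ref_square (xmap p \<xi> T \<kappa>) x
      in poly (lagrange p \<xi> i) (z $ 1) * poly (lagrange p \<xi> j) (z $ 2))"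

text \<open>The value at \<open>x\<close>, from within the closed element \<open>\<kappa>\<close>, of the discrete function with DOFs \<open>W\<close>.\<close>

definition trace_from ::
  "nat \<Rightarrow> (nat \<Rightarrow> real) \<Rightarrow> mesh \<Rightarrow> ((real^2) set \<Rightarrow> nat \<Rightarrow> nat \<Rightarrow> real) \<Rightarrow>
   (real^2) set \<Rightarrow> real^2 \<Rightarrow> real" where
  "trace_from p \<xi> T W \<kappa> x = (\<Sum>i\<le>p. \<Sum>j\<le>p. basis p \<xi> T \<kappa> i j x * W \<kappa> i j)"

definition R_op ::
  "nat \<Rightarrow> (nat \<Rightarrow> real) \<Rightarrow> (nat \<Rightarrow> real) \<Rightarrow> mesh \<Rightarrow> (real \<Rightarrow> real^2) \<Rightarrow>
   (real \<Rightarrow> real \<Rightarrow> real^2 \<Rightarrow> real) \<Rightarrow> (real \<Rightarrow> real \<Rightarrow> real^2 \<Rightarrow> real) \<Rightarrow>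
   ((real^2) set \<Rightarrow> nat \<Rightarrow> nat \<Rightarrow> real) \<Rightarrow> (real^2) set \<Rightarrow> nat \<Rightarrow> nat \<Rightarrow> real" where
  "R_op p \<xi> \<omega> T f hec h W \<kappa> i j =
     2 * (\<omega> j * (\<Sum>k\<le>p. Qmat p \<xi> \<omega> i k * hec (W \<kappa> i j) (W \<kappa> k j) (nvol1 p \<xi> T \<kappa> i k j))
        + \<omega> i * (\<Sum>k\<le>p. Qmat p \<xi> \<omega> j k * hec (W \<kappa> i j) (W \<kappa> i k) (nvol2 p \<xi> T \<kappa> i j k)))
     + (\<Sum>e\<in>edges p \<xi> T \<kappa>. \<Sum>k\<le>p.
          basis p \<xi> T \<kappa> i j (emap T e (\<xi> k)) * \<omega> k * Jedge \<xi> T e k *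
          (h (W \<kappa> i j) (trace_from p \<xi> T W (neighbour p \<xi> T \<kappa> e) (emap T e (\<xi> k))) (enormal T \<kappa> e k)
           - f (W \<kappa> i j) \<bullet> enormal T \<kappa> e k))"

definition V_op ::
  "nat \<Rightarrow> (nat \<Rightarrow> real) \<Rightarrow> (nat \<Rightarrow> real) \<Rightarrow> mesh \<Rightarrow> ((real^2) set \<Rightarrow> real) \<Rightarrow>
   ((real^2) set \<Rightarrow> nat \<Rightarrow> nat \<Rightarrow> real) \<Rightarrow> (real^2) set \<Rightarrow> nat \<Rightarrow> nat \<Rightarrow> real" where
  "V_op p \<xi> \<omega> T dk W \<kappa> i j =
     dk \<kappa> * \<omega> i * \<omega> j * (\<Sum>k\<le>p.
        \<omega> k / 2 * norm (nvol1 p \<xi> T \<kappa> i k j) * (W \<kappa> i j - W \<kappa> k j)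
      + \<omega> k / 2 * norm (nvol2 p \<xi> T \<kappa> i j k) * (W \<kappa> i j - W \<kappa> i k))"

text \<open>\<open>w r\<close> is the value at $t_n^r$ and \<open>w0\<close> the value at $t_{n-1}^q$.\<close>

definition T_op ::
  "nat \<Rightarrow> (nat \<Rightarrow> real) \<Rightarrow> (nat \<Rightarrow> real) \<Rightarrow> (real \<Rightarrow> real) \<Rightarrow> real \<Rightarrow> real \<Rightarrow> (nat \<Rightarrow> real) \<Rightarrow> nat \<Rightarrow> real" where
  "T_op q \<tau> \<rho> \<theta> dn w0 w r =
     (\<Sum>l\<le>q. 2 * Qmat q \<tau> \<rho> r l * Uec \<theta> (w r) (w l))
     + (if r = 0 then w 0 - w0 else 0)
     + dn * \<rho> r * (\<Sum>l\<le>q. \<rho> l * (w r - w l))"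

text \<open>The space-time DGSEM on a slab of length \<open>dt\<close>. The unknown \<open>U\<close> maps \<open>(\<kappa>, i, j, r)\<close> to
  $U_\kappa^{ij}(t_n^r)$ and \<open>U0 \<kappa> i j\<close> is $U_\kappa^{ij}(t_{n-1}^q)$.\<close>

definition dof_index :: "nat \<Rightarrow> nat \<Rightarrow> mesh \<Rightarrow> ((real^2) set \<times> nat \<times> nat \<times> nat) set" where
  "dof_index p q T = elems T \<times> {..p} \<times> {..p} \<times> {..q}"

definition dgsem_slab ::
  "nat \<Rightarrow> (nat \<Rightarrow> real) \<Rightarrow> (nat \<Rightarrow> real) \<Rightarrow> nat \<Rightarrow> (nat \<Rightarrow> real) \<Rightarrow> (nat \<Rightarrow> real) \<Rightarrow> mesh \<Rightarrow>
   (real \<Rightarrow> real^2) \<Rightarrow> (real \<Rightarrow> real) \<Rightarrow> (real \<Rightarrow> real \<Rightarrow> real^2 \<Rightarrow> real) \<Rightarrow>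
   (real \<Rightarrow> real \<Rightarrow> real^2 \<Rightarrow> real) \<Rightarrow> ((real^2) set \<Rightarrow> real) \<Rightarrow> real \<Rightarrow> real \<Rightarrow>
   ((real^2) set \<Rightarrow> nat \<Rightarrow> nat \<Rightarrow> real) \<Rightarrow> ((real^2) set \<times> nat \<times> nat \<times> nat \<Rightarrow> real) \<Rightarrow> bool" where
  "dgsem_slab p \<xi> \<omega> q \<tau> \<rho> T f \<theta> hec h dk dn dt U0 U \<longleftrightarrow>
     (\<forall>\<kappa>\<in>elems T. \<forall>i\<le>p. \<forall>j\<le>p. \<forall>r\<le>q.
        \<omega> i * \<omega> j * Jdet p \<xi> T \<kappa> i j * T_op q \<tau> \<rho> \<theta> dn (U0 \<kappa> i j) (\<lambda>l. U (\<kappa>, i, j, l)) r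
        + \<rho> r * dt / 2 *
          (R_op p \<xi> \<omega> T f hec h (\<lambda>\<kappa> i j. U (\<kappa>, i, j, r)) \<kappa> i j
           + V_op p \<xi> \<omega> T dk (\<lambda>\<kappa> i j. U (\<kappa>, i, j, r)) \<kappa> i j) = 0)"

end

theory Submission
  imports Defs
begin

text \<open>Existence. The graph viscosities dominate the off-diagonal derivatives of the entropy conservative
  fluxes, which are bounded by \<open>Lu * Lf\<close> in space and, strictly, by \<open>Lu\<close> in time. Hence every equation
  is nonincreasing in all unknowns but its own and Lipschitz in the latter. The constants \<open>m\<close> and \<open>M\<close>
  are a sub- and a supersolution by the metric identities, so a monotone iteration map has a greatest
  fixed point \<open>G\<close> in the box.

  Uniqueness. If \<open>U\<close> is another solution then \<open>U \<le> G\<close>. Summation by parts reduces the sum of the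
  equations over an element to the interface fluxes; these cancel between neighbours, whose normals are
  opposite because the elements would overlap otherwise. So the mass of \<open>G - U\<close> in the elements
  within a distance \<open>N H\<close> of the origin is at most a constant times its mass in two adjacent layers,
  and grows exponentially in \<open>N\<close> unless it vanishes. But it is bounded by the area of a disc of
  radius \<open>N H\<close>.\<close>

section \<open>Gauss-Lobatto rules\<close>

text \<open>The mesh may be infinite, so existence is drawn from order alone, and the mass of a
  difference over the whole mesh need not be finite; this is why uniqueness has to localise.
  Comparing with the greatest solution instead of an arbitrary one gives the difference a sign, so
  that its mass controls each of its values. The obstacle to localisation is time: the faces of a
  finite set of elements exchange mass at all time nodes, whereas the conserved quantity is the mass
  at the last one. The gap is closed by a factor \<open>K < 1\<close> in the increments of
  \<open>Uec\<close>: even when \<open>dn\<close> equals its threshold, some dissipation is left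
  over, and in the equation at the last node it bounds the masses at all time nodes of the same
  element. The threshold in space needs no such margin. The factors 4 and 2 in the two thresholds
  are those for which the viscosity just matches the worst off-diagonal derivative. Geometry enters
  at two points that the definitions do not settle: neighbours may traverse a common edge in
  opposite directions, which requires the symmetry of the quadrature rule, and each normal is
  described only relative to its own element.\<close>

lemma gauss_lobatto_strict_mono_on:
  assumes "gauss_lobatto s \<xi> \<omega>"
  shows "strict_mono_on {..s} \<xi>"
proof (rule strict_mono_onI)
  fix k l assume kl: "k \<in> {..s}" "l \<in> {..s}" "k < l"
  have "\<xi> k < \<xi> l" if "k < l" "l \<le> s" for l
    using that
  proof (induction l)
    case 0 then show ?case by simp
  next
    case (Suc l)
    have step: "\<xi> l < \<xi> (Suc l)" using assms Suc.prems by (simp add: gauss_lobatto_def)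
    show ?case
    proof (cases "k = l")
      case True then show ?thesis using step by simp
    next
      case False then show ?thesis using Suc step by (simp add: less_Suc_eq)
    qed
  qed
  then show "\<xi> k < \<xi> l" using kl by simp
qed

lemma gauss_lobatto_inj_on:
  assumes "gauss_lobatto s \<xi> \<omega>"
  shows "inj_on \<xi> {..s}"
  using gauss_lobatto_strict_mono_on[OF assms] by (rule strict_mono_on_imp_inj_on)

lemma gauss_lobatto_node_bounds:
  assumes "gauss_lobatto s \<xi> \<omega>" "k \<le> s"
  shows "-1 \<le> \<xi> k" "\<xi> k \<le> 1"
proof -
  have le: "\<xi> a \<le> \<xi> b" if "a \<le> b" "b \<le> s" for a b
    using strict_mono_onD[OF gauss_lobatto_strict_mono_on[OF assms(1)], of a b] that
    by (cases "a = b") auto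
  show "-1 \<le> \<xi> k" "\<xi> k \<le> 1"
    using le[of 0 k] le[of k s] assms by (auto simp: gauss_lobatto_def)
qed

lemma gauss_lobatto_weight_pos: "gauss_lobatto s \<xi> \<omega> \<Longrightarrow> k \<le> s \<Longrightarrow> 0 < \<omega> k"
  by (simp add: gauss_lobatto_def)

lemma gauss_lobatto_exact:
  "gauss_lobatto s \<xi> \<omega> \<Longrightarrow> degree P \<le> 2 * s - 1 \<Longrightarrow>
     (\<Sum>k\<le>s. \<omega> k * poly P (\<xi> k)) = integral {-1..1} (poly P)"
  by (simp add: gauss_lobatto_def)

lemma poly_lagrange_node:
  assumes "inj_on \<xi> {..s}" "k \<le> s" "l \<le> s"
  shows "poly (lagrange s \<xi> k) (\<xi> l) = (if k = l then 1 else 0)"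
proof (cases "k = l")
  case True
  have "poly (smult (1 / (\<xi> k - \<xi> l')) [:- \<xi> l', 1:]) (\<xi> l) = 1" if "l' \<in> {..s} - {k}" for l'
  proof -
    have "\<xi> k - \<xi> l' \<noteq> 0" using that assms inj_onD[OF assms(1), of k l'] by auto
    then show ?thesis using True by (simp add: diff_divide_distrib[symmetric])
  qed
  then show ?thesis using True by (simp add: lagrange_def poly_prod)
next
  case False
  then show ?thesis using assms by (auto simp: lagrange_def poly_prod intro!: prod_zero)
qed

lemma degree_lagrange_le:
  assumes "k \<le> s"
  shows "degree (lagrange s \<xi> k) \<le> s"
proof -
  have "degree (lagrange s \<xi> k) \<le>
      (\<Sum>l\<in>{..s} - {k}. degree (smult (1 / (\<xi> k - \<xi> l)) [:- \<xi> l, 1:]))"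
    using degree_prod_sum_le[of "{..s} - {k}" "\<lambda>l. smult (1 / (\<xi> k - \<xi> l)) [:- \<xi> l, 1:]"]
    by (simp add: lagrange_def o_def del: degree_smult_eq)
  also have "\<dots> \<le> (\<Sum>l\<in>{..s} - {k}. 1)"
    by (rule sum_mono) simp
  also have "\<dots> = s" using assms by simp
  finally show ?thesis .
qed

lemma lagrange_interpolation:
  assumes "inj_on \<xi> {..s}" "degree P \<le> s"
  shows "P = (\<Sum>k\<le>s. smult (poly P (\<xi> k)) (lagrange s \<xi> k))"
proof (rule poly_eqI_degree[of "\<xi> ` {..s}"])
  show "poly P x = poly (\<Sum>k\<le>s. smult (poly P (\<xi> k)) (lagrange s \<xi> k)) x" if "x \<in> \<xi> ` {..s}" for x
    using that assms(1)
    by (auto simp: poly_sum poly_lagrange_node if_distrib[where f = "\<lambda>x. _ * x"] cong: if_cong)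
  have "degree (\<Sum>k\<le>s. smult (poly P (\<xi> k)) (lagrange s \<xi> k)) \<le> s"
    by (rule degree_sum_le) (auto simp: degree_lagrange_le)
  then show "degree (\<Sum>k\<le>s. smult (poly P (\<xi> k)) (lagrange s \<xi> k)) < card (\<xi> ` {..s})"
    using assms by (simp add: card_image)
  show "degree P < card (\<xi> ` {..s})" using assms by (simp add: card_image)
qed

lemma pderiv_sum_distrib: "pderiv (sum P A) = (\<Sum>i\<in>A. pderiv (P i))"
  by (induction A rule: infinite_finite_induct) (simp_all add: pderiv_add)

text \<open>The Lagrange polynomials sum to \<open>1\<close>, so the derivative matrix annihilates
  constants; a constant state then produces no volume term in time.\<close>

lemma Dmat_row_sum:
  assumes "inj_on \<xi> {..s}"
  shows "(\<Sum>l\<le>s. Dmat s \<xi> k l) = 0"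
proof -
  have "(\<Sum>l\<le>s. lagrange s \<xi> l) = 1"
    using lagrange_interpolation[OF assms, of 1] by simp
  then have "pderiv (\<Sum>l\<le>s. lagrange s \<xi> l) = 0" by simp
  then have "poly (\<Sum>l\<le>s. pderiv (lagrange s \<xi> l)) (\<xi> k) = 0" by (simp add: pderiv_sum_distrib)
  then show ?thesis by (simp add: Dmat_def poly_sum)
qed

text \<open>The integrand has degree at most \<open>s + (s - 1)\<close>, exactly the degree up to
  which the rule is exact.\<close>

lemma Qmat_eq_integral:
  assumes gl: "gauss_lobatto s \<xi> \<omega>" and s: "1 \<le> s" and kl: "k \<le> s" "l \<le> s"
  shows "Qmat s \<xi> \<omega> k l = integral {-1..1} (poly (lagrange s \<xi> k * pderiv (lagrange s \<xi> l)))"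
proof -
  have "degree (lagrange s \<xi> k * pderiv (lagrange s \<xi> l)) \<le> s + (s - 1)"
    using degree_mult_le[of "lagrange s \<xi> k" "pderiv (lagrange s \<xi> l)"]
      degree_lagrange_le[OF kl(1), of \<xi>] degree_lagrange_le[OF kl(2), of \<xi>]
      degree_pderiv[of "lagrange s \<xi> l"] by linarith
  then have deg: "degree (lagrange s \<xi> k * pderiv (lagrange s \<xi> l)) \<le> 2 * s - 1" using s by simp
  have "integral {-1..1} (poly (lagrange s \<xi> k * pderiv (lagrange s \<xi> l))) =
     (\<Sum>j\<le>s. \<omega> j * (poly (lagrange s \<xi> k) (\<xi> j) * poly (pderiv (lagrange s \<xi> l)) (\<xi> j)))"
    using gauss_lobatto_exact[OF gl deg] by simp
  also have "\<dots> = (\<Sum>j\<le>s. if k = j then Qmat s \<xi> \<omega> k l else 0)"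
    by (rule sum.cong) (auto simp: poly_lagrange_node[OF gauss_lobatto_inj_on[OF gl]] kl Qmat_def Dmat_def)
  finally show ?thesis using kl by simp
qed

text \<open>Integration by parts for two Lagrange polynomials. The end points are nodes, so the
  boundary term is a difference of Kronecker deltas.\<close>

lemma Qmat_summation_by_parts:
  assumes gl: "gauss_lobatto s \<xi> \<omega>" and s: "1 \<le> s" and kl: "k \<le> s" "l \<le> s"
  shows "Qmat s \<xi> \<omega> k l + Qmat s \<xi> \<omega> l k =
    (if k = l \<and> k = s then 1 else 0) - (if k = l \<and> k = 0 then 1 else 0)"
proof -
  let ?P = "lagrange s \<xi> k" and ?R = "lagrange s \<xi> l"
  have "(poly (pderiv (?P * ?R)) has_integral poly (?P * ?R) 1 - poly (?P * ?R) (-1)) {-1..1}"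
    by (rule fundamental_theorem_of_calculus)
       (auto intro!: has_field_derivative_at_within poly_DERIV
             simp: has_real_derivative_iff_has_vector_derivative[symmetric] simp del: poly_mult)
  then have "integral {-1..1} (poly (pderiv (?P * ?R))) = poly (?P * ?R) 1 - poly (?P * ?R) (-1)"
    by (rule integral_unique)
  moreover have "integral {-1..1} (poly (pderiv (?P * ?R))) =
     integral {-1..1} (poly (?P * pderiv ?R)) + integral {-1..1} (poly (?R * pderiv ?P))"
  proof -
    have "integral {-1..1} (poly (pderiv (?P * ?R))) =
      integral {-1..1} (\<lambda>x. poly (?P * pderiv ?R) x + poly (?R * pderiv ?P) x)"
      by (rule integral_cong) (simp add: pderiv_mult)
    also have "\<dots> = integral {-1..1} (poly (?P * pderiv ?R)) + integral {-1..1} (poly (?R * pderiv ?P))"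
      by (rule Henstock_Kurzweil_Integration.integral_add)
         (auto intro!: integrable_continuous_interval continuous_intros)
    finally show ?thesis .
  qed
  moreover have "poly (?P * ?R) 1 = (if k = l \<and> k = s then 1 else 0)"
    using poly_lagrange_node[OF gauss_lobatto_inj_on[OF gl], of k s]
      poly_lagrange_node[OF gauss_lobatto_inj_on[OF gl], of l s] kl gl
    by (auto simp: gauss_lobatto_def)
  moreover have "poly (?P * ?R) (-1) = (if k = l \<and> k = 0 then 1 else 0)"
    using poly_lagrange_node[OF gauss_lobatto_inj_on[OF gl], of k 0]
      poly_lagrange_node[OF gauss_lobatto_inj_on[OF gl], of l 0] kl gl
    by (auto simp: gauss_lobatto_def)
  ultimately show ?thesis by (simp add: Qmat_eq_integral[OF gl s] kl)
qed

lemma max_D_over_weight_ge: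
  assumes "k \<le> s" "l \<le> s" "k \<noteq> l"
  shows "\<bar>Dmat s \<xi> k l\<bar> / \<omega> l \<le> max_D_over_weight s \<xi> \<omega>"
proof -
  have "finite ((\<lambda>(k, l). \<bar>Dmat s \<xi> k l\<bar> / \<omega> l) ` ({..s} \<times> {..s}))" by simp
  then have "finite {\<bar>Dmat s \<xi> k l\<bar> / \<omega> l | k l. k \<le> s \<and> l \<le> s \<and> k \<noteq> l}"
    by (rule finite_subset[rotated]) force
  then show ?thesis unfolding max_D_over_weight_def by (rule Max_ge) (use assms in blast)
qed

text \<open>Otherwise the vanishing sum of row \<open>s\<close> would make its diagonal entry
  \<open>0\<close>, whereas summation by parts makes twice the entry of \<open>Qmat\<close> there
  equal to \<open>1\<close>. Positivity is needed for strict dissipation in time.\<close>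

lemma max_D_over_weight_pos:
  assumes gl: "gauss_lobatto s \<xi> \<omega>" and s: "1 \<le> s"
  shows "0 < max_D_over_weight s \<xi> \<omega>"
proof -
  have "\<exists>l\<le>s. l \<noteq> s \<and> Dmat s \<xi> s l \<noteq> 0"
  proof (rule ccontr)
    assume "\<not> ?thesis"
    then have "(\<Sum>l\<le>s. Dmat s \<xi> s l) = (\<Sum>l\<le>s. if l = s then Dmat s \<xi> s s else 0)"
      by (intro sum.cong) auto
    then have "Dmat s \<xi> s s = 0" using Dmat_row_sum[OF gauss_lobatto_inj_on[OF gl], of s] by simp
    then show False using Qmat_summation_by_parts[OF gl s, of s s] s by (simp add: Qmat_def)
  qed
  then obtain l where l: "l \<le> s" "l \<noteq> s" "Dmat s \<xi> s l \<noteq> 0" by blast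
  then have "0 < \<bar>Dmat s \<xi> s l\<bar> / \<omega> l" using gauss_lobatto_weight_pos[OF gl] by simp
  also have "\<dots> \<le> max_D_over_weight s \<xi> \<omega>" using l by (intro max_D_over_weight_ge) auto
  finally show ?thesis .
qed

section \<open>Uniqueness and symmetry of the Gauss-Lobatto rule\<close>

lemma gauss_lobatto_reflect:
  assumes gl: "gauss_lobatto s \<xi> \<omega>"
  shows "gauss_lobatto s (\<lambda>k. - \<xi> (s - k)) (\<lambda>k. \<omega> (s - k))"
proof -
  have "(\<Sum>k\<le>s. \<omega> (s - k) * poly P (- \<xi> (s - k))) = integral {-1..1} (poly P)"
    if deg: "degree P \<le> 2 * s - 1" for P :: "real poly"
  proof -
    let ?P = "P \<circ>\<^sub>p [:0, -1:]"
    have "(\<Sum>k\<le>s. \<omega> (s - k) * poly P (- \<xi> (s - k))) = (\<Sum>k\<le>s. \<omega> k * poly P (- \<xi> k))"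
      by (rule sum.reindex_bij_witness[of _ "\<lambda>k. s - k" "\<lambda>k. s - k"]) auto
    also have "\<dots> = (\<Sum>k\<le>s. \<omega> k * poly ?P (\<xi> k))" by (simp add: poly_pcompose)
    also have "\<dots> = integral {-1..1} (poly ?P)"
      by (rule gauss_lobatto_exact[OF gl]) (use deg in \<open>simp add: degree_pcompose\<close>)
    also have "\<dots> = integral {-1..1} (\<lambda>x. poly P (- x))"
      by (rule integral_cong) (simp add: poly_pcompose)
    also have "\<dots> = integral {-1..1} (poly P)"
      using Henstock_Kurzweil_Integration.integral_reflect_real[of 1 "-1" "poly P"] by simp
    finally show ?thesis .
  qed
  moreover have "- \<xi> (s - k) < - \<xi> (s - Suc k)" if "k < s" for k
    using gl that by (auto simp: gauss_lobatto_def Suc_diff_Suc dest!: spec[of _ "s - Suc k"])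
  ultimately show ?thesis using gl by (simp add: gauss_lobatto_def)
qed

text \<open>Two rules have monic interior node polynomials whose difference is orthogonal to itself with
  respect to the weight $1 - x^2$; exactness turns this into a vanishing sum of squares.\<close>

lemma gauss_lobatto_nodes_unique:
  assumes gl: "gauss_lobatto s \<xi> \<omega>" and gl': "gauss_lobatto s \<eta> \<mu>" and s: "1 \<le> s"
  shows "\<xi> ` {..s} = \<eta> ` {..s}"
proof -
  define \<pi> where "\<pi> \<xi> = (\<Prod>k\<in>{0<..<s}. [:- \<xi> k, 1:] :: real poly)" for \<xi>
  have deg: "degree (\<pi> \<xi>) = s - 1" and lead: "lead_coeff (\<pi> \<xi>) = 1" for \<xi>
  proof -
    have "degree (\<pi> \<xi>) = (\<Sum>k\<in>{0<..<s}. degree [:- \<xi> k, 1:])"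
      unfolding \<pi>_def by (rule degree_prod_eq_sum_degree) auto
    then show "degree (\<pi> \<xi>) = s - 1" by simp
    show "lead_coeff (\<pi> \<xi>) = 1" unfolding \<pi>_def by (simp add: lead_coeff_prod)
  qed
  have root: "poly (\<pi> \<xi>) (\<xi> k) = 0" if "0 < k" "k < s" for \<xi> k
    using that by (auto simp: \<pi>_def poly_prod intro!: prod_zero)
  define w :: "real poly" where "w = [:1, 0, -1:]"
  have w: "poly w x = 1 - x\<^sup>2" for x by (simp add: w_def power2_eq_square)
  have degw: "degree w = 2" by (simp add: w_def)
  define \<delta> where "\<delta> = \<pi> \<xi> - \<pi> \<eta>"
  have deg\<delta>: "\<delta> = 0 \<or> degree \<delta> < s - 1"
  proof -
    have "degree \<delta> \<le> s - 1" unfolding \<delta>_def by (rule degree_diff_le) (simp_all add: deg)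
    moreover have "coeff \<delta> (s - 1) = 0"
      using lead[of \<xi>] lead[of \<eta>] by (simp add: \<delta>_def deg)
    ultimately show ?thesis by (metis le_neq_implies_less leading_coeff_0_iff)
  qed
  \<comment> \<open>Degrees add up to \<open>2 + (s - 2) + (s - 1) = 2 * s - 1\<close>, so the rule
    is still exact. The integrand vanishes at the end points through \<open>w\<close> and at the
    interior nodes through their node polynomial.\<close>
  have orth: "integral {-1..1} (poly (w * \<delta> * \<pi> \<zeta>)) = 0" if "gauss_lobatto s \<zeta> \<nu>" for \<zeta> \<nu>
  proof (cases "\<delta> = 0")
    case True then show ?thesis by (simp add: poly_0[abs_def])
  next
    case False
    then have "degree \<delta> < s - 1" using deg\<delta> by simp
    then have "degree (w * \<delta> * \<pi> \<zeta>) \<le> 2 * s - 1"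
      using degree_mult_le[of "w * \<delta>" "\<pi> \<zeta>"] degree_mult_le[of w \<delta>] deg[of \<zeta>] degw by linarith
    then have "integral {-1..1} (poly (w * \<delta> * \<pi> \<zeta>)) = (\<Sum>k\<le>s. \<nu> k * poly (w * \<delta> * \<pi> \<zeta>) (\<zeta> k))"
      by (rule gauss_lobatto_exact[OF that, symmetric])
    also have "\<dots> = 0"
    proof (rule sum.neutral, rule ballI)
      fix k assume "k \<in> {..s}"
      then consider "k = 0" | "k = s" | "0 < k" "k < s" by fastforce
      then show "\<nu> k * poly (w * \<delta> * \<pi> \<zeta>) (\<zeta> k) = 0"
        by cases (use that in \<open>auto simp: gauss_lobatto_def w root\<close>)
    qed
    finally show ?thesis .
  qed
  have zero: "poly (w * \<delta>) (\<xi> k) = 0" if k: "k \<le> s" for k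
  proof (cases "\<delta> = 0")
    case True then show ?thesis by simp
  next
    case False
    then have "degree \<delta> < s - 1" using deg\<delta> by simp
    then have "degree (w * \<delta> * \<delta>) \<le> 2 * s - 1"
      using degree_mult_le[of "w * \<delta>" "\<delta>"] degree_mult_le[of w \<delta>] degw by linarith
    then have "(\<Sum>k\<le>s. \<omega> k * poly (w * \<delta> * \<delta>) (\<xi> k)) = integral {-1..1} (poly (w * \<delta> * \<delta>))"
      by (rule gauss_lobatto_exact[OF gl])
    also have "\<dots> = integral {-1..1} (\<lambda>x. poly (w * \<delta> * \<pi> \<xi>) x - poly (w * \<delta> * \<pi> \<eta>) x)"
      by (rule integral_cong) (simp add: \<delta>_def algebra_simps)
    also have "\<dots> = integral {-1..1} (poly (w * \<delta> * \<pi> \<xi>)) - integral {-1..1} (poly (w * \<delta> * \<pi> \<eta>))"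
      by (rule Henstock_Kurzweil_Integration.integral_diff)
         (auto intro!: integrable_continuous_interval continuous_intros)
    also have "\<dots> = 0" using orth[OF gl] orth[OF gl'] by simp
    finally have sum0: "(\<Sum>k\<le>s. \<omega> k * poly (w * \<delta> * \<delta>) (\<xi> k)) = 0" .
    have nonneg: "0 \<le> \<omega> k * poly (w * \<delta> * \<delta>) (\<xi> k)" if "k \<in> {..s}" for k
    proof -
      have "\<bar>\<xi> k\<bar> \<le> 1" using gauss_lobatto_node_bounds[OF gl, of k] that by simp
      then have "(\<xi> k)\<^sup>2 \<le> 1" by (simp add: abs_square_le_1)
      then show ?thesis using gauss_lobatto_weight_pos[OF gl, of k] that
        by (simp add: w mult.assoc)
    qed
    have "\<forall>k\<in>{..s}. \<omega> k * poly (w * \<delta> * \<delta>) (\<xi> k) = 0"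
      using sum0 by (subst (asm) sum_nonneg_eq_0_iff) (use nonneg in auto)
    then have "\<omega> k * poly (w * \<delta> * \<delta>) (\<xi> k) = 0" using k by blast
    then show ?thesis using gauss_lobatto_weight_pos[OF gl, of k] k by auto
  qed
  have sub: "\<xi> ` {..s} \<subseteq> \<eta> ` {..s}"
  proof (rule image_subsetI)
    fix k assume "k \<in> {..s}"
    then have k: "k \<le> s" by simp
    consider "k = 0" | "k = s" | "0 < k" "k < s" using k by fastforce
    then show "\<xi> k \<in> \<eta> ` {..s}"
    proof cases
      case 1 then show ?thesis using gl gl' by (auto simp: gauss_lobatto_def intro!: image_eqI[of _ _ 0])
    next
      case 2 then show ?thesis using gl gl' by (auto simp: gauss_lobatto_def intro!: image_eqI[of _ _ s])
    next
      case 3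
      \<comment> \<open>At an interior node \<open>w\<close> is nonzero, so \<open>\<delta>\<close>
        vanishes there, and a common root of \<open>\<pi> \<xi>\<close> and \<open>\<delta>\<close>
        is a root of \<open>\<pi> \<eta>\<close>.\<close>
      have "-1 < \<xi> k" "\<xi> k < 1"
        using strict_mono_onD[OF gauss_lobatto_strict_mono_on[OF gl], of 0 k]
          strict_mono_onD[OF gauss_lobatto_strict_mono_on[OF gl], of k s] 3 gl
        by (auto simp: gauss_lobatto_def)
      then have "(\<xi> k)\<^sup>2 < 1" by (simp add: abs_square_less_1)
      then have "poly \<delta> (\<xi> k) = 0" using zero[OF k] by (simp add: w)
      then have "poly (\<pi> \<eta>) (\<xi> k) = 0" using root[of k \<xi>] 3 by (simp add: \<delta>_def)
      then obtain l where "0 < l" "l < s" "\<xi> k = \<eta> l" by (auto simp: \<pi>_def poly_prod)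
      then show ?thesis by auto
    qed
  qed
  then show ?thesis
    by (rule card_subset_eq[rotated])
       (simp_all add: card_image gauss_lobatto_inj_on[OF gl] gauss_lobatto_inj_on[OF gl'])
qed

text \<open>Both enumerations end with the maximum of the common image; removing it leaves the claim
  for \<open>s\<close>.\<close>

lemma strict_mono_on_image_eq_imp_eq:
  fixes a b :: "nat \<Rightarrow> real"
  assumes "strict_mono_on {..s} a" "strict_mono_on {..s} b" "a ` {..s} = b ` {..s}" "k \<le> s"
  shows "a k = b k"
  using assms
proof (induction s arbitrary: k)
  case 0 then show ?case by simp
next
  case (Suc s)
  have top: "c (Suc s) = Max (c ` {..Suc s})" if "strict_mono_on {..Suc s} c" for c :: "nat \<Rightarrow> real"
    using strict_mono_onD[OF that, of _ "Suc s"]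
    by (intro Max_eqI[symmetric]) (auto simp: le_Suc_eq less_imp_le)
  have eq: "a (Suc s) = b (Suc s)" using top Suc.prems by metis
  have less: "c ` {..s} = c ` {..Suc s} - {c (Suc s)}" if "strict_mono_on {..Suc s} c" for c :: "nat \<Rightarrow> real"
  proof -
    have "c k \<noteq> c (Suc s)" if "k \<le> s" for k
      using strict_mono_onD[OF \<open>strict_mono_on {..Suc s} c\<close>, of k "Suc s"] that by simp
    then show ?thesis by (force simp: atMost_Suc)
  qed
  have "a ` {..s} = b ` {..s}" using less[OF Suc.prems(1)] less[OF Suc.prems(2)] Suc.prems(3) eq by simp
  moreover have "strict_mono_on {..s} a" "strict_mono_on {..s} b"
    using Suc.prems(1,2) by (auto simp: strict_mono_on_def)
  ultimately show ?case using Suc.IH[of k] eq Suc.prems(4) by (cases "k = Suc s") auto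
qed

lemma gauss_lobatto_unique:
  assumes gl: "gauss_lobatto s \<xi> \<omega>" and gl': "gauss_lobatto s \<eta> \<mu>" and s: "1 \<le> s" and k: "k \<le> s"
  shows "\<xi> k = \<eta> k" "\<omega> k = \<mu> k"
proof -
  have eq: "\<xi> k = \<eta> k" if "k \<le> s" for k
    using strict_mono_on_image_eq_imp_eq[OF gauss_lobatto_strict_mono_on[OF gl]
        gauss_lobatto_strict_mono_on[OF gl'] gauss_lobatto_nodes_unique[OF gl gl' s] that] .
  show "\<xi> k = \<eta> k" using eq k by simp
  \<comment> \<open>Exactness on one Lagrange polynomial singles out one weight; its degree
    \<open>s\<close> is admissible since \<open>s \<le> 2 * s - 1\<close>.\<close>
  have weight: "\<nu> k = integral {-1..1} (poly (lagrange s \<zeta> k))" if "gauss_lobatto s \<zeta> \<nu>" for \<zeta> \<nu>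
  proof -
    have "(\<Sum>l\<le>s. \<nu> l * poly (lagrange s \<zeta> k) (\<zeta> l)) = integral {-1..1} (poly (lagrange s \<zeta> k))"
      by (rule gauss_lobatto_exact[OF that]) (use degree_lagrange_le[OF k, of \<zeta>] s in linarith)
    moreover have "(\<Sum>l\<le>s. \<nu> l * poly (lagrange s \<zeta> k) (\<zeta> l)) = (\<Sum>l\<le>s. if k = l then \<nu> l else 0)"
      by (rule sum.cong) (auto simp: poly_lagrange_node[OF gauss_lobatto_inj_on[OF that]] k)
    ultimately show ?thesis using k by simp
  qed
  have "lagrange s \<xi> k = lagrange s \<eta> k"
    using eq k unfolding lagrange_def by (intro prod.cong) auto
  then show "\<omega> k = \<mu> k" using weight[OF gl] weight[OF gl'] by simp
qed

text \<open>The reflected rule is again a Gauss-Lobatto rule, hence the same one. This is needed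
  where an edge is traversed against the numbering of an element.\<close>

lemma gauss_lobatto_symmetric:
  assumes "gauss_lobatto s \<xi> \<omega>" "1 \<le> s" "k \<le> s"
  shows "\<xi> (s - k) = - \<xi> k" "\<omega> (s - k) = \<omega> k"
  using gauss_lobatto_unique[OF assms(1) gauss_lobatto_reflect[OF assms(1)] assms(2,3)] by simp_all

section \<open>Entropy conservative two-point functions\<close>

text \<open>The difference quotients below have no derivative formula at the diagonal point
  \<open>a\<close>. An interval around \<open>a\<close> is split there, and continuity lets the mean
  value theorem reach that end point.\<close>

lemma increment_bounds_off_point:
  fixes \<phi> :: "real \<Rightarrow> real"
  assumes cont: "continuous_on {m..M} \<phi>"
    and der: "\<And>x. x \<in> {m..M} \<Longrightarrow> x \<noteq> a \<Longrightarrow> (\<phi> has_real_derivative \<phi>' x) (at x)"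
    and bnd: "\<And>x. x \<in> {m..M} \<Longrightarrow> x \<noteq> a \<Longrightarrow> l \<le> \<phi>' x \<and> \<phi>' x \<le> u"
    and b: "b \<in> {m..M}" "b' \<in> {m..M}" "b \<le> b'"
  shows "l * (b' - b) \<le> \<phi> b' - \<phi> b \<and> \<phi> b' - \<phi> b \<le> u * (b' - b)"
proof -
  have main: "l * (y - x) \<le> \<phi> y - \<phi> x \<and> \<phi> y - \<phi> x \<le> u * (y - x)"
    if xy: "x \<in> {m..M}" "y \<in> {m..M}" "x \<le> y" and a: "a \<notin> {x<..<y}" for x y
  proof (cases "x = y")
    case True then show ?thesis by simp
  next
    case False
    then have "x < y" using xy by simp
    moreover have "continuous_on {x..y} \<phi>" by (rule continuous_on_subset[OF cont]) (use xy in auto)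
    moreover have "\<phi> differentiable (at z)" if "x < z" "z < y" for z
      using der[of z] that xy a real_differentiable_def by fastforce
    ultimately obtain d z where z: "x < z" "z < y" "(\<phi> has_real_derivative d) (at z)"
      "\<phi> y - \<phi> x = (y - x) * d"
      using MVT[of x y \<phi>] by blast
    have zm: "z \<in> {m..M}" "z \<noteq> a" using z xy a by auto
    have "d = \<phi>' z" using DERIV_unique[OF z(3) der[OF zm]] .
    then have "l \<le> d \<and> d \<le> u" using bnd[OF zm] by simp
    then show ?thesis using z(4) \<open>x < y\<close> by (simp add: mult.commute[of "y - x"])
  qed
  show ?thesis
  proof (cases "a \<in> {b<..<b'}")
    case False then show ?thesis using main[of b b'] b by simp
  next
    case True
    then have "a \<in> {m..M}" using b by auto
    then show ?thesis using main[of b a] main[of a b'] True b by (auto simp: algebra_simps)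
  qed
qed

section \<open>The entropy variable and the two-point function in time\<close>

locale entropy_on_interval =
  fixes f :: "real \<Rightarrow> real^2" and \<theta> :: "real \<Rightarrow> real" and g :: "real \<Rightarrow> real^2" and m M :: real
  assumes entropy: "entropy_pair f \<theta> g" and mM: "m \<le> M"
begin

abbreviation v :: "real \<Rightarrow> real" where "v \<equiv> deriv \<theta>"
abbreviation v' :: "real \<Rightarrow> real" where "v' \<equiv> deriv (deriv \<theta>)"

lemma DERIV_theta: "(\<theta> has_real_derivative v u) (at u)"
  using entropy by (simp add: entropy_pair_def DERIV_deriv_iff_field_differentiable)

lemma DERIV_v: "(v has_real_derivative v' u) (at u)"
  using entropy by (simp add: entropy_pair_def DERIV_deriv_iff_field_differentiable)

lemma v'_pos: "0 < v' u"
  using entropy by (simp add: entropy_pair_def)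

lemma v_strict_mono: "a < b \<Longrightarrow> v a < v b"
  by (rule DERIV_pos_imp_increasing) (use DERIV_v v'_pos in blast)+

lemma v_eq_iff: "v a = v b \<longleftrightarrow> a = b"
  using v_strict_mono by (metis linorder_neqE less_irrefl)

lemma slope_pos: "a \<noteq> b \<Longrightarrow> 0 < (v b - v a) / (b - a)"
  using v_strict_mono by (cases "a < b") (auto simp: zero_less_divide_iff not_less_iff_gr_or_eq)

lemma continuous_on_v: "continuous_on S v"
  using DERIV_v by (meson DERIV_isCont continuous_at_imp_continuous_on)

lemma v'_bounds:
  obtains c0 c1 where "0 < c0" "c0 \<le> c1" "\<And>u. u \<in> {m..M} \<Longrightarrow> c0 \<le> v' u \<and> v' u \<le> c1"
proof -
  have cont: "continuous_on {m..M} v'"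
    using entropy continuous_on_subset by (auto simp: entropy_pair_def)
  obtain x where x: "x \<in> {m..M}" "\<And>u. u \<in> {m..M} \<Longrightarrow> v' x \<le> v' u"
    using continuous_attains_inf[OF _ _ cont] mM by auto
  obtain y where y: "y \<in> {m..M}" "\<And>u. u \<in> {m..M} \<Longrightarrow> v' u \<le> v' y"
    using continuous_attains_sup[OF _ _ cont] mM by auto
  show thesis by (rule that[of "v' x" "v' y"]) (use x y v'_pos in auto)
qed

lemma slope_bounds:
  assumes c: "\<And>u. u \<in> {m..M} \<Longrightarrow> c0 \<le> v' u \<and> v' u \<le> c1"
    and ab: "a \<in> {m..M}" "b \<in> {m..M}" "a \<noteq> b"
  shows "c0 \<le> (v b - v a) / (b - a) \<and> (v b - v a) / (b - a) \<le> c1"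
proof -
  have main: "c0 \<le> (v b - v a) / (b - a) \<and> (v b - v a) / (b - a) \<le> c1"
    if ab: "a < b" "a \<in> {m..M}" "b \<in> {m..M}" for a b
  proof -
    obtain z where z: "a < z" "z < b" "v b - v a = (b - a) * v' z"
      using MVT2[OF ab(1), of v v'] DERIV_v by blast
    then have "(v b - v a) / (b - a) = v' z" using ab by simp
    then show ?thesis using c[of z] z ab by simp
  qed
  show ?thesis
  proof (cases "a < b")
    case True then show ?thesis using main ab by blast
  next
    case False
    then have "b < a" using ab by simp
    moreover have "(v b - v a) / (b - a) = (v a - v b) / (a - b)"
      by (metis minus_diff_eq minus_divide_divide)
    ultimately show ?thesis using main[of b a] ab by simp
  qed
qed

text \<open>A real supremum bounds its set only if the set is bounded above; the ratio of the
  extreme values of \<open>v'\<close> on \<open>{m..M}\<close> provides such a bound.\<close>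

lemma Lu_ge:
  assumes "a \<in> {m..M}" "b \<in> {m..M}" "a \<noteq> b"
  shows "v' b * (b - a) / (v b - v a) \<le> Lu \<theta> m M"
proof -
  obtain c0 c1 where c: "0 < c0" "c0 \<le> c1" "\<And>u. u \<in> {m..M} \<Longrightarrow> c0 \<le> v' u \<and> v' u \<le> c1"
    using v'_bounds by blast
  have "v' b * (b - a) / (v b - v a) \<le> c1 / c0" if "a \<in> {m..M}" "b \<in> {m..M}" "b \<noteq> a" for a b
  proof -
    have "v' b * (b - a) / (v b - v a) = v' b / ((v b - v a) / (b - a))" by simp
    also have "\<dots> \<le> c1 / c0"
      by (rule frac_le) (use c slope_bounds[OF c(3), of a b] that v'_pos[of b] in auto)
    finally show ?thesis .
  qed
  then have "bdd_above (insert 0 {v' b * (b - a) / (v b - v a) | a b. a \<in> {m..M} \<and> b \<in> {m..M} \<and> b \<noteq> a})"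
    using c by (intro bdd_aboveI[of _ "max 0 (c1 / c0)"]) fastforce
  then show ?thesis unfolding Lu_def by (rule cSup_upper[rotated]) (use assms in blast)
qed

lemma Lu_quotient_pos: "a \<noteq> b \<Longrightarrow> 0 < v' b * (b - a) / (v b - v a)"
proof -
  assume "a \<noteq> b"
  then have "0 < (b - a) / (v b - v a)" using slope_pos[of a b] by (auto simp: zero_less_divide_iff)
  then have "0 < v' b * ((b - a) / (v b - v a))" using v'_pos[of b] by (intro mult_pos_pos)
  then show "0 < v' b * (b - a) / (v b - v a)" by simp
qed

lemma Lu_pos:
  assumes "m < M"
  shows "0 < Lu \<theta> m M"
  using Lu_quotient_pos[of m M] Lu_ge[of m M] assms by auto

text \<open>With one state fixed, both two-point functions are increments of a potential
  \<open>Z\<close> divided by increments of \<open>v\<close>. The quotient rule makes the derivative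
  proportional to \<open>y - E\<close>, the gap between the diagonal value and the two-point
  value.\<close>

lemma entropy_quotient_DERIV:
  assumes E: "\<And>b. (v b - v a) * E b = Z b - Z a"
    and Z: "\<And>b. (Z has_real_derivative v' b * y b) (at b)"
    and x: "x \<noteq> a"
  shows "(E has_real_derivative v' x * (y x - E x) / (v x - v a)) (at x)"
proof -
  have nz: "v x - v a \<noteq> 0" using v_eq_iff[of x a] x by simp
  have "((\<lambda>x. (Z x - Z a) / (v x - v a)) has_real_derivative
      (v' x * y x * (v x - v a) - (Z x - Z a) * v' x) / ((v x - v a) * (v x - v a))) (at x)"
    using nz by (auto intro!: derivative_eq_intros Z DERIV_v)
  moreover have "(v' x * y x * (v x - v a) - (Z x - Z a) * v' x) / ((v x - v a) * (v x - v a)) =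
      v' x * (y x - E x) / (v x - v a)"
  proof -
    have "v' x * y x * (v x - v a) - (Z x - Z a) * v' x = (v x - v a) * (v' x * (y x - E x))"
      unfolding E[of x, symmetric] by (simp add: algebra_simps)
    then show ?thesis using nz by simp
  qed
  ultimately have "((\<lambda>x. (Z x - Z a) / (v x - v a)) has_real_derivative
      v' x * (y x - E x) / (v x - v a)) (at x)" by simp
  then show ?thesis
  proof (rule has_field_derivative_transform_within_open[where S = "- {a}"])
    show "(Z z - Z a) / (v z - v a) = E z" if "z \<in> - {a}" for z
      using E[of z] v_eq_iff[of z a] that by (simp add: field_simps)
  qed (use x in auto)
qed

text \<open>\<open>E\<close> is a two-point function with one state fixed, and \<open>y\<close> its value on the diagonal. For
  \<open>b \<noteq> a\<close> its derivative is the product of the quotient in the definition of \<open>Lu\<close> and of the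
  quotient bounded in \<open>bnd\<close>.\<close>

lemma entropy_quotient_increment:
  assumes E: "\<And>b. (v b - v a) * E b = Z b - Z a"
    and Z: "\<And>b. (Z has_real_derivative v' b * y b) (at b)"
    and cont: "continuous_on {m..M} E"
    and a: "a \<in> {m..M}"
    and bnd: "\<And>b. b \<in> {m..M} \<Longrightarrow> b \<noteq> a \<Longrightarrow> l \<le> (y b - E b) / (b - a) \<and> (y b - E b) / (b - a) \<le> u"
    and lu: "l \<le> 0" "0 \<le> u"
    and b: "b \<in> {m..M}" "b' \<in> {m..M}" "b \<le> b'"
  shows "Lu \<theta> m M * l * (b' - b) \<le> E b' - E b \<and> E b' - E b \<le> Lu \<theta> m M * u * (b' - b)"
proof (rule increment_bounds_off_point[OF cont _ _ b])
  fix x assume x: "x \<in> {m..M}" "x \<noteq> a"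
  show "(E has_real_derivative v' x * (y x - E x) / (v x - v a)) (at x)"
    by (rule entropy_quotient_DERIV[OF E Z x(2)])
  let ?R = "v' x * (x - a) / (v x - v a)" and ?t = "(y x - E x) / (x - a)"
  have eq: "v' x * (y x - E x) / (v x - v a) = ?R * ?t" using x by simp
  have R: "0 < ?R" "?R \<le> Lu \<theta> m M" using Lu_quotient_pos[of a x] Lu_ge[OF a x(1)] x by auto
  have t: "l \<le> ?t" "?t \<le> u" using bnd[OF x] by auto
  \<comment> \<open>Since \<open>l \<le> 0 \<le> u\<close>, the positive factor \<open>?R\<close>
    may be enlarged to \<open>Lu\<close> in both inequalities.\<close>
  have "?R * ?t \<le> ?R * u" using R t by (intro mult_left_mono) auto
  moreover have "?R * u \<le> Lu \<theta> m M * u" using R lu by (intro mult_right_mono) auto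
  moreover have "?R * l \<le> ?R * ?t" using R t by (intro mult_left_mono) auto
  moreover have "Lu \<theta> m M * l \<le> ?R * l" using R lu by (intro mult_right_mono_neg) auto
  ultimately show "Lu \<theta> m M * l \<le> v' x * (y x - E x) / (v x - v a) \<and>
      v' x * (y x - E x) / (v x - v a) \<le> Lu \<theta> m M * u" unfolding eq by linarith
qed

text \<open>As a function of \<open>x = v w\<close>, the expression
  \<open>w * v w - \<theta> w\<close> is the Legendre transform of \<open>\<theta>\<close>, whose
  derivative is the inverse of \<open>v\<close>. This derivative is integrated along the segment
  from \<open>v a\<close> to \<open>v b\<close>.\<close>

lemma Uec_quotient: "(v b - v a) * Uec \<theta> a b = (b * v b - \<theta> b) - (a * v a - \<theta> a)"
proof -
  let ?u = "the_inv v" and ?Y = "\<lambda>w. w * v w - \<theta> w" and ?x = "\<lambda>s. s * v b + (1 - s) * v a"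
  have inv: "?u (v w) = w" for w
    by (rule the_inv_f_f) (auto intro!: injI simp: v_eq_iff)
  have Y: "(?Y has_real_derivative w * v' w) (at w)" for w
    by (auto intro!: derivative_eq_intros DERIV_v DERIV_theta)
  have u: "(?u has_real_derivative inverse (v' w)) (at (v w))" for w
    unfolding has_field_derivative_def
    by (rule has_derivative_inverse_strong[where S = UNIV and f = v and f' = "(*) (v' w)"])
       (use DERIV_v[of w, unfolded has_field_derivative_def] v'_pos[of w] continuous_on_v inv in
         \<open>auto simp: fun_eq_iff\<close>)
  have Yu: "((\<lambda>x. ?Y (?u x)) has_real_derivative ?u (v w)) (at (v w))" for w
    using DERIV_chain2[OF Y[of "?u (v w)"] u[of w]] v'_pos[of w]
    by (simp add: inv mult.assoc less_imp_neq[symmetric])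
  have "((\<lambda>s. ?Y (?u (?x s))) has_vector_derivative ?u (?x s) * (v b - v a)) (at s within {0..1})"
    if "s \<in> {0..1}" for s
  proof -
    \<comment> \<open>\<open>v\<close> need not be surjective, but by the intermediate value theorem
      it attains every value between \<open>v a\<close> and \<open>v b\<close>, so its inverse is
      meaningful there.\<close>
    have "?x s \<in> closed_segment (v a) (v b)"
      using that by (auto simp: in_segment algebra_simps intro!: exI[of _ s])
    then obtain w where "v w = ?x s" using IVT'_closed_segment_real[OF _ continuous_on_v] by blast
    then have "((\<lambda>x. ?Y (?u x)) has_real_derivative ?u (?x s)) (at (?x s))" using Yu[of w] by simp
    then have "((\<lambda>s. ?Y (?u (?x s))) has_real_derivative ?u (?x s) * (v b - v a)) (at s)"
      by (rule DERIV_chain2) (auto intro!: derivative_eq_intros)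
    then show ?thesis
      unfolding has_real_derivative_iff_has_vector_derivative[symmetric]
      by (rule has_field_derivative_at_within)
  qed
  then have "((\<lambda>s. ?u (?x s) * (v b - v a)) has_integral ?Y (?u (?x 1)) - ?Y (?u (?x 0))) {0..1}"
    by (intro fundamental_theorem_of_calculus) simp_all
  then have "integral {0..1} (\<lambda>s. ?u (?x s) * (v b - v a)) = ?Y (?u (?x 1)) - ?Y (?u (?x 0))"
    by (rule integral_unique)
  then show ?thesis by (simp add: Uec_def inv mult.commute)
qed

lemma Uec_refl: "Uec \<theta> a a = a"
proof -
  have "the_inv v (v a) = a" by (rule the_inv_f_f) (auto intro!: injI simp: v_eq_iff)
  moreover have "s * v a + (1 - s) * v a = v a" for s by (simp add: algebra_simps)
  ultimately show ?thesis by (simp add: Uec_def)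
qed

lemma Uec_commute: "Uec \<theta> a b = Uec \<theta> b a"
proof (cases "a = b")
  case False
  have "(v b - v a) * Uec \<theta> a b = (v b - v a) * Uec \<theta> b a"
    using Uec_quotient[of b a] Uec_quotient[of a b] by (simp add: algebra_simps)
  then show ?thesis using False v_eq_iff[of a b] by simp
qed simp

text \<open>The right-hand side is a Bregman divergence of \<open>\<theta>\<close>. After
  subtraction of the quadratic, its derivative is \<open>(x - a) * (v' x - c0)\<close>, so the
  minimum is at \<open>a\<close>, where everything vanishes.\<close>

lemma Bregman_lower_bound:
  assumes c: "\<And>u. u \<in> {m..M} \<Longrightarrow> c0 \<le> v' u"
    and ab: "a \<in> {m..M}" "b \<in> {m..M}"
  shows "c0 / 2 * (b - a)\<^sup>2 \<le> (b - a) * v b - (\<theta> b - \<theta> a)"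
proof -
  define k where "k x = (x - a) * v x - (\<theta> x - \<theta> a) - c0 / 2 * (x - a)\<^sup>2" for x
  have k': "(k has_real_derivative (x - a) * (v' x - c0)) (at x)" for x
    unfolding k_def by (auto intro!: derivative_eq_intros DERIV_v DERIV_theta simp: field_simps)
  have "k a \<le> k b"
  proof (cases "a \<le> b")
    case True
    then show ?thesis
      by (rule DERIV_nonneg_imp_nondecreasing)
         (use k' c ab in \<open>auto intro!: exI[of _ "(_ - a) * (v' _ - c0)"]\<close>)
  next
    case False
    then have "b \<le> a" by simp
    then show ?thesis
      by (rule DERIV_nonpos_imp_nonincreasing)
         (use k' c ab in \<open>auto intro!: exI[of _ "(_ - a) * (v' _ - c0)"] mult_nonpos_nonneg\<close>)
  qed
  then show ?thesis by (simp add: k_def)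
qed

text \<open>The factor \<open>K < 1\<close> is what makes the dissipation in time strict.\<close>

lemma Uec_increment:
  obtains K where "0 \<le> K" "K < 1"
    "\<And>a b b'. a \<in> {m..M} \<Longrightarrow> b \<in> {m..M} \<Longrightarrow> b' \<in> {m..M} \<Longrightarrow> b \<le> b' \<Longrightarrow>
       0 \<le> Uec \<theta> a b' - Uec \<theta> a b \<and> Uec \<theta> a b' - Uec \<theta> a b \<le> Lu \<theta> m M * K * (b' - b)"
proof -
  obtain c0 c1 where c: "0 < c0" "c0 \<le> c1" "\<And>u. u \<in> {m..M} \<Longrightarrow> c0 \<le> v' u \<and> v' u \<le> c1"
    using v'_bounds by blast
  \<comment> \<open>The Bregman bound removes \<open>c0 / 2\<close> from a slope of \<open>v\<close>
    that is at most \<open>c1\<close>; what remains is at most the fraction \<open>K\<close> of the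
    slope.\<close>
  define K where "K = 1 - c0 / (2 * c1)"
  have c1: "0 < c1" using c by simp
  have "0 < c0 / (2 * c1)" "c0 / (2 * c1) \<le> 1 / 2" using c c1 by (auto simp: field_simps)
  then have K: "0 \<le> K" "K < 1" by (auto simp: K_def)
  have ratio: "0 \<le> (b - Uec \<theta> a b) / (b - a) \<and> (b - Uec \<theta> a b) / (b - a) \<le> K"
    if ab: "a \<in> {m..M}" "b \<in> {m..M}" "b \<noteq> a" for a b
  proof -
    let ?s = "(v b - v a) / (b - a)"
    have s: "0 < ?s" "?s \<le> c1" using slope_pos[of a b] slope_bounds[OF c(3), of a b] ab by auto
    have low: "c0 / 2 * (b - a)\<^sup>2 \<le> (b - a) * v b - (\<theta> b - \<theta> a)"
      by (rule Bregman_lower_bound) (use c ab in auto)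
    have "c0 / 2 * (a - b)\<^sup>2 \<le> (a - b) * v a - (\<theta> a - \<theta> b)"
      by (rule Bregman_lower_bound) (use c ab in auto)
    moreover have "0 \<le> c0 / 2 * (a - b)\<^sup>2" using c by simp
    ultimately have low': "0 \<le> (\<theta> b - \<theta> a) - (b - a) * v a" by (simp add: algebra_simps)
    have eq: "(b - Uec \<theta> a b) * (v b - v a) = (\<theta> b - \<theta> a) - (b - a) * v a"
      using Uec_quotient[of b a] by (simp add: algebra_simps)
    have sq: "0 < (b - a)\<^sup>2" using ab by simp
    have prod: "(b - Uec \<theta> a b) / (b - a) * ?s = ((b - Uec \<theta> a b) * (v b - v a)) / (b - a)\<^sup>2"
      by (simp add: power2_eq_square)
    have "0 \<le> (b - Uec \<theta> a b) / (b - a) * ?s" unfolding prod eq using low' by simp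
    then have "0 \<le> (b - Uec \<theta> a b) / (b - a)" using s(1) mult_right_le_imp_le[of 0 ?s] by (metis mult_zero_left)
    moreover have "(b - Uec \<theta> a b) / (b - a) \<le> K"
    proof -
      have "(b - Uec \<theta> a b) * (v b - v a) \<le> (b - a) * (v b - v a) - c0 / 2 * (b - a)\<^sup>2"
        unfolding eq using low by (simp add: algebra_simps)
      then have "(b - Uec \<theta> a b) / (b - a) * ?s \<le> ((b - a) * (v b - v a) - c0 / 2 * (b - a)\<^sup>2) / (b - a)\<^sup>2"
        unfolding prod by (rule divide_right_mono) simp
      also have "\<dots> = ?s - c0 / 2"
        using ab by (simp add: diff_divide_distrib power2_eq_square)
      also have "\<dots> \<le> K * ?s"
      proof -
        have "c0 / (2 * c1) * ?s \<le> c0 / (2 * c1) * c1" using s c by (intro mult_left_mono) auto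
        then have "c0 / (2 * c1) * ?s \<le> c0 / 2" using c1 by simp
        moreover have "K * ?s = ?s - c0 / (2 * c1) * ?s" by (simp only: K_def left_diff_distrib mult_1)
        ultimately show ?thesis by linarith
      qed
      finally show ?thesis using s(1) by (rule mult_right_le_imp_le)
    qed
    ultimately show ?thesis by blast
  qed
  have "0 \<le> Uec \<theta> a b' - Uec \<theta> a b \<and> Uec \<theta> a b' - Uec \<theta> a b \<le> Lu \<theta> m M * K * (b' - b)"
    if a: "a \<in> {m..M}" and b: "b \<in> {m..M}" "b' \<in> {m..M}" "b \<le> b'" for a b b'
  proof -
    have Y: "((\<lambda>w. w * v w - \<theta> w) has_real_derivative v' w * w) (at w)" for w
      by (auto intro!: derivative_eq_intros DERIV_v DERIV_theta)
    have isCont_off: "isCont (Uec \<theta> a) x" if "x \<noteq> a" for x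
      using DERIV_isCont[OF entropy_quotient_DERIV[OF Uec_quotient Y that]] .
    \<comment> \<open>The quotient is silent at the diagonal. Continuity there follows from the
      ratio bound, which keeps \<open>Uec \<theta> a x\<close> between \<open>a\<close> and
      \<open>x\<close>.\<close>
    have cont_at: "continuous (at a within {m..M}) (Uec \<theta> a)"
      unfolding continuous_within
    proof (rule Lim_null[THEN iffD2], rule Lim_null_comparison)
      show "\<forall>\<^sub>F x in at a within {m..M}. norm (Uec \<theta> a x - Uec \<theta> a a) \<le> \<bar>x - a\<bar>"
        unfolding eventually_at_filter
      proof (rule eventuallyI, intro impI)
        fix x assume x: "x \<noteq> a" "x \<in> {m..M}"
        define t where "t = (x - Uec \<theta> a x) / (x - a)"
        have t: "0 \<le> t" "t \<le> 1" using ratio[OF a x(2,1)] K unfolding t_def by auto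
        have "t * (x - a) = x - Uec \<theta> a x" using x by (simp add: t_def)
        then have "Uec \<theta> a x - a = (1 - t) * (x - a)" by (simp add: left_diff_distrib)
        then show "norm (Uec \<theta> a x - Uec \<theta> a a) \<le> \<bar>x - a\<bar>"
          using t by (simp add: Uec_refl abs_mult mult_left_le_one_le)
      qed
      show "((\<lambda>x. \<bar>x - a\<bar>) \<longlongrightarrow> 0) (at a within {m..M})"
        by (rule tendsto_rabs_zero, rule Lim_null[THEN iffD1], rule tendsto_ident_at)
    qed
    have cont: "continuous_on {m..M} (Uec \<theta> a)"
      unfolding continuous_on_eq_continuous_within
    proof
      fix x assume "x \<in> {m..M}"
      then show "continuous (at x within {m..M}) (Uec \<theta> a)"
        using isCont_off[of x] cont_at continuous_at_imp_continuous_at_within by (cases "x = a") auto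
    qed
    have "Lu \<theta> m M * 0 * (b' - b) \<le> Uec \<theta> a b' - Uec \<theta> a b \<and>
        Uec \<theta> a b' - Uec \<theta> a b \<le> Lu \<theta> m M * K * (b' - b)"
      by (rule entropy_quotient_increment[OF Uec_quotient Y cont a _ _ K(1) b]) (use ratio[OF a] in auto)
    then show ?thesis by simp
  qed
  then show thesis using that K by blast
qed

end

section \<open>The entropy conservative flux in space\<close>

locale ec_flux_on_interval = entropy_on_interval f \<theta> g m M
  for f :: "real \<Rightarrow> real^2" and \<theta> g m M +
  fixes hec :: "real \<Rightarrow> real \<Rightarrow> real^2 \<Rightarrow> real"
  assumes cell_flux: "ec_flux f \<theta> g hec"
begin

lemma hec_refl: "hec u u n = f u \<bullet> n"
  using cell_flux by (simp add: ec_flux_def)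

lemma hec_commute: "hec a b n = hec b a n"
  using cell_flux by (simp add: ec_flux_def)

lemma hec_C1:
  obtains h' where "\<And>z. ((\<lambda>(a, b). hec a b n) has_derivative blinfun_apply (h' z)) (at z)"
    "continuous_on UNIV h'"
  using cell_flux unfolding ec_flux_def by blast

text \<open>Consistency transfers the smoothness of the two-point flux to \<open>f\<close>.\<close>

lemma f_inner_C1:
  obtains F' where "\<And>u. ((\<lambda>u. f u \<bullet> n) has_real_derivative F' u) (at u)" "continuous_on UNIV F'"
proof -
  obtain h' where h': "\<And>z. ((\<lambda>(a, b). hec a b n) has_derivative blinfun_apply (h' z)) (at z)"
    "continuous_on UNIV h'"
    using hec_C1[of n] by blast
  have "((\<lambda>u. f u \<bullet> n) has_real_derivative h' (u, u) (1, 1)) (at u)" for u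
  proof -
    have "((\<lambda>t. (t, t)) has_derivative (\<lambda>t. (t, t))) (at u)"
      by (auto intro!: derivative_eq_intros)
    then have "((\<lambda>(a, b). hec a b n) \<circ> (\<lambda>t. (t, t)) has_derivative h' (u, u) \<circ> (\<lambda>t. (t, t))) (at u)"
      by (rule diff_chain_at) (rule h'(1))
    moreover have "h' (u, u) \<circ> (\<lambda>t. (t, t)) = (*) (h' (u, u) (1, 1))"
    proof
      fix t :: real
      have "(t, t) = t *\<^sub>R (1, 1)" by simp
      then show "(h' (u, u) \<circ> (\<lambda>t. (t, t))) t = h' (u, u) (1, 1) * t"
        by (simp only: comp_apply blinfun.scaleR_right real_scaleR_def mult.commute)
    qed
    ultimately show ?thesis by (simp add: has_field_derivative_def comp_def hec_refl)
  qed
  moreover have "continuous_on UNIV (\<lambda>u. h' (u, u) (1, 1))"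
    by (intro continuous_intros continuous_on_compose2[OF h'(2)]) auto
  ultimately show thesis by (rule that)
qed

lemma f_has_vector_derivative: "(f has_vector_derivative vector_derivative f (at u)) (at u)"
proof -
  have "(\<lambda>u. f u \<bullet> n) differentiable (at u)" for n
    using f_inner_C1[of n] real_differentiable_def by metis
  then have "f differentiable (at u)"
    by (subst differentiable_componentwise_within) blast
  then show ?thesis by (simp add: vector_derivative_works)
qed

text \<open>Formally \<open>v' f + v f' - g'\<close> collapses to \<open>v' f\<close>. The entropy
  flux is given only through an integral, so its differentiability rests on the continuity of the
  derivative of \<open>f\<close>, which is inherited from the smooth two-point flux.\<close>

lemma DERIV_potential:
  "((\<lambda>u. entropy_potential f \<theta> g u \<bullet> n) has_real_derivative v' u * (f u \<bullet> n)) (at u)"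
proof -
  obtain F' where F': "\<And>u. ((\<lambda>u. f u \<bullet> n) has_real_derivative F' u) (at u)" "continuous_on UNIV F'"
    using f_inner_C1[of n] by blast
  have vd: "vector_derivative f (at w) \<bullet> n = F' w" for w
  proof -
    have "((\<lambda>u. f u \<bullet> n) has_vector_derivative vector_derivative f (at w) \<bullet> n) (at w)"
      by (rule bounded_linear.has_vector_derivative[OF bounded_linear_inner_left f_has_vector_derivative])
    then have "((\<lambda>u. f u \<bullet> n) has_real_derivative vector_derivative f (at w) \<bullet> n) (at w)"
      by (simp add: has_real_derivative_iff_has_vector_derivative)
    then show ?thesis using F'(1) DERIV_unique by blast
  qed
  have G: "((\<lambda>w. v w * F' w) has_integral (g b \<bullet> n - g a \<bullet> n)) {a..b}" if "a \<le> b" for a b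
  proof -
    have "((\<lambda>w. v w *\<^sub>R vector_derivative f (at w)) has_integral (g b - g a)) {a..b}"
      using entropy that by (simp add: entropy_pair_def)
    from has_integral_linear[OF this bounded_linear_inner_left[of n]]
    show ?thesis by (simp add: o_def vd inner_diff_left)
  qed
  have cont: "continuous_on S (\<lambda>w. v w * F' w)" for S
    by (intro continuous_intros continuous_on_v continuous_on_subset[OF F'(2)]) auto
  \<comment> \<open>On the window from \<open>u - 1\<close> to \<open>u + 1\<close>,
    \<open>g\<close> differs from an integral with a continuous integrand by a constant.\<close>
  have g: "((\<lambda>u. g u \<bullet> n) has_real_derivative v u * F' u) (at u)"
  proof -
    have "((\<lambda>x. integral {u - 1..x} (\<lambda>w. v w * F' w)) has_real_derivative v u * F' u)
        (at u within {u - 1..u + 1})"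
      by (rule integral_has_real_derivative[OF cont]) simp
    then have "((\<lambda>x. integral {u - 1..x} (\<lambda>w. v w * F' w)) has_real_derivative v u * F' u)
        (at u within {u - 1<..<u + 1})"
      by (rule DERIV_subset) auto
    then have "((\<lambda>x. integral {u - 1..x} (\<lambda>w. v w * F' w)) has_real_derivative v u * F' u) (at u)"
      by (subst (asm) at_within_open) simp_all
    then have "((\<lambda>x. integral {u - 1..x} (\<lambda>w. v w * F' w) + g (u - 1) \<bullet> n) has_real_derivative v u * F' u) (at u)"
      by (auto intro!: derivative_eq_intros)
    then show ?thesis
      by (rule has_field_derivative_transform_within_open[where S = "{u - 1<..<u + 1}"])
         (use integral_unique[OF G[of "u - 1"]] in auto)
  qed
  have "((\<lambda>u. v u * (f u \<bullet> n) - g u \<bullet> n) has_real_derivative v' u * (f u \<bullet> n)) (at u)"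
    by (auto intro!: derivative_eq_intros DERIV_v F'(1) g)
  then show ?thesis by (simp add: entropy_potential_def inner_diff_left)
qed

text \<open>Cauchy's mean value theorem for \<open>v\<close> and the entropy potential: the quotient
  of their derivatives is the flux itself.\<close>

lemma hec_mean_value:
  obtains c where "c \<in> closed_segment a b" "hec a b n = f c \<bullet> n"
proof -
  have main: "\<exists>c. a \<le> c \<and> c \<le> b \<and> hec a b n = f c \<bullet> n" if ab: "a < b" for a b
  proof -
    let ?\<psi> = "\<lambda>u. entropy_potential f \<theta> g u \<bullet> n"
    obtain c where c: "a < c" "c < b" "(v b - v a) * (v' c * (f c \<bullet> n)) = (?\<psi> b - ?\<psi> a) * v' c"
      using GMVT'[where f = v and g = ?\<psi> and f' = v' and g' = "\<lambda>u. v' u * (f u \<bullet> n)",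
          OF ab DERIV_isCont[OF DERIV_v] DERIV_isCont[OF DERIV_potential] DERIV_potential DERIV_v]
      by blast
    have "?\<psi> b - ?\<psi> a = (v b - v a) * hec a b n"
      using cell_flux by (simp add: ec_flux_def inner_diff_left)
    then have "(v b - v a) * v' c * (f c \<bullet> n) = (v b - v a) * v' c * hec a b n"
      using c(3) by (simp add: mult_ac)
    then have "hec a b n = f c \<bullet> n"
      using v_strict_mono[OF ab] v'_pos[of c] by simp
    then show ?thesis using c by (meson less_imp_le)
  qed
  consider "a < b" | "a = b" | "b < a" by linarith
  then show thesis
  proof cases
    case 1 then show ?thesis using main[of a b] that by (auto simp: closed_segment_eq_real_ivl)
  next
    case 2 then show ?thesis using that[of a] by (simp add: hec_refl)
  next
    case 3 then show ?thesis using main[of b a] that hec_commute[of a b]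
      by (auto simp: closed_segment_eq_real_ivl)
  qed
qed

lemma f_inner_Lipschitz:
  obtains L where "\<And>a b. a \<in> {m..M} \<Longrightarrow> b \<in> {m..M} \<Longrightarrow> \<bar>f b \<bullet> n - f a \<bullet> n\<bar> \<le> L * \<bar>b - a\<bar>"
proof -
  obtain F' where F': "\<And>u. ((\<lambda>u. f u \<bullet> n) has_real_derivative F' u) (at u)" "continuous_on UNIV F'"
    using f_inner_C1[of n] by blast
  have "bounded (F' ` {m..M})"
    by (rule compact_imp_bounded[OF compact_continuous_image])
       (use F'(2) continuous_on_subset in auto)
  then obtain L where L: "\<And>u. u \<in> {m..M} \<Longrightarrow> norm (F' u) \<le> L"
    unfolding bounded_iff by blast
  have "\<bar>f b \<bullet> n - f a \<bullet> n\<bar> \<le> L * \<bar>b - a\<bar>" if "a \<in> {m..M}" "b \<in> {m..M}" for a b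
    using field_differentiable_bound[of "{m..M}" "\<lambda>u. f u \<bullet> n" F' L b a]
      has_field_derivative_at_within[OF F'(1)] L that by auto
  then show thesis by (rule that)
qed

text \<open>Lipschitz constants of the two components bound all quotients in the definition of
  \<open>Lf\<close>, so the supremum is a genuine bound; a general \<open>n\<close> is scaled to
  unit length.\<close>

lemma Lf_ge:
  assumes ab: "a \<in> {m..M}" "b \<in> {m..M}"
  shows "\<bar>f b \<bullet> n - f a \<bullet> n\<bar> \<le> Lf f m M * norm n * \<bar>b - a\<bar>"
proof (cases "n = 0 \<or> a = b")
  case True then show ?thesis by auto
next
  case False
  obtain L1 where L1: "\<And>a b. a \<in> {m..M} \<Longrightarrow> b \<in> {m..M} \<Longrightarrow>
      \<bar>f b \<bullet> axis 1 1 - f a \<bullet> axis 1 1\<bar> \<le> L1 * \<bar>b - a\<bar>"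
    using f_inner_Lipschitz by blast
  obtain L2 where L2: "\<And>a b. a \<in> {m..M} \<Longrightarrow> b \<in> {m..M} \<Longrightarrow>
      \<bar>f b \<bullet> axis 2 1 - f a \<bullet> axis 2 1\<bar> \<le> L2 * \<bar>b - a\<bar>"
    using f_inner_Lipschitz by blast
  have "\<bar>(f b - f a) \<bullet> n\<bar> / \<bar>b - a\<bar> \<le> L1 + L2"
    if "a \<in> {m..M}" "b \<in> {m..M}" "b \<noteq> a" "norm n = 1" for a b n
  proof -
    have "\<bar>(f b - f a) \<bullet> n\<bar> \<le> norm (f b - f a)"
      using Cauchy_Schwarz_ineq2[of "f b - f a" n] that(4) by simp
    also have "\<dots> \<le> (\<Sum>i\<in>UNIV. \<bar>(f b - f a) $ i\<bar>)" by (rule norm_le_l1_cart)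
    also have "\<dots> \<le> (L1 + L2) * \<bar>b - a\<bar>"
      using L1[OF that(1,2)] L2[OF that(1,2)]
      by (simp add: sum_2 inner_axis inner_axis' algebra_simps)
    finally show ?thesis using that by (simp add: field_simps)
  qed
  then have "bdd_above (insert 0 {\<bar>(f b - f a) \<bullet> n\<bar> / \<bar>b - a\<bar> | a b n.
       a \<in> {m..M} \<and> b \<in> {m..M} \<and> b \<noteq> a \<and> norm n = 1})"
    by (intro bdd_aboveI[of _ "max 0 (L1 + L2)"]) fastforce
  moreover have "\<bar>(f b - f a) \<bullet> (n /\<^sub>R norm n)\<bar> / \<bar>b - a\<bar> \<in> insert 0 {\<bar>(f b - f a) \<bullet> n\<bar> / \<bar>b - a\<bar> | a b n.
       a \<in> {m..M} \<and> b \<in> {m..M} \<and> b \<noteq> a \<and> norm n = 1}"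
    using False ab by (intro insertI2 CollectI exI[of _ a] exI[of _ b] exI[of _ "n /\<^sub>R norm n"]) auto
  ultimately have "\<bar>(f b - f a) \<bullet> (n /\<^sub>R norm n)\<bar> / \<bar>b - a\<bar> \<le> Lf f m M"
    unfolding Lf_def by (rule cSup_upper[rotated])
  then have "\<bar>(f b - f a) \<bullet> n\<bar> / norm n / \<bar>b - a\<bar> \<le> Lf f m M"
    by (simp add: abs_mult divide_inverse mult_ac)
  then show ?thesis using False by (simp add: field_simps inner_diff_left)
qed

lemma Lf_nonneg: "0 \<le> Lf f m M"
proof (cases "m = M")
  case True
  then show ?thesis by (auto simp: Lf_def cong: conj_cong)
next
  case False
  then have "m < M" using mM by simp
  then have "0 \<le> Lf f m M * norm (axis 1 1 :: real^2) * \<bar>M - m\<bar>"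
    using Lf_ge[of m M "axis 1 1"] by (smt (verit) atLeastAtMost_iff)
  then show ?thesis using \<open>m < M\<close> by (simp add: zero_le_mult_iff norm_axis_1)
qed

text \<open>The two-point flux is the flux at a state between \<open>a\<close> and \<open>b\<close>,
  so its gap to \<open>f b\<close> is at most \<open>Lf * norm n\<close> times the distance of the
  states. Passing from states to the entropy variable costs the factor \<open>Lu\<close>.\<close>

lemma hec_increment:
  assumes a: "a \<in> {m..M}" and b: "b \<in> {m..M}" "b' \<in> {m..M}"
  shows "\<bar>hec a b' n - hec a b n\<bar> \<le> Lu \<theta> m M * (Lf f m M * norm n) * \<bar>b' - b\<bar>"
proof -
  let ?L = "Lf f m M * norm n" and ?\<psi> = "\<lambda>u. entropy_potential f \<theta> g u \<bullet> n"
  have L: "0 \<le> ?L" using Lf_nonneg by simp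
  have bnd: "- ?L \<le> (f b \<bullet> n - hec a b n) / (b - a) \<and> (f b \<bullet> n - hec a b n) / (b - a) \<le> ?L"
    if b: "b \<in> {m..M}" "b \<noteq> a" for b
  proof -
    obtain c where c: "c \<in> closed_segment a b" "hec a b n = f c \<bullet> n" using hec_mean_value by blast
    have "c \<in> {m..M}" "\<bar>b - c\<bar> \<le> \<bar>b - a\<bar>"
      using c(1) a b by (auto simp: closed_segment_eq_real_ivl split: if_splits)
    then have "\<bar>f b \<bullet> n - hec a b n\<bar> \<le> ?L * \<bar>b - a\<bar>"
      using Lf_ge[of c b n] b L c(2) by (smt (verit) mult_left_mono)
    then have "\<bar>(f b \<bullet> n - hec a b n) / (b - a)\<bar> \<le> ?L"
      using b by (simp add: field_simps)
    then show ?thesis by linarith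
  qed
  obtain h' where h': "\<And>z. ((\<lambda>(a, b). hec a b n) has_derivative blinfun_apply (h' z)) (at z)"
    using hec_C1[of n] by blast
  have "continuous_on UNIV (\<lambda>(a, b). hec a b n)"
    by (rule has_derivative_continuous_on) (use h' in simp)
  then have "continuous_on UNIV (\<lambda>b. (\<lambda>(a, b). hec a b n) (a, b))"
    by (rule continuous_on_compose2) (auto intro!: continuous_intros)
  then have cont: "continuous_on {m..M} (\<lambda>b. hec a b n)"
    using continuous_on_subset by force
  have E: "(v b - v a) * hec a b n = ?\<psi> b - ?\<psi> a" for b
    using cell_flux by (simp add: ec_flux_def inner_diff_left)
  have main: "\<bar>hec a b' n - hec a b n\<bar> \<le> Lu \<theta> m M * ?L * \<bar>b' - b\<bar>"
    if "b \<in> {m..M}" "b' \<in> {m..M}" "b \<le> b'" for b b'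
    using entropy_quotient_increment[OF E DERIV_potential cont a bnd _ L that] L that(3)
    by (auto simp: abs_le_iff algebra_simps)
  show ?thesis using main[OF b] main[OF b(2,1)] by (cases "b \<le> b'") (auto simp: abs_minus_commute)
qed

end

section \<open>Element mappings\<close>

text \<open>The columns of the Jacobian matrix as explicit tensor polynomials, the form needed for
  continuity and for exact quadrature.\<close>

definition xdiff ::
  "nat \<Rightarrow> (nat \<Rightarrow> real) \<Rightarrow> mesh \<Rightarrow> (real^2) set \<Rightarrow> 2 \<Rightarrow> real^2 \<Rightarrow> real^2" where
  "xdiff p \<xi> T \<kappa> c z = (if c = 1
     then (\<Sum>i\<le>p. \<Sum>j\<le>p. (poly (pderiv (lagrange p \<xi> i)) (z $ 1) * poly (lagrange p \<xi> j) (z $ 2)) *\<^sub>R node T \<kappa> i j)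
     else (\<Sum>i\<le>p. \<Sum>j\<le>p. (poly (lagrange p \<xi> i) (z $ 1) * poly (pderiv (lagrange p \<xi> j)) (z $ 2)) *\<^sub>R node T \<kappa> i j))"

lemma xmap_has_derivative:
  "(xmap p \<xi> T \<kappa> has_derivative (\<lambda>d. d $ 1 *\<^sub>R xdiff p \<xi> T \<kappa> 1 z + d $ 2 *\<^sub>R xdiff p \<xi> T \<kappa> 2 z)) (at z)"
proof -
  have P: "((\<lambda>z. poly P (z $ c)) has_derivative (\<lambda>d. d $ c * poly (pderiv P) (z $ c))) (at z)"
    for P :: "real poly" and c :: 2
    by (rule DERIV_compose_FDERIV[OF poly_DERIV bounded_linear_imp_has_derivative[OF bounded_linear_vec_nth]])
  have "((\<lambda>z. \<Sum>i\<le>p. \<Sum>j\<le>p. (poly (lagrange p \<xi> i) (z $ 1) * poly (lagrange p \<xi> j) (z $ 2)) *\<^sub>R node T \<kappa> i j)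
     has_derivative (\<lambda>d. \<Sum>i\<le>p. \<Sum>j\<le>p. (poly (lagrange p \<xi> i) (z $ 1) * (d $ 2 * poly (pderiv (lagrange p \<xi> j)) (z $ 2))
       + (d $ 1 * poly (pderiv (lagrange p \<xi> i)) (z $ 1)) * poly (lagrange p \<xi> j) (z $ 2)) *\<^sub>R node T \<kappa> i j)) (at z)"
    by (intro has_derivative_sum has_derivative_scaleR_left has_derivative_mult P)
  moreover have "(\<Sum>i\<le>p. \<Sum>j\<le>p. (poly (lagrange p \<xi> i) (z $ 1) * (d $ 2 * poly (pderiv (lagrange p \<xi> j)) (z $ 2))
       + (d $ 1 * poly (pderiv (lagrange p \<xi> i)) (z $ 1)) * poly (lagrange p \<xi> j) (z $ 2)) *\<^sub>R node T \<kappa> i j)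
     = d $ 1 *\<^sub>R xdiff p \<xi> T \<kappa> 1 z + d $ 2 *\<^sub>R xdiff p \<xi> T \<kappa> 2 z" for d :: "real^2"
    by (simp add: xdiff_def scaleR_sum_right sum.distrib scaleR_add_left mult_ac add.commute)
  ultimately show ?thesis unfolding xmap_def by simp
qed

lemma continuous_on_xdiff: "continuous_on S (xdiff p \<xi> T \<kappa> c)"
  unfolding xdiff_def[abs_def] by (cases "c = 1") (auto intro!: continuous_intros)

lemma xjac_nth: "xjac p \<xi> T \<kappa> z $ i $ c = xdiff p \<xi> T \<kappa> c z $ i"
proof -
  have "xjac p \<xi> T \<kappa> z = matrix (\<lambda>d. d $ 1 *\<^sub>R xdiff p \<xi> T \<kappa> 1 z + d $ 2 *\<^sub>R xdiff p \<xi> T \<kappa> 2 z)"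
    by (simp add: xjac_def jacobian_def frechet_derivative_at[OF xmap_has_derivative, symmetric])
  then show ?thesis using exhaust_2[of c] by (auto simp: matrix_def axis_def)
qed

lemma xjac_mult: "xjac p \<xi> T \<kappa> z *v d = d $ 1 *\<^sub>R xdiff p \<xi> T \<kappa> 1 z + d $ 2 *\<^sub>R xdiff p \<xi> T \<kappa> 2 z"
  by (simp add: vec_eq_iff matrix_vector_mult_def sum_2 xjac_nth mult.commute)

lemma xmap_has_derivative_xjac: "(xmap p \<xi> T \<kappa> has_derivative (*v) (xjac p \<xi> T \<kappa> z)) (at z)"
proof -
  have "(*v) (xjac p \<xi> T \<kappa> z) = (\<lambda>d. d $ 1 *\<^sub>R xdiff p \<xi> T \<kappa> 1 z + d $ 2 *\<^sub>R xdiff p \<xi> T \<kappa> 2 z)"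
    by (rule ext) (rule xjac_mult)
  then show ?thesis using xmap_has_derivative by simp
qed

definition cross2 :: "real^2 \<Rightarrow> real^2 \<Rightarrow> real" where
  "cross2 a b = a $ 1 * b $ 2 - a $ 2 * b $ 1"

lemma det_xjac: "det (xjac p \<xi> T \<kappa> z) = cross2 (xdiff p \<xi> T \<kappa> 1 z) (xdiff p \<xi> T \<kappa> 2 z)"
  by (simp add: det_2 xjac_nth cross2_def)

lemma abs_cross2_le: "\<bar>cross2 a b\<bar> \<le> norm a * norm b"
proof -
  have "cross2 a b = a \<bullet> vector [b $ 2, - b $ 1]"
    by (simp add: cross2_def inner_vec_def sum_2)
  also have "\<bar>\<dots>\<bar> \<le> norm a * norm (vector [b $ 2, - b $ 1] :: real^2)" by (rule Cauchy_Schwarz_ineq2)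
  also have "norm (vector [b $ 2, - b $ 1] :: real^2) = norm b"
    by (simp add: norm_vec_def L2_set_def sum_2)
  finally show ?thesis .
qed

text \<open>The determinant times the inverse matrix is the adjugate, whose rows are the rotated
  tangent vectors.\<close>

lemma scaled_ref_grad:
  assumes "0 < Jdet p \<xi> T \<kappa> i j"
  defines "z \<equiv> vector [\<xi> i, \<xi> j]"
  shows "Jdet p \<xi> T \<kappa> i j *\<^sub>R ref_grad p \<xi> T \<kappa> 1 i j = vector [xdiff p \<xi> T \<kappa> 2 z $ 2, - xdiff p \<xi> T \<kappa> 2 z $ 1]"
    and "Jdet p \<xi> T \<kappa> i j *\<^sub>R ref_grad p \<xi> T \<kappa> 2 i j = vector [- xdiff p \<xi> T \<kappa> 1 z $ 2, xdiff p \<xi> T \<kappa> 1 z $ 1]"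
proof -
  let ?A = "xjac p \<xi> T \<kappa> z" and ?a = "xdiff p \<xi> T \<kappa> 1 z" and ?b = "xdiff p \<xi> T \<kappa> 2 z"
  define J where "J = Jdet p \<xi> T \<kappa> i j"
  have J: "J = det ?A" "0 < J" using assms(1) by (simp_all add: J_def Jdet_def z_def)
  define B :: "real^2^2" where "B = vector [vector [?b $ 2, - ?b $ 1], vector [- ?a $ 2, ?a $ 1]]"
  have BA: "B ** ?A = mat J"
    using J(1) by (simp add: vec_eq_iff forall_2 matrix_matrix_mult_def sum_2 xjac_nth B_def mat_def det_2)
  have inv: "invertible ?A" using J by (simp add: invertible_det_nz)
  have "B = B ** (?A ** matrix_inv ?A)"
    using someI_ex[OF inv[unfolded invertible_def]] by (simp add: matrix_inv_def)
  also have "\<dots> = mat J ** matrix_inv ?A" by (simp add: matrix_mul_assoc BA)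
  also have "\<dots> = J *\<^sub>R matrix_inv ?A"
    by (simp add: vec_eq_iff matrix_matrix_mult_def mat_def if_distrib[where f = "\<lambda>x. x * _"] cong: if_cong)
  finally have eq: "B = J *\<^sub>R matrix_inv ?A" .
  have "J *\<^sub>R row c (matrix_inv ?A) = row c B" for c
    unfolding eq by (simp add: vec_eq_iff row_def)
  then have "J *\<^sub>R ref_grad p \<xi> T \<kappa> c i j = row c B" for c
    by (simp add: ref_grad_def z_def)
  then show "Jdet p \<xi> T \<kappa> i j *\<^sub>R ref_grad p \<xi> T \<kappa> 1 i j = vector [?b $ 2, - ?b $ 1]"
    and "Jdet p \<xi> T \<kappa> i j *\<^sub>R ref_grad p \<xi> T \<kappa> 2 i j = vector [- ?a $ 2, ?a $ 1]"
    by (simp_all add: J_def[symmetric] row_def B_def vec_eq_iff forall_2)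
qed

lemma nvol1_diag: "nvol1 p \<xi> T \<kappa> i i j = Jdet p \<xi> T \<kappa> i j *\<^sub>R ref_grad p \<xi> T \<kappa> 1 i j"
  by (simp add: nvol1_def scaleR_2[symmetric])

lemma nvol2_diag: "nvol2 p \<xi> T \<kappa> i j j = Jdet p \<xi> T \<kappa> i j *\<^sub>R ref_grad p \<xi> T \<kappa> 2 i j"
  by (simp add: nvol2_def scaleR_2[symmetric])

text \<open>Mesh regularity bounds the Jacobian from below only. The diagonal metric terms are the
  rows of the adjugate, which in dimension two has the same determinant as the Jacobian matrix; this
  yields an upper bound.\<close>

lemma Jdet_le_norm_nvol:
  assumes "0 < Jdet p \<xi> T \<kappa> i j"
  shows "Jdet p \<xi> T \<kappa> i j \<le> norm (nvol1 p \<xi> T \<kappa> i i j) * norm (nvol2 p \<xi> T \<kappa> i j j)"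
proof -
  have "Jdet p \<xi> T \<kappa> i j = cross2 (nvol1 p \<xi> T \<kappa> i i j) (nvol2 p \<xi> T \<kappa> i j j)"
    unfolding nvol1_diag nvol2_diag scaled_ref_grad[OF assms]
    by (simp add: Jdet_def det_xjac cross2_def)
  then show ?thesis using abs_cross2_le by (metis abs_ge_self order_trans)
qed

lemma nvol1_commute: "nvol1 p \<xi> T \<kappa> i k j = nvol1 p \<xi> T \<kappa> k i j"
  by (simp add: nvol1_def add.commute)

lemma nvol2_commute: "nvol2 p \<xi> T \<kappa> i j k = nvol2 p \<xi> T \<kappa> i k j"
  by (simp add: nvol2_def add.commute)

lemma xmap_node:
  assumes inj: "inj_on \<xi> {..p}" and ij: "i \<le> p" "j \<le> p"
  shows "xmap p \<xi> T \<kappa> (vector [\<xi> i, \<xi> j]) = node T \<kappa> i j"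
proof -
  have "xmap p \<xi> T \<kappa> (vector [\<xi> i, \<xi> j]) = (\<Sum>k\<le>p. \<Sum>l\<le>p. if k = i \<and> l = j then node T \<kappa> i j else 0)"
    unfolding xmap_def by (intro sum.cong refl) (auto simp: poly_lagrange_node[OF inj] ij)
  also have "\<dots> = (\<Sum>k\<le>p. if k = i then node T \<kappa> i j else 0)"
    by (intro sum.cong refl) (use ij in auto)
  finally show ?thesis using ij by simp
qed

lemma ref_square_iff: "z \<in> ref_square \<longleftrightarrow> \<bar>z $ 1\<bar> \<le> 1 \<and> \<bar>z $ 2\<bar> \<le> 1"
  by (auto simp: ref_square_def mem_box_cart forall_2)

lemma interior_ref_square_iff: "z \<in> interior ref_square \<longleftrightarrow> \<bar>z $ 1\<bar> < 1 \<and> \<bar>z $ 2\<bar> < 1"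
  by (auto simp: ref_square_def mem_box_cart forall_2)

lemma basis_node:
  assumes gl: "gauss_lobatto p \<xi> \<omega>" and inj: "inj_on (xmap p \<xi> T \<kappa>) ref_square"
    and ij: "i \<le> p" "j \<le> p" "k \<le> p" "l \<le> p"
  shows "basis p \<xi> T \<kappa> i j (xmap p \<xi> T \<kappa> (vector [\<xi> k, \<xi> l])) = (if i = k \<and> j = l then 1 else 0)"
proof -
  have "(vector [\<xi> k, \<xi> l] :: real^2) \<in> ref_square"
    using gauss_lobatto_node_bounds[OF gl] ij by (auto simp: ref_square_iff abs_le_iff minus_le_iff)
  then show ?thesis
    using ij by (auto simp: basis_def Let_def the_inv_into_f_f[OF inj]
        poly_lagrange_node[OF gauss_lobatto_inj_on[OF gl]])
qed

lemma trace_from_node: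
  assumes gl: "gauss_lobatto p \<xi> \<omega>" and inj: "inj_on (xmap p \<xi> T \<kappa>) ref_square"
    and kl: "k \<le> p" "l \<le> p"
  shows "trace_from p \<xi> T W \<kappa> (xmap p \<xi> T \<kappa> (vector [\<xi> k, \<xi> l])) = W \<kappa> k l"
proof -
  have "trace_from p \<xi> T W \<kappa> (xmap p \<xi> T \<kappa> (vector [\<xi> k, \<xi> l])) =
      (\<Sum>i\<le>p. \<Sum>j\<le>p. if i = k \<and> j = l then W \<kappa> k l else 0)"
    unfolding trace_from_def by (intro sum.cong refl) (auto simp: basis_node[OF gl inj] kl)
  also have "\<dots> = (\<Sum>i\<le>p. if i = k then W \<kappa> k l else 0)"
    by (intro sum.cong refl) (use kl in auto)
  finally show ?thesis using kl by simp
qed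

section \<open>Edges\<close>

fun side_tangent :: "side \<Rightarrow> real^2" where
  "side_tangent West = vector [0, 1]"
| "side_tangent East = vector [0, 1]"
| "side_tangent South = vector [1, 0]"
| "side_tangent North = vector [1, 0]"

fun side_node :: "nat \<Rightarrow> side \<Rightarrow> nat \<Rightarrow> nat \<times> nat" where
  "side_node p West k = (0, k)"
| "side_node p East k = (p, k)"
| "side_node p South k = (k, 0)"
| "side_node p North k = (k, p)"

lemma UNIV_side: "(UNIV :: side set) = {West, East, South, North}"
  using side.exhaust by blast

lemma finite_side [simp]: "finite (A :: side set)"
  by (rule finite_subset[OF subset_UNIV]) (simp add: UNIV_side)

lemma edges_eq: "edges p \<xi> T \<kappa> = side_edge p \<xi> T \<kappa> ` UNIV"
  by (simp add: edges_def UNIV_side)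

lemma side_point_ref_square: "\<bar>s\<bar> \<le> 1 \<Longrightarrow> side_point sd s \<in> ref_square"
  by (cases sd) (auto simp: ref_square_iff)

lemma side_point_node:
  assumes "gauss_lobatto p \<xi> \<omega>"
  shows "side_point sd (\<xi> k) = vector [\<xi> (fst (side_node p sd k)), \<xi> (snd (side_node p sd k))]"
  using assms by (cases sd) (auto simp: gauss_lobatto_def)

lemma side_node_le: "k \<le> p \<Longrightarrow> fst (side_node p sd k) \<le> p \<and> snd (side_node p sd k) \<le> p"
  by (cases sd) auto

text \<open>Makes the set of edges of an element a faithful copy of its four sides, so that sums
  over edges become sums over sides.\<close>

lemma inj_side_edge:
  assumes inj: "inj_on (xmap p \<xi> T \<kappa>) ref_square"
  shows "inj (side_edge p \<xi> T \<kappa>)"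
proof (rule injI)
  fix sd sd' assume eq: "side_edge p \<xi> T \<kappa> sd = side_edge p \<xi> T \<kappa> sd'"
  \<comment> \<open>The midpoint distinguishes the sides, whereas each corner belongs to two of
    them.\<close>
  have "xmap p \<xi> T \<kappa> (side_point sd 0) \<in> side_edge p \<xi> T \<kappa> sd'"
    unfolding eq[symmetric] by (auto simp: side_edge_def)
  then obtain s where s: "s \<in> {-1..1}" "xmap p \<xi> T \<kappa> (side_point sd 0) = xmap p \<xi> T \<kappa> (side_point sd' s)"
    by (auto simp: side_edge_def)
  then have "side_point sd 0 = side_point sd' s"
    using inj_onD[OF inj s(2)] side_point_ref_square by (auto simp: abs_le_iff)
  then show "sd = sd'"
    by (cases sd; cases sd') (auto simp: vec_eq_iff forall_2)
qed

text \<open>\<open>edge_sign\<close> is the direction in which \<open>emap\<close> traverses the side, and \<open>edge_index\<close> the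
  corresponding renumbering of the nodes of the side.\<close>

definition edge_sign :: "nat \<Rightarrow> (nat \<Rightarrow> real) \<Rightarrow> mesh \<Rightarrow> (real^2) set \<Rightarrow> side \<Rightarrow> real" where
  "edge_sign p \<xi> T \<kappa> sd =
     (if \<forall>s\<in>{-1..1}. emap T (side_edge p \<xi> T \<kappa> sd) s = xmap p \<xi> T \<kappa> (side_point sd s) then 1 else -1)"

definition edge_index :: "nat \<Rightarrow> (nat \<Rightarrow> real) \<Rightarrow> mesh \<Rightarrow> (real^2) set \<Rightarrow> side \<Rightarrow> nat \<Rightarrow> nat" where
  "edge_index p \<xi> T \<kappa> sd k = (if edge_sign p \<xi> T \<kappa> sd = 1 then k else p - k)"

lemma edge_sign_cases: "edge_sign p \<xi> T \<kappa> sd = 1 \<or> edge_sign p \<xi> T \<kappa> sd = -1"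
  by (simp add: edge_sign_def)

lemma emap_eq_xmap:
  assumes "watertight p \<xi> T" "\<kappa> \<in> elems T" "s \<in> {-1..1}"
  shows "emap T (side_edge p \<xi> T \<kappa> sd) s = xmap p \<xi> T \<kappa> (side_point sd (edge_sign p \<xi> T \<kappa> sd * s))"
proof -
  let ?e = "side_edge p \<xi> T \<kappa> sd"
  have *: "(\<forall>s\<in>{-1..1}. emap T ?e s = xmap p \<xi> T \<kappa> (side_point sd s)) \<or>
        (\<forall>s\<in>{-1..1}. emap T ?e s = xmap p \<xi> T \<kappa> (side_point sd (- s)))"
    using assms(1,2) unfolding watertight_def by blast
  show ?thesis
  proof (cases "\<forall>s\<in>{-1..1}. emap T ?e s = xmap p \<xi> T \<kappa> (side_point sd s)")
    case True
    then show ?thesis using assms(3) by (simp add: edge_sign_def)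
  next
    case False
    then have "edge_sign p \<xi> T \<kappa> sd = -1" by (simp only: edge_sign_def if_False)
    then show ?thesis using * False assms(3) by (metis mult_minus1)
  qed
qed

lemma edge_index_le: "k \<le> p \<Longrightarrow> edge_index p \<xi> T \<kappa> sd k \<le> p"
  by (simp add: edge_index_def)

lemma edge_index_involution: "k \<le> p \<Longrightarrow> edge_index p \<xi> T \<kappa> sd (edge_index p \<xi> T \<kappa> sd k) = k"
  by (simp add: edge_index_def)

lemma edge_index_node_weight:
  assumes "gauss_lobatto p \<xi> \<omega>" "1 \<le> p" "k \<le> p"
  shows "\<xi> (edge_index p \<xi> T \<kappa> sd k) = edge_sign p \<xi> T \<kappa> sd * \<xi> k"
    and "\<omega> (edge_index p \<xi> T \<kappa> sd k) = \<omega> k"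
  using gauss_lobatto_symmetric[OF assms] edge_sign_cases[of p \<xi> T \<kappa> sd] by (auto simp: edge_index_def)

lemma emap_node:
  assumes gl: "gauss_lobatto p \<xi> \<omega>" and p: "1 \<le> p" and wt: "watertight p \<xi> T"
    and \<kappa>: "\<kappa> \<in> elems T" and k: "k \<le> p"
  fixes sd :: side
  defines "n \<equiv> side_node p sd (edge_index p \<xi> T \<kappa> sd k)"
  shows "emap T (side_edge p \<xi> T \<kappa> sd) (\<xi> k) = xmap p \<xi> T \<kappa> (vector [\<xi> (fst n), \<xi> (snd n)])"
proof -
  have "\<xi> k \<in> {-1..1}" using gauss_lobatto_node_bounds[OF gl k] by simp
  then show ?thesis
    using side_point_node[OF gl, of sd "edge_index p \<xi> T \<kappa> sd k"]
    by (simp add: emap_eq_xmap[OF wt \<kappa>] edge_index_node_weight[OF gl p k, symmetric] n_def)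
qed

section \<open>The normals of neighbouring elements are opposite\<close>

text \<open>The polynomial mapping is defined on the whole plane, so the inverse function theorem
  applies also on the boundary of the reference square. The lifted curve will show on which side of
  an edge the physical curve runs.\<close>

lemma xmap_lift_curve:
  assumes det: "det (xjac p \<xi> T \<kappa> z) \<noteq> 0"
    and \<gamma>0: "\<gamma> 0 = xmap p \<xi> T \<kappa> z"
    and \<gamma>: "(\<gamma> has_vector_derivative xjac p \<xi> T \<kappa> z *v y) (at 0)"
  obtains c where "c 0 = z" "(c has_vector_derivative y) (at 0)"
    "\<forall>\<^sub>F t in nhds 0. xmap p \<xi> T \<kappa> (c t) = \<gamma> t"
proof -
  let ?X = "xmap p \<xi> T \<kappa>" and ?A = "xjac p \<xi> T \<kappa>"
  \<comment> \<open>The derivative as a bounded linear map, so that its continuous dependence on the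
    point can be stated.\<close>
  define F :: "real^2 \<Rightarrow> (real^2) \<Rightarrow>\<^sub>L (real^2)" where
    "F z = (blinfun_scaleR_left (xdiff p \<xi> T \<kappa> 1 z) o\<^sub>L Blinfun (\<lambda>d. d $ 1))
         + (blinfun_scaleR_left (xdiff p \<xi> T \<kappa> 2 z) o\<^sub>L Blinfun (\<lambda>d. d $ 2))" for z
  have F: "blinfun_apply (F z) = (*v) (?A z)" for z
    by (rule ext) (simp add: F_def blinfun.add_left bounded_linear_Blinfun_apply bounded_linear_vec_nth xjac_mult)
  have contF: "continuous_on UNIV F"
    unfolding F_def[abs_def]
    by (intro continuous_on_add bounded_bilinear.continuous_on[OF bounded_bilinear_blinfun_compose]
        bounded_linear.continuous_on[OF bounded_linear_blinfun_scaleR_left] continuous_on_xdiff continuous_on_const)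
  have inv: "invertible (?A z)" using det by (simp add: invertible_det_nz)
  then obtain B where B: "?A z ** B = mat 1" "B ** ?A z = mat 1" by (auto simp: invertible_def)
  have id: "Blinfun ((*v) B) o\<^sub>L F z = id_blinfun"
    by (rule blinfun_eqI)
       (simp add: bounded_linear_Blinfun_apply matrix_vector_mul_bounded_linear F matrix_vector_mul_assoc B)
  obtain U V G G' where U: "z \<in> U" "open V" "?X z \<in> V" "homeomorphism U V ?X G"
    and G': "\<And>x. x \<in> V \<Longrightarrow> (G has_derivative G' x) (at x)"
    "\<And>x. x \<in> V \<Longrightarrow> G' x = inv (blinfun_apply (F (G x)))"
    "\<And>x. x \<in> V \<Longrightarrow> bij (blinfun_apply (F (G x)))"
    by (rule inverse_function_theorem[of UNIV ?X F z "Blinfun ((*v) B)"])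
       (use xmap_has_derivative_xjac contF id in \<open>auto simp: F\<close>)
  have Gz: "G (?X z) = z" using U by (simp add: homeomorphism_def)
  show thesis
  proof (rule that[of "G \<circ> \<gamma>"])
    show "(G \<circ> \<gamma>) 0 = z" by (simp add: \<gamma>0 Gz)
    have "(G has_derivative G' (?X z)) (at (\<gamma> 0) within range \<gamma>)"
      unfolding \<gamma>0 by (rule has_derivative_at_withinI[OF G'(1)[OF U(3)]])
    then have "((G \<circ> \<gamma>) has_vector_derivative G' (?X z) (?A z *v y)) (at 0)"
      by (rule vector_derivative_diff_chain_within[OF \<gamma>])
    moreover have "G' (?X z) (?A z *v y) = y"
      using G'(2,3)[OF U(3)] by (simp add: Gz F inv_f_f bij_is_inj)
    ultimately show "((G \<circ> \<gamma>) has_vector_derivative y) (at 0)" by simp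
    have "(\<gamma> \<longlongrightarrow> \<gamma> 0) (nhds 0)"
      using has_vector_derivative_continuous[OF \<gamma>] by (simp add: isCont_def tendsto_at_iff_tendsto_nhds)
    then have "\<forall>\<^sub>F t in nhds 0. \<gamma> t \<in> V"
      by (rule topological_tendstoD) (use U(2,3) \<gamma>0 in auto)
    then show "\<forall>\<^sub>F t in nhds 0. ?X ((G \<circ> \<gamma>) t) = \<gamma> t"
      by (rule eventually_mono) (use U(4) in \<open>simp add: homeomorphism_def\<close>)
  qed
qed

lemma side_point_eq: "side_point sd s = side_point sd 0 + s *\<^sub>R side_tangent sd"
  by (cases sd) (simp_all add: vec_eq_iff forall_2)

text \<open>Near a relatively interior point of a side, the constraint belonging to that side is the
  only one that can fail.\<close>

lemma near_side_interior:
  assumes "\<bar>s\<bar> < 1"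
  obtains \<delta> where "0 < \<delta>"
    "\<And>y. dist y (side_point sd s) < \<delta> \<Longrightarrow> y \<bullet> side_outward sd < 1 \<Longrightarrow> y \<in> interior ref_square"
proof (rule that[of "1 - \<bar>s\<bar>"])
  show "0 < 1 - \<bar>s\<bar>" using assms by simp
  fix y assume y: "dist y (side_point sd s) < 1 - \<bar>s\<bar>" "y \<bullet> side_outward sd < 1"
  have "\<bar>y $ i - side_point sd s $ i\<bar> < 1 - \<bar>s\<bar>" for i
    using dist_vec_nth_le[of y i "side_point sd s"] y(1) by (simp add: dist_real_def)
  from this[of 1] this[of 2] show "y \<in> interior ref_square"
    using y(2) assms by (cases sd) (auto simp: interior_ref_square_iff inner_vec_def sum_2 abs_less_iff)
qed

text \<open>A straight reference line leads from the common edge point into \<open>\<kappa>\<close>.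
  Its image, lifted to the reference square of \<open>\<kappa>'\<close>, starts with velocity
  \<open>- (\<alpha> *\<^sub>R side_outward sd' + \<beta> *\<^sub>R side_tangent sd')\<close>, which
  points inward because \<open>\<alpha>\<close> is positive; its points belong to both elements for
  a short time.\<close>

lemma overlap_if_same_side:
  assumes s: "\<bar>s\<bar> < 1" "\<bar>s'\<bar> < 1"
    and eq: "xmap p \<xi> T \<kappa> (side_point sd s) = xmap p \<xi> T \<kappa>' (side_point sd' s')"
    and det: "det (xjac p \<xi> T \<kappa>' (side_point sd' s')) \<noteq> 0"
    and w: "xjac p \<xi> T \<kappa> (side_point sd s) *v side_outward sd =
       xjac p \<xi> T \<kappa>' (side_point sd' s') *v (\<alpha> *\<^sub>R side_outward sd' + \<beta> *\<^sub>R side_tangent sd')"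
    and \<alpha>: "0 < \<alpha>"
  shows "xmap p \<xi> T \<kappa> ` interior ref_square \<inter> xmap p \<xi> T \<kappa>' ` interior ref_square \<noteq> {}"
proof -
  let ?X = "xmap p \<xi> T \<kappa>" and ?X' = "xmap p \<xi> T \<kappa>'"
  let ?z = "side_point sd s" and ?z' = "side_point sd' s'"
  define y where "y = - (\<alpha> *\<^sub>R side_outward sd' + \<beta> *\<^sub>R side_tangent sd')"
  define \<gamma> where "\<gamma> t = ?X (?z - t *\<^sub>R side_outward sd)" for t
  have lin: "((\<lambda>t. ?z - t *\<^sub>R side_outward sd) has_vector_derivative - side_outward sd) (at 0)"
    by (auto intro!: derivative_eq_intros)
  have "(?X has_derivative (*v) (xjac p \<xi> T \<kappa> ?z))
      (at (?z - 0 *\<^sub>R side_outward sd) within range (\<lambda>t. ?z - t *\<^sub>R side_outward sd))"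
    using has_derivative_at_withinI[OF xmap_has_derivative_xjac] by simp
  from vector_derivative_diff_chain_within[OF lin this]
  have "(\<gamma> has_vector_derivative xjac p \<xi> T \<kappa> ?z *v - side_outward sd) (at 0)"
    by (simp add: \<gamma>_def[abs_def] o_def)
  moreover have "xjac p \<xi> T \<kappa> ?z *v - side_outward sd = xjac p \<xi> T \<kappa>' ?z' *v y"
    unfolding y_def linear_neg[OF matrix_vector_mul_linear] w ..
  ultimately have \<gamma>': "(\<gamma> has_vector_derivative xjac p \<xi> T \<kappa>' ?z' *v y) (at 0)" by simp
  have \<gamma>0: "\<gamma> 0 = ?X' ?z'" by (simp add: \<gamma>_def eq)
  obtain c where c: "c 0 = ?z'" "(c has_vector_derivative y) (at 0)"
    "\<forall>\<^sub>F t in nhds 0. ?X' (c t) = \<gamma> t"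
    using xmap_lift_curve[OF det \<gamma>0 \<gamma>'] by blast
  have out1: "side_outward sd \<bullet> side_outward sd = 1" for sd
    by (cases sd) (simp_all add: inner_vec_def sum_2)
  have out2: "side_tangent sd \<bullet> side_outward sd = 0" for sd
    by (cases sd) (simp_all add: inner_vec_def sum_2)
  have out3: "side_point sd s \<bullet> side_outward sd = 1" for sd s
    by (cases sd) (simp_all add: inner_vec_def sum_2)
  note out = out1 out2 out3
  obtain \<delta> where \<delta>: "0 < \<delta>" "\<And>y. dist y ?z < \<delta> \<Longrightarrow> y \<bullet> side_outward sd < 1 \<Longrightarrow> y \<in> interior ref_square"
    using near_side_interior[OF s(1), of sd] by blast
  obtain \<delta>' where \<delta>': "0 < \<delta>'" "\<And>y. dist y ?z' < \<delta>' \<Longrightarrow> y \<bullet> side_outward sd' < 1 \<Longrightarrow> y \<in> interior ref_square"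
    using near_side_interior[OF s(2), of sd'] by blast
  \<comment> \<open>The outward coordinate of the lifted curve has derivative
    \<open>- \<alpha>\<close>, so it falls below its boundary value for small positive
    \<open>t\<close>.\<close>
  have "((\<lambda>t. c t \<bullet> side_outward sd') has_vector_derivative y \<bullet> side_outward sd') (at 0)"
    by (rule bounded_linear.has_vector_derivative[OF bounded_linear_inner_left c(2)])
  then have "((\<lambda>t. c t \<bullet> side_outward sd') has_real_derivative - \<alpha>) (at 0)"
    by (simp add: has_real_derivative_iff_has_vector_derivative y_def inner_add_left inner_diff_left out)
  then obtain d where d: "0 < d" "\<And>t. 0 < t \<Longrightarrow> t < d \<Longrightarrow> c t \<bullet> side_outward sd' < c 0 \<bullet> side_outward sd'"
    using DERIV_neg_dec_right[of "\<lambda>t. c t \<bullet> side_outward sd'" "- \<alpha>" 0] \<alpha> by auto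
  have "isCont c 0" by (rule has_vector_derivative_continuous[OF c(2)])
  then have "\<forall>\<^sub>F t in at_right 0. dist (c t) ?z' < \<delta>'"
    using tendstoD[of c ?z' "at 0" \<delta>'] \<delta>'(1) by (simp add: isCont_def c(1) eventually_at_split)
  moreover have "\<forall>\<^sub>F t in at_right 0. dist (?z - t *\<^sub>R side_outward sd) ?z < \<delta>"
  proof -
    have "((\<lambda>t. ?z - t *\<^sub>R side_outward sd) \<longlongrightarrow> ?z - 0 *\<^sub>R side_outward sd) (at_right 0)"
      by (intro tendsto_intros)
    then show ?thesis using \<delta>(1) by (auto dest: tendstoD)
  qed
  moreover have "\<forall>\<^sub>F t in at_right 0. 0 < t \<and> t < d"
    using eventually_at_right[of 0 d "\<lambda>t. 0 < t \<and> t < d"] d(1) by auto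
  moreover have "\<forall>\<^sub>F t in at_right 0. ?X' (c t) = \<gamma> t"
    using c(3) by (auto simp: eventually_at_filter elim: eventually_mono)
  ultimately have "\<forall>\<^sub>F t in at_right (0::real). \<exists>t. dist (c t) ?z' < \<delta>' \<and>
      dist (?z - t *\<^sub>R side_outward sd) ?z < \<delta> \<and> 0 < t \<and> t < d \<and> ?X' (c t) = \<gamma> t"
    by eventually_elim blast
  then obtain t where t: "dist (c t) ?z' < \<delta>'" "dist (?z - t *\<^sub>R side_outward sd) ?z < \<delta>"
    "0 < t" "t < d" "?X' (c t) = \<gamma> t"
    using eventually_happens'[of "at_right (0::real)"] trivial_limit_at_right_real by blast
  have "c t \<in> interior ref_square"
    using \<delta>'(2)[OF t(1)] d(2)[OF t(3,4)] by (simp add: c(1) out)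
  moreover have "?z - t *\<^sub>R side_outward sd \<in> interior ref_square"
  proof (rule \<delta>(2)[OF t(2)])
    show "(?z - t *\<^sub>R side_outward sd) \<bullet> side_outward sd < 1"
      using t(3) by (simp add: inner_diff_left out)
  qed
  ultimately show ?thesis using t(5) unfolding \<gamma>_def by (metis IntI empty_iff imageI)
qed

lemma cross2_side:
  "\<bar>cross2 (xjac p \<xi> T \<kappa> z *v side_tangent sd) (xjac p \<xi> T \<kappa> z *v side_outward sd)\<bar> =
   \<bar>det (xjac p \<xi> T \<kappa> z)\<bar>"
  by (cases sd) (simp_all add: xjac_mult det_xjac cross2_def abs_minus_commute mult.commute)

text \<open>Cramer's rule in the basis \<open>b\<close>, \<open>c\<close>.\<close>

lemma cross2_decomposition:
  assumes "cross2 c b \<noteq> 0"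
  shows "a = (cross2 c a / cross2 c b) *\<^sub>R b + (cross2 a b / cross2 c b) *\<^sub>R c"
proof -
  have "cross2 c b * a $ i = cross2 c a * b $ i + cross2 a b * c $ i" for i
    using exhaust_2[of i] by (auto simp: cross2_def algebra_simps)
  then show ?thesis using assms by (simp add: vec_eq_iff field_simps)
qed

text \<open>In the plane the vectors orthogonal to \<open>c\<close> form the line spanned by the
  rotated \<open>c\<close>. Signs of \<open>n \<bullet> w\<close> can thus be compared through
  \<open>cross2 c w\<close>.\<close>

lemma orthogonal_eq_scaled_rotation:
  fixes n c :: "real^2"
  assumes "n \<bullet> c = 0" "c \<noteq> 0"
  obtains \<nu> where "\<And>w. n \<bullet> w = \<nu> * cross2 c w"
proof -
  have cc: "0 < c \<bullet> c" using assms(2) by simp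
  have "(c \<bullet> c) * (n \<bullet> w) = cross2 c n * cross2 c w" for w
  proof -
    have "(c \<bullet> c) * (n \<bullet> w) = cross2 c n * cross2 c w + (n \<bullet> c) * (c \<bullet> w)"
      by (simp add: inner_vec_def sum_2 cross2_def algebra_simps)
    then show ?thesis using assms(1) by simp
  qed
  then have "n \<bullet> w = cross2 c n / (c \<bullet> c) * cross2 c w" for w
    using cc by (simp add: field_simps)
  then show thesis by (rule that)
qed

lemma unit_orthogonal_cases:
  fixes n n' c :: "real^2"
  assumes "norm n = 1" "norm n' = 1" "n \<bullet> c = 0" "n' \<bullet> c = 0" "c \<noteq> 0"
  shows "n' = n \<or> n' = - n"
proof -
  obtain \<nu> where \<nu>: "\<And>w. n \<bullet> w = \<nu> * cross2 c w" using orthogonal_eq_scaled_rotation[OF assms(3,5)] by blast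
  obtain \<mu> where \<mu>: "\<And>w. n' \<bullet> w = \<mu> * cross2 c w" using orthogonal_eq_scaled_rotation[OF assms(4,5)] by blast
  have "n \<bullet> n = 1" "n' \<bullet> n' = 1" using assms(1,2) by (simp_all add: norm_eq_1)
  then have 1: "\<nu> * cross2 c n = 1" "\<mu> * cross2 c n' = 1" using \<nu>[of n] \<mu>[of n'] by simp_all
  have "\<mu> * cross2 c n = \<nu> * cross2 c n'" using \<nu>[of n'] \<mu>[of n] by (simp add: inner_commute)
  then have "\<mu> * \<mu> = \<nu> * \<nu>" using 1
    by (metis mult.assoc mult.commute mult.right_neutral)
  then have "\<mu> = \<nu> \<or> \<mu> = - \<nu>" by (simp add: square_eq_iff)
  then have "(\<forall>w. n' \<bullet> w = n \<bullet> w) \<or> (\<forall>w. n' \<bullet> w = (- n) \<bullet> w)" using \<nu> \<mu> by auto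
  then show ?thesis by (metis vector_eq_rdot)
qed

lemma side_curve_has_vector_derivative:
  "((\<lambda>t. xmap p \<xi> T \<kappa> (side_point sd (\<sigma> * t))) has_vector_derivative
     xjac p \<xi> T \<kappa> (side_point sd (\<sigma> * t)) *v (\<sigma> *\<^sub>R side_tangent sd)) (at t within S)"
proof -
  have "((\<lambda>t. side_point sd 0 + (\<sigma> * t) *\<^sub>R side_tangent sd) has_vector_derivative \<sigma> *\<^sub>R side_tangent sd) (at t within S)"
    by (auto intro!: derivative_eq_intros)
  then have "((\<lambda>t. side_point sd (\<sigma> * t)) has_vector_derivative \<sigma> *\<^sub>R side_tangent sd) (at t within S)"
    by (simp only: side_point_eq[symmetric])
  from vector_derivative_diff_chain_within[OF this has_derivative_at_withinI[OF xmap_has_derivative_xjac]]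
  show ?thesis by (simp add: o_def)
qed

lemma emap_vector_derivative:
  assumes "watertight p \<xi> T" "\<kappa> \<in> elems T" "t \<in> {-1..1}"
  defines "\<sigma> \<equiv> \<lambda>sd. edge_sign p \<xi> T \<kappa> sd"
  shows "vector_derivative (emap T (side_edge p \<xi> T \<kappa> sd)) (at t within {-1..1}) =
     xjac p \<xi> T \<kappa> (side_point sd (\<sigma> sd * t)) *v (\<sigma> sd *\<^sub>R side_tangent sd)"
proof (rule vector_derivative_within_closed_interval)
  show "(emap T (side_edge p \<xi> T \<kappa> sd) has_vector_derivative
     xjac p \<xi> T \<kappa> (side_point sd (\<sigma> sd * t)) *v (\<sigma> sd *\<^sub>R side_tangent sd)) (at t within {-1..1})"
    by (rule has_vector_derivative_transform[OF assms(3) _ side_curve_has_vector_derivative])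
       (simp add: emap_eq_xmap[OF assms(1,2)] \<sigma>_def)
qed (use assms in auto)

lemma continuous_on_xjac_side:
  "continuous_on S (\<lambda>t. xjac p \<xi> T \<kappa> (side_point sd (\<sigma> * t)) *v d)"
proof -
  have "continuous_on S (\<lambda>t. side_point sd (\<sigma> * t))"
    by (subst side_point_eq) (intro continuous_intros)
  then show ?thesis
    unfolding xjac_mult by (intro continuous_intros continuous_on_compose2[OF continuous_on_xdiff]) auto
qed

text \<open>If the normals agreed, both elements would lie on the same side of the edge near one of its
  relatively interior points.\<close>

lemma enormal_opposite:
  assumes mesh: "dgsem_mesh p \<xi> \<Omega> T" and gl: "gauss_lobatto p \<xi> \<omega>"
    and \<kappa>: "\<kappa> \<in> elems T" "\<kappa>' \<in> elems T" "\<kappa> \<noteq> \<kappa>'"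
    and e: "e = side_edge p \<xi> T \<kappa> sd" "e = side_edge p \<xi> T \<kappa>' sd'" and k: "k \<le> p"
  shows "enormal T \<kappa>' e k = - enormal T \<kappa> e k"
proof (rule ccontr)
  assume not_opp: "enormal T \<kappa>' e k \<noteq> - enormal T \<kappa> e k"
  have wt: "watertight p \<xi> T" and fm: "face_metrics p \<xi> T" and mr: "mesh_regular p \<xi> T"
    and mp: "mesh_partition p \<xi> \<Omega> T"
    using mesh by (simp_all add: dgsem_mesh_def)
  define \<sigma> where "\<sigma> = edge_sign p \<xi> T \<kappa> sd"
  define \<sigma>' where "\<sigma>' = edge_sign p \<xi> T \<kappa>' sd'"
  have \<sigma>: "\<bar>\<sigma>\<bar> = 1" "\<sigma>' = 1 \<or> \<sigma>' = -1"
    using edge_sign_cases[of p \<xi> T \<kappa> sd] edge_sign_cases[of p \<xi> T \<kappa>' sd'] by (auto simp: \<sigma>_def \<sigma>'_def)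
  define A where "A t = xjac p \<xi> T \<kappa> (side_point sd (\<sigma> * t))" for t
  define A' where "A' t = xjac p \<xi> T \<kappa>' (side_point sd' (\<sigma>' * t))" for t
  define c where "c t = A t *v (\<sigma> *\<^sub>R side_tangent sd)" for t
  have k1: "\<xi> k \<in> {-1..1}" using gauss_lobatto_node_bounds[OF gl k] by simp
  have c: "vector_derivative (emap T e) (at t within {-1..1}) = c t"
    and c': "c t = A' t *v (\<sigma>' *\<^sub>R side_tangent sd')" if "t \<in> {-1..1}" for t
    using emap_vector_derivative[OF wt \<kappa>(1) that, of sd] emap_vector_derivative[OF wt \<kappa>(2) that, of sd']
    by (simp_all add: e(1)[symmetric] e(2)[symmetric] c_def A_def A'_def \<sigma>_def \<sigma>'_def)
  have tangent: "edge_tangent \<xi> T e k = c (\<xi> k)" using c[OF k1] by (simp only: edge_tangent_def)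
  let ?n = "enormal T \<kappa> e k" and ?n' = "enormal T \<kappa>' e k"
  have out: "outward_unit_normal p \<xi> T \<kappa> sd k ?n" "outward_unit_normal p \<xi> T \<kappa>' sd' k ?n'"
    using fm \<kappa> k unfolding face_metrics_def e(1)[symmetric] by (metis e(1), metis e(2))
  have n: "norm ?n = 1" "?n \<bullet> c (\<xi> k) = 0" "norm ?n' = 1" "?n' \<bullet> c (\<xi> k) = 0"
    using out unfolding outward_unit_normal_def e(1)[symmetric] e(2)[symmetric] tangent by auto
  have sk: "\<sigma> * \<xi> k \<in> {-1..1}" "\<sigma>' * \<xi> k \<in> {-1..1}"
    using k1 \<sigma> by (auto simp: abs_if split: if_splits)
  have nw: "0 < ?n \<bullet> (A (\<xi> k) *v side_outward sd)"
    using out(1) sk(1) emap_eq_xmap[OF wt \<kappa>(1) k1, of sd]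
    unfolding outward_unit_normal_def A_def \<sigma>_def by simp
  have nw': "0 < ?n' \<bullet> (A' (\<xi> k) *v side_outward sd')"
    using out(2) sk(2) emap_eq_xmap[OF wt \<kappa>(2) k1, of sd']
    unfolding outward_unit_normal_def A'_def \<sigma>'_def by simp
  have "e \<in> edges p \<xi> T \<kappa>" by (simp add: edges_eq e(1))
  then have "0 < Jedge \<xi> T e k" using mr \<kappa>(1) k unfolding mesh_regular_def Let_def by blast
  then have c0: "c (\<xi> k) \<noteq> 0" by (simp add: Jedge_def tangent)
  have nn: "?n' = ?n" using unit_orthogonal_cases[OF n(1,3,2,4) c0] not_opp by blast
  \<comment> \<open>Positive exactly when the images of both outward directions lie strictly on the
    same side of the tangent.\<close>
  define \<phi> where "\<phi> t = cross2 (c t) (A t *v side_outward sd) * cross2 (c t) (A' t *v side_outward sd')" for t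
  have \<phi>k: "0 < \<phi> (\<xi> k)"
  proof -
    obtain \<nu> where \<nu>: "\<And>w. ?n \<bullet> w = \<nu> * cross2 (c (\<xi> k)) w"
      using orthogonal_eq_scaled_rotation[OF n(2) c0] by blast
    have "0 < (?n \<bullet> (A (\<xi> k) *v side_outward sd)) * (?n \<bullet> (A' (\<xi> k) *v side_outward sd'))"
      using nw nw' nn by simp
    also have "\<dots> = \<nu>\<^sup>2 * \<phi> (\<xi> k)" by (simp add: \<nu> \<phi>_def power2_eq_square mult_ac)
    finally show ?thesis by (simp add: zero_less_mult_iff)
  qed
  have "continuous_on UNIV \<phi>"
    unfolding \<phi>_def[abs_def] cross2_def c_def A_def A'_def
    by (intro continuous_intros continuous_on_xjac_side)
  then have "\<forall>\<^sub>F t in at (\<xi> k). 0 < \<phi> t"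
    using \<phi>k by (intro order_tendstoD(1)) (auto simp: continuous_on_def)
  then obtain \<delta> where \<delta>: "0 < \<delta>" "\<And>t. t \<noteq> \<xi> k \<Longrightarrow> dist t (\<xi> k) < \<delta> \<Longrightarrow> 0 < \<phi> t"
    unfolding eventually_at by blast
  \<comment> \<open>The node may be an end point of the edge, that is, a corner of the elements.
    Shrinking by the factor \<open>1 - \<eta>\<close> moves it to a parameter inside the edge at
    which \<open>\<phi>\<close> is still positive.\<close>
  define \<eta> where "\<eta> = min (\<delta> / 2) (1 / 2)"
  define t where "t = (1 - \<eta>) * \<xi> k"
  have \<eta>: "0 < \<eta>" "\<eta> < 1" "\<eta> < \<delta>" using \<delta>(1) by (auto simp: \<eta>_def)
  have "\<bar>\<xi> k\<bar> \<le> 1" using k1 by auto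
  then have "\<bar>t\<bar> \<le> (1 - \<eta>) * 1" unfolding t_def abs_mult using \<eta> by (intro mult_mono) auto
  then have t1: "\<bar>t\<bar> < 1" using \<eta> by simp
  have "dist t (\<xi> k) = \<eta> * \<bar>\<xi> k\<bar>" using \<eta> by (simp add: t_def dist_real_def left_diff_distrib abs_mult)
  also have "\<dots> \<le> \<eta>" using \<eta> \<open>\<bar>\<xi> k\<bar> \<le> 1\<close> by (simp add: mult_left_le)
  finally have pos: "0 < \<phi> t" using \<delta>(2)[of t] \<phi>k \<eta> by (cases "t = \<xi> k") auto
  have tI: "t \<in> {-1..1}" using t1 by auto
  define w where "w = A t *v side_outward sd"
  define w' where "w' = A' t *v side_outward sd'"
  have cw': "cross2 (c t) w' \<noteq> 0" using pos by (auto simp: \<phi>_def w'_def)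
  define \<alpha> where "\<alpha> = cross2 (c t) w / cross2 (c t) w'"
  \<comment> \<open>\<open>c t\<close> is the image of \<open>\<sigma>'\<close> times the reference
    tangent, hence the sign.\<close>
  define \<beta> where "\<beta> = cross2 w w' / cross2 (c t) w' * \<sigma>'"
  have \<alpha>: "0 < \<alpha>"
    using pos by (auto simp: \<alpha>_def \<phi>_def w_def w'_def zero_less_divide_iff zero_less_mult_iff)
  have wA: "w = A' t *v (\<alpha> *\<^sub>R side_outward sd' + \<beta> *\<^sub>R side_tangent sd')"
    using cross2_decomposition[OF cw', of w] c'[OF tI]
    by (simp add: \<alpha>_def \<beta>_def w'_def matrix_vector_right_distrib matrix_vector_mult_scaleR)
  \<comment> \<open>The mesh assumptions give positive Jacobians at the nodes only; at
    \<open>t\<close> the matrix is nonsingular because the cross product is nonzero.\<close>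
  have det: "det (A' t) \<noteq> 0"
  proof -
    have "cross2 (A' t *v side_tangent sd') w' \<noteq> 0"
      using cw' c'[OF tI] by (auto simp: matrix_vector_mult_scaleR cross2_def algebra_simps)
    then show ?thesis using cross2_side[of p \<xi> T \<kappa>' "side_point sd' (\<sigma>' * t)" sd'] by (auto simp: A'_def w'_def)
  qed
  have xeq: "xmap p \<xi> T \<kappa> (side_point sd (\<sigma> * t)) = xmap p \<xi> T \<kappa>' (side_point sd' (\<sigma>' * t))"
    using emap_eq_xmap[OF wt \<kappa>(1) tI, of sd] emap_eq_xmap[OF wt \<kappa>(2) tI, of sd']
    by (simp add: e(1)[symmetric] e(2)[symmetric] \<sigma>_def \<sigma>'_def)
  have lt: "\<bar>\<sigma> * t\<bar> < 1" "\<bar>\<sigma>' * t\<bar> < 1" using t1 \<sigma> by (auto simp: abs_mult)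
  have "xmap p \<xi> T \<kappa> ` interior ref_square \<inter> xmap p \<xi> T \<kappa>' ` interior ref_square \<noteq> {}"
    by (rule overlap_if_same_side[OF lt xeq det[unfolded A'_def] wA[unfolded w_def A_def A'_def] \<alpha>])
  moreover have "\<kappa> = xmap p \<xi> T \<kappa> ` interior ref_square" "\<kappa>' = xmap p \<xi> T \<kappa>' ` interior ref_square"
    using mp \<kappa> unfolding mesh_partition_def by blast+
  ultimately have "\<kappa> \<inter> \<kappa>' \<noteq> {}" by simp
  then show False using mp \<kappa> by (auto simp: mesh_partition_def pairwise_def disjnt_def)
qed

section \<open>Areas of the elements\<close>

text \<open>Iterated integrals are computed on the product type, while elements live in
  \<open>real^2\<close>. The coordinate map between the two takes boxes to boxes of the same
  content.\<close>

lemma has_integral_cart2: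
  fixes f :: "real \<Rightarrow> real \<Rightarrow> real"
  assumes "((\<lambda>(x, y). f x y) has_integral I) (cbox (-1, -1) (1, 1))"
  shows "((\<lambda>z. f (z $ 1) (z $ 2)) has_integral I) (cbox (-1) (1 :: real^2))"
proof -
  let ?g = "\<lambda>z :: real^2. (z $ 1, z $ 2)" and ?h = "\<lambda>z. vector [fst z, snd z] :: real^2"
  have gh: "?g (?h z) = z" and hg: "?h (?g x) = x" for z x
    by (simp_all add: vec_eq_iff forall_2)
  have mem_g: "?g x \<in> cbox (u $ 1, u $ 2) (v $ 1, v $ 2) \<longleftrightarrow> x \<in> cbox u v" for x u v
    by (auto simp: mem_box_cart forall_2 cbox_Pair_eq)
  have mem_h: "?h z \<in> cbox (?h u) (?h v) \<longleftrightarrow> z \<in> cbox u v" for z u v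
    by (cases z; cases u; cases v) (auto simp: mem_box_cart forall_2 cbox_Pair_eq)
  have g: "?g ` cbox u v = cbox (u $ 1, u $ 2) (v $ 1, v $ 2)" for u v
  proof (intro equalityI subsetI)
    fix z assume "z \<in> cbox (u $ 1, u $ 2) (v $ 1, v $ 2)"
    then have "?g (?h z) \<in> cbox (u $ 1, u $ 2) (v $ 1, v $ 2)" by (simp only: gh)
    then have "?h z \<in> cbox u v" by (simp only: mem_g)
    then show "z \<in> ?g ` cbox u v" by (rule rev_image_eqI) (simp only: gh)
  qed (use mem_g in blast)
  have h: "?h ` cbox u v = cbox (?h u) (?h v)" for u v
  proof (intro equalityI subsetI)
    fix z assume "z \<in> cbox (?h u) (?h v)"
    then have "?h (?g z) \<in> cbox (?h u) (?h v)" by (simp only: hg)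
    then have "?g z \<in> cbox u v" by (simp only: mem_h)
    then show "z \<in> ?h ` cbox u v" by (rule rev_image_eqI) (simp only: hg)
  qed (use mem_h in blast)
  have content: "measure lborel (?g ` cbox u v) = 1 * measure lborel (cbox u v)" for u v :: "real^2"
  proof -
    have "cbox u v = {} \<longleftrightarrow> \<not> (u $ 1 \<le> v $ 1 \<and> u $ 2 \<le> v $ 2)"
      unfolding interval_eq_empty_cart forall_2[of "\<lambda>i. u $ i \<le> v $ i", symmetric]
      by (simp add: not_le)
    then show ?thesis
      unfolding g by (auto simp: content_Pair content_cbox_if_cart UNIV_2 content_real_if)
  qed
  have "((\<lambda>z. (\<lambda>(x, y). f x y) (?g z)) has_integral (1 / 1) *\<^sub>R I) (?h ` cbox (-1, -1) (1, 1))"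
  proof (rule has_integral_twiddle[OF zero_less_one])
    show "isCont ?g z" for z by (intro continuous_intros)
    show "\<exists>w z. ?g ` cbox u v = cbox w z" for u v using g by blast
    show "\<exists>w z. ?h ` cbox u v = cbox w z" for u v using h by blast
    show "measure lborel (?g ` cbox u v) = 1 * measure lborel (cbox u v)" for u v by (rule content)
  qed (use assms in \<open>auto simp: vec_eq_iff forall_2\<close>)
  moreover have "vector [-1, -1] = (-1 :: real^2)" "vector [1, 1] = (1 :: real^2)"
    by (simp_all add: vec_eq_iff forall_2)
  ultimately show ?thesis by (simp add: h)
qed

lemma gauss_lobatto_tensor:
  assumes gl: "gauss_lobatto s \<xi> \<omega>" and deg: "degree P \<le> 2 * s - 1" "degree R \<le> 2 * s - 1"
  shows "((\<lambda>z. poly P (z $ 1) * poly R (z $ 2)) has_integral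
     (\<Sum>i\<le>s. \<Sum>j\<le>s. \<omega> i * \<omega> j * (poly P (\<xi> i) * poly R (\<xi> j)))) (cbox (-1) (1 :: real^2))"
proof (rule has_integral_cart2)
  let ?f = "\<lambda>(x, y). poly P x * poly R y"
  have cont: "continuous_on (cbox (-1, -1) (1, 1)) ?f"
    unfolding split_beta by (intro continuous_intros)
  have "integral (cbox (-1, -1) (1, 1)) ?f = integral (cbox (-1) 1) (\<lambda>x. integral (cbox (-1) 1) (\<lambda>y. poly P x * poly R y))"
    using integral_prod_continuous[OF cont] by simp
  also have "\<dots> = integral {-1..1} (poly P) * integral {-1..1} (poly R)" by simp
  also have "\<dots> = (\<Sum>i\<le>s. \<Sum>j\<le>s. \<omega> i * \<omega> j * (poly P (\<xi> i) * poly R (\<xi> j)))"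
    by (simp add: gauss_lobatto_exact[OF gl deg(1), symmetric] gauss_lobatto_exact[OF gl deg(2), symmetric]
        sum_product mult_ac)
  finally show "(?f has_integral (\<Sum>i\<le>s. \<Sum>j\<le>s. \<omega> i * \<omega> j * (poly P (\<xi> i) * poly R (\<xi> j)))) (cbox (-1, -1) (1, 1))"
    using integrable_integral[OF integrable_continuous[OF cont]] by simp
qed

lemma cross2_sum_left: "cross2 (sum a A) b = (\<Sum>i\<in>A. cross2 (a i) b)"
  by (simp add: cross2_def sum_distrib_right sum_subtractf)

lemma cross2_sum_right: "cross2 b (sum a A) = (\<Sum>i\<in>A. cross2 b (a i))"
  by (simp add: cross2_def sum_distrib_left sum_subtractf)

lemma cross2_scaleR: "cross2 (x *\<^sub>R a) (y *\<^sub>R b) = x * y * cross2 a b"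
  by (simp add: cross2_def algebra_simps)

text \<open>The determinant is bilinear in the two partial derivatives, and each of its terms is
  differentiated once in each variable. Its degree in either variable is therefore at most
  \<open>2 * p - 1\<close>, and the tensor rule is exact.\<close>

lemma det_xjac_has_integral:
  assumes gl: "gauss_lobatto p \<xi> \<omega>" and p: "1 \<le> p"
  shows "((\<lambda>z. det (xjac p \<xi> T \<kappa> z)) has_integral (\<Sum>i\<le>p. \<Sum>j\<le>p. \<omega> i * \<omega> j * Jdet p \<xi> T \<kappa> i j))
    (cbox (-1) 1)"
proof -
  define E where "E F \<longleftrightarrow> (F has_integral (\<Sum>i\<le>p. \<Sum>j\<le>p. \<omega> i * \<omega> j * F (vector [\<xi> i, \<xi> j]))) (cbox (-1) 1)"
    for F :: "real^2 \<Rightarrow> real"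
  have E_sum: "E (\<lambda>z. \<Sum>a\<in>A. F a z)" if fin: "finite A" and E: "\<And>a. a \<in> A \<Longrightarrow> E (F a)"
    for A :: "nat set" and F
  proof -
    have "(\<Sum>i\<le>p. \<Sum>j\<le>p. \<omega> i * \<omega> j * (\<Sum>a\<in>A. F a (vector [\<xi> i, \<xi> j])))
        = (\<Sum>i\<le>p. \<Sum>j\<le>p. \<Sum>a\<in>A. \<omega> i * \<omega> j * F a (vector [\<xi> i, \<xi> j]))"
      by (simp add: sum_distrib_left)
    also have "\<dots> = (\<Sum>i\<le>p. \<Sum>a\<in>A. \<Sum>j\<le>p. \<omega> i * \<omega> j * F a (vector [\<xi> i, \<xi> j]))"
      by (intro sum.cong refl sum.swap)
    also have "\<dots> = (\<Sum>a\<in>A. \<Sum>i\<le>p. \<Sum>j\<le>p. \<omega> i * \<omega> j * F a (vector [\<xi> i, \<xi> j]))"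
      by (rule sum.swap)
    finally show ?thesis
      unfolding E_def by (simp only:) (rule has_integral_sum[OF fin], rule E[unfolded E_def])
  qed
  let ?l = "lagrange p \<xi>" and ?X = "node T \<kappa>"
  have E_prod: "E (\<lambda>z. (poly P (z $ 1) * poly R (z $ 2)) * c)"
    if "degree P \<le> 2 * p - 1" "degree R \<le> 2 * p - 1" for P R c
    unfolding E_def
    using has_integral_mult_left[OF gauss_lobatto_tensor[OF gl that], of c]
    by (simp add: sum_distrib_right mult.assoc)
  have deg: "degree (pderiv (?l i) * ?l k) \<le> 2 * p - 1" if "i \<le> p" "k \<le> p" for i k
    using degree_mult_le[of "pderiv (?l i)" "?l k"] degree_pderiv[of "?l i"]
      degree_lagrange_le[OF that(1), of \<xi>] degree_lagrange_le[OF that(2), of \<xi>] p by linarith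
  have det: "det (xjac p \<xi> T \<kappa> z) = (\<Sum>i\<le>p. \<Sum>j\<le>p. \<Sum>k\<le>p. \<Sum>l\<le>p.
      (poly (pderiv (?l i) * ?l k) (z $ 1) * poly (pderiv (?l l) * ?l j) (z $ 2)) * cross2 (?X i j) (?X k l))" for z
    by (simp add: det_xjac xdiff_def cross2_sum_left) (simp add: cross2_sum_right cross2_scaleR mult_ac)
  have "E (\<lambda>z. det (xjac p \<xi> T \<kappa> z))"
    unfolding det by (intro E_sum E_prod deg finite_atMost) simp_all
  then show ?thesis by (simp add: E_def Jdet_def)
qed

text \<open>The sign of the determinant away from the nodes is not known, so only an inequality is
  claimed: the integral of the determinant is at most that of its absolute value, which is the area
  by change of variables.\<close>

lemma element_area:
  assumes gl: "gauss_lobatto p \<xi> \<omega>" and p: "1 \<le> p"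
    and mp: "mesh_partition p \<xi> \<Omega> T" and \<kappa>: "\<kappa> \<in> elems T"
  shows "(\<Sum>i\<le>p. \<Sum>j\<le>p. \<omega> i * \<omega> j * Jdet p \<xi> T \<kappa> i j) \<le> measure lebesgue \<kappa>"
proof -
  let ?d = "\<lambda>z. det (xjac p \<xi> T \<kappa> z)"
  have sq: "interior ref_square = box (-1) (1 :: real^2)" by (simp add: ref_square_def interior_cbox)
  have cont: "continuous_on (cbox (-1) 1) (\<lambda>z. \<bar>?d z\<bar>)"
    unfolding det_xjac cross2_def by (intro continuous_intros continuous_on_xdiff)
  have int: "(\<lambda>z. \<bar>?d z\<bar>) integrable_on cbox (-1) 1" by (rule integrable_continuous[OF cont])
  have inj: "inj_on (xmap p \<xi> T \<kappa>) (box (-1) 1)"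
    using mp \<kappa> unfolding mesh_partition_def ref_square_def
    by (meson box_subset_cbox inj_on_subset)
  have mat: "matrix ((*v) (xjac p \<xi> T \<kappa> z)) = xjac p \<xi> T \<kappa> z" for z
    by (rule matrix_of_matrix_vector_mul)
  have "(\<Sum>i\<le>p. \<Sum>j\<le>p. \<omega> i * \<omega> j * Jdet p \<xi> T \<kappa> i j) = integral (cbox (-1) 1) ?d"
    by (rule integral_unique[OF det_xjac_has_integral[OF gl p], symmetric])
  also have "\<dots> \<le> integral (cbox (-1) 1) (\<lambda>z. \<bar>?d z\<bar>)"
    by (rule integral_le[OF has_integral_integrable[OF det_xjac_has_integral[OF gl p]] int]) simp
  also have "\<dots> = integral (box (-1) 1) (\<lambda>z. \<bar>det (matrix ((*v) (xjac p \<xi> T \<kappa> z)))\<bar>)"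
    by (simp add: mat integral_open_interval)
  also have "\<dots> = measure lebesgue (xmap p \<xi> T \<kappa> ` box (-1) 1)"
    by (rule measure_differentiable_image_eq[symmetric, OF _ has_derivative_at_withinI[OF xmap_has_derivative_xjac] inj])
       (use int in \<open>auto simp: mat integrable_on_open_interval\<close>)
  also have "xmap p \<xi> T \<kappa> ` box (-1) 1 = \<kappa>"
    using mp \<kappa> by (simp add: mesh_partition_def sq[symmetric])
  finally show ?thesis .
qed

section \<open>Element balances\<close>

text \<open>Exchanging the two indices reverses the sign; this is why the graph viscosities conserve
  mass.\<close>

lemma sum_sum_symmetric_diff:
  fixes a :: "nat \<Rightarrow> nat \<Rightarrow> real"
  assumes "\<And>i k. a i k = a k i"
  shows "(\<Sum>i\<in>A. \<Sum>k\<in>A. a i k * (w i - w k)) = 0"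
proof -
  have "(\<Sum>i\<in>A. \<Sum>k\<in>A. a i k * (w i - w k)) = (\<Sum>k\<in>A. \<Sum>i\<in>A. a i k * (w i - w k))"
    by (rule sum.swap)
  also have "\<dots> = (\<Sum>i\<in>A. \<Sum>k\<in>A. - (a i k * (w i - w k)))"
    by (intro sum.cong refl) (simp add: assms[of _ _] algebra_simps)
  finally show ?thesis by (simp add: sum_negf)
qed

text \<open>Only the symmetric part of \<open>Qmat\<close> acts on a symmetric \<open>S\<close>, and
  summation by parts reduces it to the two end points. Used in time for \<open>Uec\<close> and in
  both space directions for the cell flux.\<close>

lemma Qmat_symmetric_sum:
  assumes gl: "gauss_lobatto s \<xi> \<omega>" and s: "1 \<le> s" and S: "\<And>k l. S k l = S l k"
  shows "(\<Sum>k\<le>s. \<Sum>l\<le>s. 2 * (Qmat s \<xi> \<omega> k l * S k l)) = S s s - S 0 0"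
proof -
  let ?Q = "Qmat s \<xi> \<omega>"
  have "(\<Sum>k\<le>s. \<Sum>l\<le>s. ?Q k l * S k l) = (\<Sum>l\<le>s. \<Sum>k\<le>s. ?Q k l * S k l)" by (rule sum.swap)
  also have "\<dots> = (\<Sum>k\<le>s. \<Sum>l\<le>s. ?Q l k * S k l)" by (subst S) simp
  finally have "(\<Sum>k\<le>s. \<Sum>l\<le>s. 2 * (?Q k l * S k l)) =
      (\<Sum>k\<le>s. \<Sum>l\<le>s. ?Q k l * S k l) + (\<Sum>k\<le>s. \<Sum>l\<le>s. ?Q l k * S k l)"
    by (simp add: sum_distrib_left[symmetric])
  also have "\<dots> = (\<Sum>k\<le>s. \<Sum>l\<le>s. (?Q k l + ?Q l k) * S k l)"
    by (simp add: sum.distrib distrib_right)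
  also have "\<dots> = (\<Sum>k\<le>s. \<Sum>l\<le>s. if l = k then (if k = s then S s s else 0) - (if k = 0 then S 0 0 else 0) else 0)"
    by (intro sum.cong refl) (auto simp: Qmat_summation_by_parts[OF gl s])
  also have "\<dots> = S s s - S 0 0" by (simp add: sum_subtractf)
  finally show ?thesis .
qed

definition edge_side :: "nat \<Rightarrow> (nat \<Rightarrow> real) \<Rightarrow> mesh \<Rightarrow> (real^2) set \<Rightarrow> (real^2) set \<Rightarrow> side" where
  "edge_side p \<xi> T \<kappa> e = (THE sd. side_edge p \<xi> T \<kappa> sd = e)"

text \<open>The indices \<open>(i, j)\<close> of the node of \<open>\<kappa>\<close> that coincides with the edge node $\mathbf x_e^k$.\<close>

definition face_node ::
  "nat \<Rightarrow> (nat \<Rightarrow> real) \<Rightarrow> mesh \<Rightarrow> (real^2) set \<Rightarrow> (real^2) set \<Rightarrow> nat \<Rightarrow> nat \<times> nat" where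
  "face_node p \<xi> T \<kappa> e k =
     (let sd = edge_side p \<xi> T \<kappa> e in side_node p sd (edge_index p \<xi> T \<kappa> sd k))"

locale dgsem_geometry =
  fixes p :: nat and \<xi> \<omega> :: "nat \<Rightarrow> real" and \<Omega> :: "(real^2) set" and T :: mesh
  assumes p: "1 \<le> p" and gl: "gauss_lobatto p \<xi> \<omega>" and mesh: "dgsem_mesh p \<xi> \<Omega> T"
begin

abbreviation "nb \<equiv> neighbour p \<xi> T"
abbreviation "fn \<equiv> face_node p \<xi> T"
abbreviation "J \<equiv> Jdet p \<xi> T"
abbreviation "n1 \<equiv> nvol1 p \<xi> T"
abbreviation "n2 \<equiv> nvol2 p \<xi> T"
abbreviation "at_face W \<kappa> e k \<equiv> W \<kappa> (fst (fn \<kappa> e k)) (snd (fn \<kappa> e k))"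

lemma wt: "watertight p \<xi> T" and fm: "face_metrics p \<xi> T" and mr: "mesh_regular p \<xi> T"
  and mp: "mesh_partition p \<xi> \<Omega> T" and mi: "metric_identities p \<xi> T"
  using mesh by (simp_all add: dgsem_mesh_def)

lemma inj_xmap: "\<kappa> \<in> elems T \<Longrightarrow> inj_on (xmap p \<xi> T \<kappa>) ref_square"
  using mp by (simp add: mesh_partition_def)

lemma weight_pos: "k \<le> p \<Longrightarrow> 0 < \<omega> k"
  by (rule gauss_lobatto_weight_pos[OF gl])

lemma J_pos: "\<kappa> \<in> elems T \<Longrightarrow> i \<le> p \<Longrightarrow> j \<le> p \<Longrightarrow> 0 < J \<kappa> i j"
  using mp by (simp add: mesh_partition_def)

lemma finite_edges [simp]: "finite (edges p \<xi> T \<kappa>)"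
  by (simp add: edges_def)

lemma edge_side_eq: "\<kappa> \<in> elems T \<Longrightarrow> edge_side p \<xi> T \<kappa> (side_edge p \<xi> T \<kappa> sd) = sd"
  unfolding edge_side_def by (rule the_equality) (use injD[OF inj_side_edge[OF inj_xmap]] in auto)

lemma side_edge_edge_side:
  assumes "\<kappa> \<in> elems T" "e \<in> edges p \<xi> T \<kappa>"
  shows "side_edge p \<xi> T \<kappa> (edge_side p \<xi> T \<kappa> e) = e"
  using assms by (auto simp: edges_eq edge_side_eq)

lemma face_node_le:
  "k \<le> p \<Longrightarrow> fst (fn \<kappa> e k) \<le> p" "k \<le> p \<Longrightarrow> snd (fn \<kappa> e k) \<le> p"
  using side_node_le[OF edge_index_le] by (simp_all add: face_node_def Let_def)

lemma emap_face_node: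
  assumes "\<kappa> \<in> elems T" "e \<in> edges p \<xi> T \<kappa>" "k \<le> p"
  shows "emap T e (\<xi> k) = xmap p \<xi> T \<kappa> (vector [\<xi> (fst (fn \<kappa> e k)), \<xi> (snd (fn \<kappa> e k))])"
  using emap_node[OF gl p wt assms(1,3), of "edge_side p \<xi> T \<kappa> e"] side_edge_edge_side[OF assms(1,2)]
  by (simp add: face_node_def Let_def)

lemma basis_face:
  assumes "\<kappa> \<in> elems T" "e \<in> edges p \<xi> T \<kappa>" "k \<le> p" "i \<le> p" "j \<le> p"
  shows "basis p \<xi> T \<kappa> i j (emap T e (\<xi> k)) = (if (i, j) = fn \<kappa> e k then 1 else 0)"
  using assms basis_node[OF gl inj_xmap, of \<kappa> i j "fst (fn \<kappa> e k)" "snd (fn \<kappa> e k)"]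
  by (auto simp: emap_face_node face_node_le prod_eq_iff)

lemma trace_face:
  assumes "\<kappa> \<in> elems T" "e \<in> edges p \<xi> T \<kappa>" "k \<le> p"
  shows "trace_from p \<xi> T W \<kappa> (emap T e (\<xi> k)) = at_face W \<kappa> e k"
  using assms trace_from_node[OF gl inj_xmap] by (simp add: emap_face_node face_node_le)

lemma neighbour_unique:
  assumes "\<kappa> \<in> elems T" "e \<in> edges p \<xi> T \<kappa>"
  shows "\<exists>!\<kappa>'. \<kappa>' \<in> elems T \<and> \<kappa>' \<noteq> \<kappa> \<and> e \<in> edges p \<xi> T \<kappa>'"
  using wt assms unfolding watertight_def by blast

lemma neighbour:
  assumes "\<kappa> \<in> elems T" "e \<in> edges p \<xi> T \<kappa>"
  shows "nb \<kappa> e \<in> elems T" "nb \<kappa> e \<noteq> \<kappa>" "e \<in> edges p \<xi> T (nb \<kappa> e)"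
  using theI'[OF neighbour_unique[OF assms]] unfolding neighbour_def by blast+

lemma neighbour_neighbour:
  assumes "\<kappa> \<in> elems T" "e \<in> edges p \<xi> T \<kappa>"
  shows "nb (nb \<kappa> e) e = \<kappa>"
  unfolding neighbour_def[of p \<xi> T "nb \<kappa> e"]
  by (rule the1_equality[OF neighbour_unique]) (use neighbour[OF assms] assms in auto)

lemma enormal_unit:
  assumes "\<kappa> \<in> elems T" "e \<in> edges p \<xi> T \<kappa>" "k \<le> p"
  shows "enormal T \<kappa> e k \<in> sphere 0 1"
  using fm assms unfolding face_metrics_def edges_eq outward_unit_normal_def by auto

lemma enormal_neighbour:
  assumes "\<kappa> \<in> elems T" "e \<in> edges p \<xi> T \<kappa>" "k \<le> p"
  shows "enormal T (nb \<kappa> e) e k = - enormal T \<kappa> e k"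
  by (rule enormal_opposite[OF mesh gl assms(1) neighbour(1)[OF assms(1,2)] _ _ _ assms(3),
        where sd = "edge_side p \<xi> T \<kappa> e" and sd' = "edge_side p \<xi> T (nb \<kappa> e) e"])
     (use neighbour[OF assms(1,2)] assms side_edge_edge_side in auto)

lemma Jedge_pos: "\<kappa> \<in> elems T \<Longrightarrow> e \<in> edges p \<xi> T \<kappa> \<Longrightarrow> k \<le> p \<Longrightarrow> 0 < Jedge \<xi> T e k"
  using mr unfolding mesh_regular_def Let_def by blast

lemma R_op_eq:
  assumes \<kappa>: "\<kappa> \<in> elems T" and ij: "i \<le> p" "j \<le> p"
  shows "R_op p \<xi> \<omega> T f hec h W \<kappa> i j =
     2 * (\<omega> j * (\<Sum>k\<le>p. Qmat p \<xi> \<omega> i k * hec (W \<kappa> i j) (W \<kappa> k j) (n1 \<kappa> i k j))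
        + \<omega> i * (\<Sum>k\<le>p. Qmat p \<xi> \<omega> j k * hec (W \<kappa> i j) (W \<kappa> i k) (n2 \<kappa> i j k)))
     + (\<Sum>e\<in>edges p \<xi> T \<kappa>. \<Sum>k\<le>p. if (i, j) = fn \<kappa> e k then
          \<omega> k * Jedge \<xi> T e k * (h (at_face W \<kappa> e k) (at_face W (nb \<kappa> e) e k) (enormal T \<kappa> e k)
           - f (at_face W \<kappa> e k) \<bullet> enormal T \<kappa> e k) else 0)"
proof -
  have "basis p \<xi> T \<kappa> i j (emap T e (\<xi> k)) * \<omega> k * Jedge \<xi> T e k *
          (h (W \<kappa> i j) (trace_from p \<xi> T W (nb \<kappa> e) (emap T e (\<xi> k))) (enormal T \<kappa> e k)
           - f (W \<kappa> i j) \<bullet> enormal T \<kappa> e k) =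
        (if (i, j) = fn \<kappa> e k then
          \<omega> k * Jedge \<xi> T e k * (h (at_face W \<kappa> e k) (at_face W (nb \<kappa> e) e k) (enormal T \<kappa> e k)
           - f (at_face W \<kappa> e k) \<bullet> enormal T \<kappa> e k) else 0)"
    if "e \<in> edges p \<xi> T \<kappa>" "k \<in> {..p}" for e k
  proof -
    have k: "k \<le> p" using that by simp
    show ?thesis
      unfolding basis_face[OF \<kappa> that(1) k ij]
        trace_face[OF neighbour(1,3)[OF \<kappa> that(1)] k]
      by (cases "(i, j) = fn \<kappa> e k") (simp_all add: eq_fst_iff eq_snd_iff, metis fst_conv snd_conv)
  qed
  then show ?thesis unfolding R_op_def by (intro arg_cong2[where f = "(+)"] refl sum.cong)
qed

definition face_flux ::
  "(real \<Rightarrow> real \<Rightarrow> real^2 \<Rightarrow> real) \<Rightarrow> ((real^2) set \<Rightarrow> nat \<Rightarrow> nat \<Rightarrow> real) \<Rightarrow> (real^2) set \<Rightarrow> (real^2) set \<Rightarrow> real" where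
  "face_flux h W \<kappa> e =
     (\<Sum>k\<le>p. \<omega> k * Jedge \<xi> T e k * h (at_face W \<kappa> e k) (at_face W (nb \<kappa> e) e k) (enormal T \<kappa> e k))"

text \<open>Weights, edge nodes and \<open>Jedge\<close> are common to both elements; only the two
  states are exchanged and the normal is reversed, which a conservative flux turns into a change of
  sign.\<close>

lemma face_flux_neighbour:
  assumes "\<kappa> \<in> elems T" "e \<in> edges p \<xi> T \<kappa>"
    and h: "\<And>a b n. n \<in> sphere 0 1 \<Longrightarrow> h a b n = - h b a (- n)"
  shows "face_flux h W (nb \<kappa> e) e = - face_flux h W \<kappa> e"
proof -
  have "h (at_face W (nb \<kappa> e) e k) (at_face W (nb (nb \<kappa> e) e) e k) (enormal T (nb \<kappa> e) e k) =
      - h (at_face W \<kappa> e k) (at_face W (nb \<kappa> e) e k) (enormal T \<kappa> e k)" if "k \<le> p" for k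
    using h[OF enormal_unit[OF assms(1,2) that]] that
    by (simp add: neighbour_neighbour assms enormal_neighbour)
  then show ?thesis unfolding face_flux_def by (simp add: sum_negf)
qed

text \<open>Brings a sum over edges into the numbering of the element, where the face metrics
  identify the scaled normals with volume metric terms. Linearity of \<open>F\<close> allows
  \<open>Jedge\<close> to be absorbed into the normal.\<close>

lemma sum_face_nodes:
  fixes F :: "nat \<Rightarrow> nat \<Rightarrow> real^2 \<Rightarrow> real"
  assumes \<kappa>: "\<kappa> \<in> elems T" and lin: "\<And>i j. linear (F i j)"
  shows "(\<Sum>e\<in>edges p \<xi> T \<kappa>. \<Sum>k\<le>p. \<omega> k * Jedge \<xi> T e k *
       F (fst (fn \<kappa> e k)) (snd (fn \<kappa> e k)) (enormal T \<kappa> e k)) =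
     (\<Sum>j\<le>p. \<omega> j * (F p j (n1 \<kappa> p p j) - F 0 j (n1 \<kappa> 0 0 j))) +
     (\<Sum>i\<le>p. \<omega> i * (F i p (n2 \<kappa> i p p) - F i 0 (n2 \<kappa> i 0 0)))"
proof -
  define G where "G sd k = (let ij = side_node p sd k in F (fst ij) (snd ij)
     (case sd of West \<Rightarrow> - n1 \<kappa> 0 0 k | East \<Rightarrow> n1 \<kappa> p p k | South \<Rightarrow> - n2 \<kappa> k 0 0 | North \<Rightarrow> n2 \<kappa> k p p))"
    for sd k
  have side: "(\<Sum>k\<le>p. \<omega> k * Jedge \<xi> T e k * F (fst (fn \<kappa> e k)) (snd (fn \<kappa> e k)) (enormal T \<kappa> e k)) =
      (\<Sum>k\<le>p. \<omega> k * G sd k)" if e: "e = side_edge p \<xi> T \<kappa> sd" for e sd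
  proof -
    let ?c = "edge_index p \<xi> T \<kappa> sd"
    have "\<omega> k * Jedge \<xi> T e k * F (fst (fn \<kappa> e k)) (snd (fn \<kappa> e k)) (enormal T \<kappa> e k) = \<omega> (?c k) * G sd (?c k)"
      if k: "k \<le> p" for k
    proof -
      have fnk: "fn \<kappa> e k = side_node p sd (?c k)" by (simp add: face_node_def e edge_side_eq[OF \<kappa>])
      have c: "?c k \<le> p" by (rule edge_index_le[OF k])
      have "emap T e (\<xi> k) = node T \<kappa> (fst (fn \<kappa> e k)) (snd (fn \<kappa> e k))"
        using emap_face_node[OF \<kappa> _ k, of e] xmap_node[OF gauss_lobatto_inj_on[OF gl]] face_node_le[OF k]
        by (simp add: e edges_eq)
      then have "Jedge \<xi> T e k *\<^sub>R enormal T \<kappa> e k =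
          (case sd of West \<Rightarrow> - n1 \<kappa> 0 0 (?c k) | East \<Rightarrow> n1 \<kappa> p p (?c k)
            | South \<Rightarrow> - n2 \<kappa> (?c k) 0 0 | North \<Rightarrow> n2 \<kappa> (?c k) p p)"
        using fm \<kappa> k c unfolding face_metrics_def Let_def fnk by (cases sd) (auto simp: e)
      then have "G sd (?c k) = F (fst (fn \<kappa> e k)) (snd (fn \<kappa> e k)) (Jedge \<xi> T e k *\<^sub>R enormal T \<kappa> e k)"
        by (simp add: G_def fnk Let_def)
      then show ?thesis
        by (simp add: linear_cmul[OF lin] edge_index_node_weight[OF gl p k])
    qed
    then have "(\<Sum>k\<le>p. \<omega> k * Jedge \<xi> T e k * F (fst (fn \<kappa> e k)) (snd (fn \<kappa> e k)) (enormal T \<kappa> e k)) =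
        (\<Sum>k\<le>p. \<omega> (?c k) * G sd (?c k))" by simp
    \<comment> \<open>The renumbering is an involution: the identity, or a reversal if the edge runs
      against the side.\<close>
    also have "\<dots> = (\<Sum>k\<le>p. \<omega> k * G sd k)"
      by (rule sum.reindex_bij_witness[of _ ?c ?c]) (simp_all add: edge_index_involution edge_index_le)
    finally show ?thesis .
  qed
  have "(\<Sum>e\<in>edges p \<xi> T \<kappa>. \<Sum>k\<le>p. \<omega> k * Jedge \<xi> T e k *
       F (fst (fn \<kappa> e k)) (snd (fn \<kappa> e k)) (enormal T \<kappa> e k)) = (\<Sum>sd\<in>UNIV. \<Sum>k\<le>p. \<omega> k * G sd k)"
    unfolding edges_eq sum.reindex[OF inj_side_edge[OF inj_xmap[OF \<kappa>]]] o_def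
    by (rule sum.cong[OF refl]) (rule side[OF refl])
  then show ?thesis
    by (simp add: UNIV_side G_def linear_neg[OF lin] right_diff_distrib sum_subtractf sum_negf)
qed

text \<open>Summation by parts reduces the volume terms to physical fluxes at the four sides. These
  are exactly what the face terms subtract, so only the interface flux survives.\<close>

lemma sum_R_op:
  assumes \<kappa>: "\<kappa> \<in> elems T"
    and sym: "\<And>a b n. hec a b n = hec b a n" and refl: "\<And>u n. hec u u n = f u \<bullet> n"
  shows "(\<Sum>i\<le>p. \<Sum>j\<le>p. R_op p \<xi> \<omega> T f hec h W \<kappa> i j) = (\<Sum>e\<in>edges p \<xi> T \<kappa>. face_flux h W \<kappa> e)"
proof -
  let ?Q = "Qmat p \<xi> \<omega>" and ?W = "W \<kappa>"
  let ?H = "\<lambda>e k. \<omega> k * Jedge \<xi> T e k * (h (at_face W \<kappa> e k) (at_face W (nb \<kappa> e) e k) (enormal T \<kappa> e k)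
           - f (at_face W \<kappa> e k) \<bullet> enormal T \<kappa> e k)"
  have vol1: "(\<Sum>i\<le>p. \<Sum>k\<le>p. 2 * (?Q i k * hec (?W i j) (?W k j) (n1 \<kappa> i k j))) =
      f (?W p j) \<bullet> n1 \<kappa> p p j - f (?W 0 j) \<bullet> n1 \<kappa> 0 0 j" for j
  proof -
    \<comment> \<open>The averaged metric terms are symmetric in the pair of nodes, as is the
      two-point flux, so their combination is a symmetric matrix.\<close>
    have S: "hec (?W i j) (?W k j) (n1 \<kappa> i k j) = hec (?W k j) (?W i j) (n1 \<kappa> k i j)" for i k
      by (subst nvol1_commute) (rule sym)
    show ?thesis using Qmat_symmetric_sum[OF gl p S] by (simp only: refl)
  qed
  have vol2: "(\<Sum>j\<le>p. \<Sum>k\<le>p. 2 * (?Q j k * hec (?W i j) (?W i k) (n2 \<kappa> i j k))) =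
      f (?W i p) \<bullet> n2 \<kappa> i p p - f (?W i 0) \<bullet> n2 \<kappa> i 0 0" for i
  proof -
    have S: "hec (?W i j) (?W i k) (n2 \<kappa> i j k) = hec (?W i k) (?W i j) (n2 \<kappa> i k j)" for j k
      by (subst nvol2_commute) (rule sym)
    show ?thesis using Qmat_symmetric_sum[OF gl p S] by (simp only: refl)
  qed
  have face: "(\<Sum>i\<le>p. \<Sum>j\<le>p. \<Sum>e\<in>edges p \<xi> T \<kappa>. \<Sum>k\<le>p. if (i, j) = fn \<kappa> e k then ?H e k else 0) =
      (\<Sum>e\<in>edges p \<xi> T \<kappa>. \<Sum>k\<le>p. ?H e k)"
  proof -
    have one: "(\<Sum>ij\<in>{..p} \<times> {..p}. if ij = fn \<kappa> e k then ?H e k else 0) = ?H e k" if "k \<le> p" for e k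
      using face_node_le[OF that, of \<kappa> e] by (simp add: mem_Times_iff)
    have cart: "(\<Sum>i\<le>p. \<Sum>j\<le>p. G (i, j)) = (\<Sum>ij\<in>{..p} \<times> {..p}. G ij)" for G :: "nat \<times> nat \<Rightarrow> real"
      by (simp add: sum.cartesian_product)
    have "(\<Sum>i\<le>p. \<Sum>j\<le>p. \<Sum>e\<in>edges p \<xi> T \<kappa>. \<Sum>k\<le>p. if (i, j) = fn \<kappa> e k then ?H e k else 0) =
      (\<Sum>ij\<in>{..p} \<times> {..p}. \<Sum>e\<in>edges p \<xi> T \<kappa>. \<Sum>k\<le>p. if ij = fn \<kappa> e k then ?H e k else 0)"
      by (rule cart)
    also have "\<dots> = (\<Sum>e\<in>edges p \<xi> T \<kappa>. \<Sum>k\<le>p. \<Sum>ij\<in>{..p} \<times> {..p}. if ij = fn \<kappa> e k then ?H e k else 0)"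
      by (subst sum.swap, rule sum.cong[OF HOL.refl], rule sum.swap)
    also have "\<dots> = (\<Sum>e\<in>edges p \<xi> T \<kappa>. \<Sum>k\<le>p. ?H e k)"
      by (intro sum.cong HOL.refl one) simp
    finally show ?thesis .
  qed
  have bdry: "(\<Sum>e\<in>edges p \<xi> T \<kappa>. \<Sum>k\<le>p. \<omega> k * Jedge \<xi> T e k * (f (at_face W \<kappa> e k) \<bullet> enormal T \<kappa> e k)) =
     (\<Sum>j\<le>p. \<omega> j * (f (?W p j) \<bullet> n1 \<kappa> p p j - f (?W 0 j) \<bullet> n1 \<kappa> 0 0 j)) +
     (\<Sum>i\<le>p. \<omega> i * (f (?W i p) \<bullet> n2 \<kappa> i p p - f (?W i 0) \<bullet> n2 \<kappa> i 0 0))"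
    by (rule sum_face_nodes[OF \<kappa>, of "\<lambda>i j n. f (?W i j) \<bullet> n"])
       (intro bounded_linear.linear bounded_linear_inner_right)
  have "(\<Sum>i\<le>p. \<Sum>j\<le>p. R_op p \<xi> \<omega> T f hec h W \<kappa> i j) =
     (\<Sum>i\<le>p. \<Sum>j\<le>p. \<omega> j * (\<Sum>k\<le>p. 2 * (?Q i k * hec (?W i j) (?W k j) (n1 \<kappa> i k j)))) +
     (\<Sum>i\<le>p. \<Sum>j\<le>p. \<omega> i * (\<Sum>k\<le>p. 2 * (?Q j k * hec (?W i j) (?W i k) (n2 \<kappa> i j k)))) +
     (\<Sum>e\<in>edges p \<xi> T \<kappa>. \<Sum>k\<le>p. ?H e k)"
    unfolding face[symmetric] sum.distrib[symmetric]
    by (intro sum.cong HOL.refl)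
       (simp add: R_op_eq[OF \<kappa>] sum_distrib_left mult_ac)
  also have "(\<Sum>i\<le>p. \<Sum>j\<le>p. \<omega> j * (\<Sum>k\<le>p. 2 * (?Q i k * hec (?W i j) (?W k j) (n1 \<kappa> i k j)))) =
     (\<Sum>j\<le>p. \<omega> j * (f (?W p j) \<bullet> n1 \<kappa> p p j - f (?W 0 j) \<bullet> n1 \<kappa> 0 0 j))"
    unfolding vol1[symmetric] sum_distrib_left[of "\<omega> _" _ "{..p}"] by (rule sum.swap)
  also have "(\<Sum>i\<le>p. \<Sum>j\<le>p. \<omega> i * (\<Sum>k\<le>p. 2 * (?Q j k * hec (?W i j) (?W i k) (n2 \<kappa> i j k)))) =
     (\<Sum>i\<le>p. \<omega> i * (f (?W i p) \<bullet> n2 \<kappa> i p p - f (?W i 0) \<bullet> n2 \<kappa> i 0 0))"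
    unfolding vol2[symmetric] sum_distrib_left[of "\<omega> _" _ "{..p}"] ..
  finally show ?thesis
    using bdry by (simp add: face_flux_def right_diff_distrib sum_subtractf)
qed

lemma sum_V_op:
  "(\<Sum>i\<le>p. \<Sum>j\<le>p. V_op p \<xi> \<omega> T dk W \<kappa> i j) = 0"
proof -
  let ?a = "\<lambda>i k j. \<omega> i * \<omega> k * norm (n1 \<kappa> i k j)" and ?b = "\<lambda>i j k. \<omega> j * \<omega> k * norm (n2 \<kappa> i j k)"
  have a: "(\<Sum>i\<le>p. \<Sum>k\<le>p. ?a i k j * (W \<kappa> i j - W \<kappa> k j)) = 0" for j
    by (rule sum_sum_symmetric_diff) (subst nvol1_commute, simp add: mult.commute)
  have b: "(\<Sum>j\<le>p. \<Sum>k\<le>p. ?b i j k * (W \<kappa> i j - W \<kappa> i k)) = 0" for i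
    by (rule sum_sum_symmetric_diff) (subst nvol2_commute, simp add: mult.commute)
  have "(\<Sum>i\<le>p. \<Sum>j\<le>p. V_op p \<xi> \<omega> T dk W \<kappa> i j) =
     (\<Sum>i\<le>p. \<Sum>j\<le>p. dk \<kappa> / 2 * \<omega> j * (\<Sum>k\<le>p. ?a i k j * (W \<kappa> i j - W \<kappa> k j))) +
     (\<Sum>i\<le>p. \<Sum>j\<le>p. dk \<kappa> / 2 * \<omega> i * (\<Sum>k\<le>p. ?b i j k * (W \<kappa> i j - W \<kappa> i k)))"
    unfolding sum.distrib[symmetric]
    by (intro sum.cong HOL.refl) (simp add: V_op_def sum.distrib sum_distrib_left distrib_left mult_ac)
  also have "(\<Sum>i\<le>p. \<Sum>j\<le>p. dk \<kappa> / 2 * \<omega> j * (\<Sum>k\<le>p. ?a i k j * (W \<kappa> i j - W \<kappa> k j))) =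
      (\<Sum>j\<le>p. dk \<kappa> / 2 * \<omega> j * (\<Sum>i\<le>p. \<Sum>k\<le>p. ?a i k j * (W \<kappa> i j - W \<kappa> k j)))"
    by (subst sum.swap) (simp add: sum_distrib_left)
  also have "(\<Sum>i\<le>p. \<Sum>j\<le>p. dk \<kappa> / 2 * \<omega> i * (\<Sum>k\<le>p. ?b i j k * (W \<kappa> i j - W \<kappa> i k))) =
      (\<Sum>i\<le>p. dk \<kappa> / 2 * \<omega> i * (\<Sum>j\<le>p. \<Sum>k\<le>p. ?b i j k * (W \<kappa> i j - W \<kappa> i k)))"
    by (simp add: sum_distrib_left)
  finally show ?thesis unfolding a b by simp
qed

end

section \<open>Order-theoretic existence and growth\<close>

text \<open>The hypothesis makes \<open>U - F U / C\<close> monotone, so that the supremum of the subsolutions is the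
  greatest solution.\<close>

lemma greatest_box_solution:
  fixes F :: "('a \<Rightarrow> real) \<Rightarrow> 'a \<Rightarrow> real" and m M :: real
  assumes mM: "m \<le> M"
    and quasi: "\<And>U W a. a \<in> A \<Longrightarrow> (\<And>b. b \<in> A \<Longrightarrow> m \<le> U b \<and> U b \<le> W b \<and> W b \<le> M) \<Longrightarrow>
       F W a - F U a \<le> C a * (W a - U a)"
    and C: "\<And>a. a \<in> A \<Longrightarrow> 0 < C a"
    and low: "\<And>a. a \<in> A \<Longrightarrow> F (\<lambda>_. m) a \<le> 0"
    and high: "\<And>a. a \<in> A \<Longrightarrow> 0 \<le> F (\<lambda>_. M) a"
  obtains G where "G \<in> extensional A" "\<And>a. a \<in> A \<Longrightarrow> m \<le> G a \<and> G a \<le> M \<and> F G a = 0"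
    "\<And>U a. (\<And>b. b \<in> A \<Longrightarrow> m \<le> U b \<and> U b \<le> M \<and> F U b \<le> 0) \<Longrightarrow> a \<in> A \<Longrightarrow> U a \<le> G a"
proof -
  define S where "S = {U. \<forall>b\<in>A. m \<le> U b \<and> U b \<le> M \<and> F U b \<le> 0}"
  define G where "G = restrict (\<lambda>a. SUP U\<in>S. U a) A"
  define \<Phi> where "\<Phi> U a = U a - F U a / C a" for U a
  have S0: "(\<lambda>_. m) \<in> S" using low mM by (simp add: S_def)
  have bdd: "bdd_above ((\<lambda>U. U a) ` S)" if "a \<in> A" for a
    using that by (intro bdd_aboveI[of _ M]) (auto simp: S_def)
  have upper: "U a \<le> G a" if "U \<in> S" "a \<in> A" for U a
    using that by (auto simp: G_def intro!: cSUP_upper bdd)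
  have GM: "G a \<le> M" if "a \<in> A" for a
    using that S0 by (auto simp: G_def S_def intro!: cSUP_least)
  have Gm: "m \<le> G a" if "a \<in> A" for a using upper[OF S0 that] .
  have mono: "\<Phi> U a \<le> \<Phi> W a"
    if "a \<in> A" "\<And>b. b \<in> A \<Longrightarrow> m \<le> U b \<and> U b \<le> W b \<and> W b \<le> M" for U W a
  proof -
    have "(F W a - F U a) / C a \<le> W a - U a"
      using quasi[OF that(1), of U W] that(2) C[OF that(1)] by (simp add: field_simps)
    then show ?thesis by (simp add: \<Phi>_def diff_divide_distrib)
  qed
  have le: "F U a \<le> 0 \<longleftrightarrow> U a \<le> \<Phi> U a" if "a \<in> A" for U a
    using C[OF that] by (auto simp: \<Phi>_def divide_le_0_iff)
  have G\<Phi>: "G a \<le> \<Phi> G a" if a: "a \<in> A" for a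
  proof -
    have "U a \<le> \<Phi> G a" if U: "U \<in> S" for U
    proof -
      have "U a \<le> \<Phi> U a" using U a le[OF a, of U] by (auto simp: S_def)
      also have "\<dots> \<le> \<Phi> G a" by (rule mono[OF a]) (use U upper GM in \<open>auto simp: S_def\<close>)
      finally show ?thesis .
    qed
    then show ?thesis using a S0 by (auto simp: G_def intro!: cSUP_least)
  qed
  have \<Phi>M: "\<Phi> G a \<le> M" if a: "a \<in> A" for a
  proof -
    have "\<Phi> G a \<le> \<Phi> (\<lambda>_. M) a" by (rule mono[OF a]) (use Gm GM in auto)
    also have "\<dots> \<le> M" using high[OF a] C[OF a] by (simp add: \<Phi>_def)
    finally show ?thesis .
  qed
  \<comment> \<open>As in the Knaster-Tarski theorem: the image of the supremum is again a
    subsolution, hence not above the supremum, and equality follows.\<close>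
  have "\<Phi> G \<in> S"
    unfolding S_def
  proof (intro CollectI ballI conjI)
    fix a assume a: "a \<in> A"
    show "m \<le> \<Phi> G a" using Gm[OF a] G\<Phi>[OF a] by simp
    show "\<Phi> G a \<le> M" by (rule \<Phi>M[OF a])
    have "\<Phi> G a \<le> \<Phi> (\<Phi> G) a" by (rule mono[OF a]) (use Gm G\<Phi> \<Phi>M in auto)
    then show "F (\<Phi> G) a \<le> 0" by (simp add: le[OF a])
  qed
  then have "\<Phi> G a \<le> G a" if "a \<in> A" for a using upper that by blast
  then have zero: "F G a = 0" if "a \<in> A" for a
    using G\<Phi>[OF that] C[OF that] that by (force simp: \<Phi>_def)
  show thesis
  proof (rule that[of G])
    show "G \<in> extensional A" by (simp add: G_def)
  qed (use Gm GM zero upper in \<open>auto simp: S_def\<close>)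
qed

lemma quadratic_growth_imp_zero:
  fixes S :: "nat \<Rightarrow> real"
  assumes nonneg: "\<And>N. 0 \<le> S N" and C: "0 < C"
    and step: "\<And>N. S (Suc N) \<le> C * (S (Suc (Suc N)) - S N)" and mono: "\<And>N. S N \<le> S (Suc N)"
    and growth: "\<And>N. S N \<le> K * (real N)\<^sup>2"
  shows "S N = 0"
proof (rule ccontr)
  assume "S N \<noteq> 0"
  then have pos: "0 < S N" using nonneg[of N] by simp
  define r where "r = 1 / C"
  have r: "0 < r" using C by (simp add: r_def)
  have two: "(1 + r) * S N \<le> S (Suc (Suc N))" for N
  proof -
    have "r * S N \<le> r * S (Suc N)" using mono[of N] r by simp
    also have "\<dots> \<le> r * (C * (S (Suc (Suc N)) - S N))" using step[of N] r by (intro mult_left_mono) auto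
    also have "\<dots> = S (Suc (Suc N)) - S N" using C by (simp add: r_def)
    finally show ?thesis by (simp add: algebra_simps)
  qed
  have pow: "(1 + r) ^ k * S N \<le> S (N + 2 * k)" for k
  proof (induction k)
    case (Suc k)
    have "(1 + r) ^ Suc k * S N \<le> (1 + r) * S (N + 2 * k)"
      using Suc r by (simp add: mult.assoc)
    also have "\<dots> \<le> S (N + 2 * Suc k)" using two[of "N + 2 * k"] by simp
    finally show ?case .
  qed simp
  have K: "0 \<le> K"
  proof -
    have "0 \<le> K * (real 1)\<^sup>2" using nonneg[of 1] growth[of 1] by linarith
    then show ?thesis by simp
  qed
  \<comment> \<open>Three blocks of \<open>j\<close> double steps, with Bernoulli's inequality in
    each, give a lower bound cubic in \<open>j\<close> against the quadratic growth; division by the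
    square of \<open>j\<close> leaves a linear bound, which large \<open>j\<close> violates.\<close>
  have bound: "real j * (r ^ 3 * S N) \<le> K * (real N + 6)\<^sup>2" if j: "1 \<le> j" for j :: nat
  proof -
    have "real j * r \<le> (1 + r) ^ j" using Bernoulli_inequality[of r j] r by simp
    then have "(real j * r) ^ 3 \<le> ((1 + r) ^ j) ^ 3" using r by (intro power_mono) auto
    then have "(real j * r) ^ 3 * S N \<le> (1 + r) ^ (3 * j) * S N"
      using pos by (simp add: power_mult[symmetric] mult.commute)
    also have "\<dots> \<le> K * (real (N + 2 * (3 * j)))\<^sup>2" using pow[of "3 * j"] growth[of "N + 2 * (3 * j)"] by linarith
    also have "\<dots> \<le> K * (real j * (real N + 6))\<^sup>2"
    proof (intro mult_left_mono power_mono K)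
      have "1 * real N \<le> real j * real N" using j by (intro mult_right_mono) auto
      then show "real (N + 2 * (3 * j)) \<le> real j * (real N + 6)" by (simp add: distrib_left)
    qed simp
    finally have "(real j)\<^sup>2 * (real j * (r ^ 3 * S N)) \<le> (real j)\<^sup>2 * (K * (real N + 6)\<^sup>2)"
      by (simp add: power_mult_distrib power2_eq_square power3_eq_cube mult_ac)
    then show ?thesis using j by simp
  qed
  have "0 < r ^ 3 * S N" using r pos by simp
  then obtain j :: nat where j: "K * (real N + 6)\<^sup>2 < real j * (r ^ 3 * S N)"
    using reals_Archimedean3 by blast
  have "1 \<le> j"
  proof (rule ccontr)
    assume "\<not> 1 \<le> j"
    then have "j = 0" by simp
    then have "K * (real N + 6)\<^sup>2 < 0" using j by simp
    then show False using K by (simp add: mult_less_0_iff)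
  qed
  then show False using bound[of j] j by simp
qed

context dgsem_geometry
begin

section \<open>Layers of elements\<close>

text \<open>Mesh regularity and the finitely many quadrature weights are condensed into constants
  that hold uniformly over a possibly infinite mesh.\<close>

lemma mesh_constants:
  obtains H c0 c1 c2 where "0 < H" "\<And>\<kappa>. \<kappa> \<in> elems T \<Longrightarrow> diameter \<kappa> \<le> H" "0 < c0"
    "\<And>\<kappa> i j. \<kappa> \<in> elems T \<Longrightarrow> i \<le> p \<Longrightarrow> j \<le> p \<Longrightarrow> c0 \<le> \<omega> i * \<omega> j * J \<kappa> i j \<and> \<omega> i * \<omega> j * J \<kappa> i j \<le> c1"
    "\<And>\<kappa> e k. \<kappa> \<in> elems T \<Longrightarrow> e \<in> edges p \<xi> T \<kappa> \<Longrightarrow> k \<le> p \<Longrightarrow> \<omega> k * Jedge \<xi> T e k \<le> c2"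
proof (cases "elems T = {}")
  case True
  \<comment> \<open>The supremum of the diameters is unspecified for an empty mesh, so the constants
    are chosen freely.\<close>
  then show thesis by (intro that[of 1 1 0 0]) auto
next
  case False
  define H where "H = (SUP \<kappa>\<in>elems T. diameter \<kappa>)"
  have bdd: "bdd_above (diameter ` elems T)" using mr by (simp add: mesh_regular_def)
  have "\<exists>b>0. \<forall>\<kappa>\<in>elems T. \<forall>i\<le>p. \<forall>j\<le>p. \<forall>k\<le>p.
        b / 4 * H\<^sup>2 \<le> J \<kappa> i j \<and>
        (\<forall>e\<in>edges p \<xi> T \<kappa>. 0 < Jedge \<xi> T e k \<and> Jedge \<xi> T e k \<le> H / (8 * b)) \<and>
        0 < norm (n1 \<kappa> i k j) \<and> norm (n1 \<kappa> i k j) \<le> H / (8 * b) \<and>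
        0 < norm (n2 \<kappa> i j k) \<and> norm (n2 \<kappa> i j k) \<le> H / (8 * b)" (is "\<exists>b>0. ?reg b")
    using mr unfolding mesh_regular_def Let_def H_def[symmetric] by (rule conjunct2)
  then obtain b where b: "0 < b" and reg: "?reg b" by (elim exE conjE)
  note reg = reg[rule_format]
  obtain \<kappa>0 where \<kappa>0: "\<kappa>0 \<in> elems T" using False by blast
  \<comment> \<open>The metric terms have positive norm, which forces a positive mesh size.\<close>
  have "0 < H / (8 * b)" using reg[OF \<kappa>0, of 0 0 0] by linarith
  then have H: "0 < H" using b by (simp add: zero_less_divide_iff)
  define wl where "wl = Min (\<omega> ` {..p})"
  define wu where "wu = Max (\<omega> ` {..p})"
  have wl: "0 < wl" unfolding wl_def by (subst Min_gr_iff) (auto simp: weight_pos)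
  have w: "wl \<le> \<omega> k" "\<omega> k \<le> wu" if "k \<le> p" for k using that by (auto simp: wl_def wu_def)
  have wu: "0 < wu" using w[of 0] wl by linarith
  show thesis
  proof (rule that[of H "wl * wl * (b / 4 * H\<^sup>2)" "wu * wu * (H / (8 * b) * (H / (8 * b)))" "wu * (H / (8 * b))"])
    show "0 < H" by (rule H)
    show "diameter \<kappa> \<le> H" if "\<kappa> \<in> elems T" for \<kappa> unfolding H_def by (rule cSUP_upper[OF that bdd])
    show "0 < wl * wl * (b / 4 * H\<^sup>2)" using wl b H by simp
    show "wl * wl * (b / 4 * H\<^sup>2) \<le> \<omega> i * \<omega> j * J \<kappa> i j \<and>
        \<omega> i * \<omega> j * J \<kappa> i j \<le> wu * wu * (H / (8 * b) * (H / (8 * b)))"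
      if \<kappa>: "\<kappa> \<in> elems T" and ij: "i \<le> p" "j \<le> p" for \<kappa> i j
    proof
      show "wl * wl * (b / 4 * H\<^sup>2) \<le> \<omega> i * \<omega> j * J \<kappa> i j"
        using reg[OF \<kappa> ij, of 0] w[OF ij(1)] w[OF ij(2)] wl b H weight_pos[OF ij(1)] weight_pos[OF ij(2)]
        by (intro mult_mono) auto
      have "J \<kappa> i j \<le> norm (n1 \<kappa> i i j) * norm (n2 \<kappa> i j j)"
        by (rule Jdet_le_norm_nvol[OF J_pos[OF \<kappa> ij]])
      also have "\<dots> \<le> H / (8 * b) * (H / (8 * b))"
        using reg[OF \<kappa> ij ij(1)] reg[OF \<kappa> ij ij(2)] b H by (intro mult_mono) auto
      finally show "\<omega> i * \<omega> j * J \<kappa> i j \<le> wu * wu * (H / (8 * b) * (H / (8 * b)))"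
        using w[OF ij(1)] w[OF ij(2)] wl wu J_pos[OF \<kappa> ij] weight_pos[OF ij(1)] weight_pos[OF ij(2)]
        by (intro mult_mono) auto
    qed
    show "\<omega> k * Jedge \<xi> T e k \<le> wu * (H / (8 * b))"
      if "\<kappa> \<in> elems T" "e \<in> edges p \<xi> T \<kappa>" "k \<le> p" for \<kappa> e k
      using reg[OF that(1) that(3) that(3) that(3)] that w[OF that(3)] wu by (intro mult_mono) auto
  qed
qed

lemma element_eq:
  assumes "\<kappa> \<in> elems T"
  shows "xmap p \<xi> T \<kappa> ` interior ref_square = \<kappa>"
proof -
  have "\<kappa> = xmap p \<xi> T \<kappa> ` interior ref_square"
    using mp assms unfolding mesh_partition_def by blast
  then show ?thesis by (rule sym)
qed

lemma open_element:
  assumes "\<kappa> \<in> elems T"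
  shows "open \<kappa>"
proof -
  have "\<forall>\<kappa>\<in>elems T. open \<kappa> \<and> \<kappa> \<noteq> {}" using mp unfolding mesh_partition_def by (elim conjE)
  then show ?thesis using assms by blast
qed

lemma disjnt_elements: "pairwise disjnt (elems T)"
  using mp unfolding mesh_partition_def by (elim conjE)

text \<open>A bound on \<open>diameter\<close> does not yield boundedness, since the supremum is
  unspecified for an unbounded set; the compact reference square supplies it.\<close>

lemma bounded_element: "\<kappa> \<in> elems T \<Longrightarrow> bounded \<kappa>"
proof -
  assume \<kappa>: "\<kappa> \<in> elems T"
  have "continuous_on ref_square (xmap p \<xi> T \<kappa>)"
    by (rule has_derivative_continuous_on) (rule has_derivative_at_withinI[OF xmap_has_derivative])
  then have "bounded (xmap p \<xi> T \<kappa> ` ref_square)"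
    by (intro compact_imp_bounded compact_continuous_image) (simp_all add: ref_square_def)
  moreover have "\<kappa> \<subseteq> xmap p \<xi> T \<kappa> ` ref_square"
    by (subst element_eq[OF \<kappa>, symmetric]) (intro image_mono interior_subset)
  ultimately show ?thesis by (rule bounded_subset)
qed

lemma edge_subset_closure:
  assumes \<kappa>: "\<kappa> \<in> elems T" and e: "e \<in> edges p \<xi> T \<kappa>"
  shows "e \<subseteq> closure \<kappa>"
proof -
  have "(0 :: real^2) \<in> interior ref_square" by (simp add: interior_ref_square_iff)
  then have "closure (interior ref_square) = closure ref_square"
    by (intro convex_closure_interior) (auto simp: ref_square_def)
  then have cl: "closure (interior ref_square) = ref_square" by (simp add: ref_square_def)
  have cont: "continuous_on (closure (interior ref_square)) (xmap p \<xi> T \<kappa>)"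
    by (rule has_derivative_continuous_on) (rule has_derivative_at_withinI[OF xmap_has_derivative])
  have "xmap p \<xi> T \<kappa> ` closure (interior ref_square) \<subseteq> closure (xmap p \<xi> T \<kappa> ` interior ref_square)"
    by (rule image_closure_subset[OF cont]) (auto simp: closure_subset)
  moreover note element_eq[OF \<kappa>]
  moreover have "e \<subseteq> xmap p \<xi> T \<kappa> ` ref_square"
    using e side_point_ref_square by (auto simp: edges_eq side_edge_def abs_le_iff)
  ultimately show ?thesis by (simp add: cl)
qed

text \<open>The closures of both elements contain the common edge, so the neighbour extends at most
  its diameter further from the origin.\<close>

lemma neighbour_in_cball:
  assumes \<kappa>: "\<kappa> \<in> elems T" and e: "e \<in> edges p \<xi> T \<kappa>" and sub: "\<kappa> \<subseteq> cball 0 R"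
    and H: "diameter (nb \<kappa> e) \<le> H"
  shows "nb \<kappa> e \<subseteq> cball 0 (R + H)"
proof
  fix y assume y: "y \<in> nb \<kappa> e"
  note n = neighbour[OF \<kappa> e]
  have "e \<noteq> {}" using e by (auto simp: edges_eq side_edge_def)
  then obtain x where x: "x \<in> e" by blast
  have "x \<in> closure \<kappa>" using edge_subset_closure[OF \<kappa> e] x by blast
  then have xR: "norm x \<le> R" using closure_minimal[OF sub closed_cball] by auto
  have "x \<in> closure (nb \<kappa> e)" "y \<in> closure (nb \<kappa> e)"
    using edge_subset_closure[OF n(1,3)] x y closure_subset by blast+
  then have "dist x y \<le> diameter (closure (nb \<kappa> e))"
    by (intro diameter_bounded_bound bounded_closure bounded_element n(1))
  then have "dist x y \<le> H" using H bounded_element[OF n(1)] by (simp add: diameter_closure)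
  then have "norm y \<le> R + H" using xR norm_triangle_ineq[of x "y - x"] by (simp add: dist_norm norm_minus_commute)
  then show "y \<in> cball 0 (R + H)" by simp
qed

text \<open>Disjoint elements of area at least \<open>c\<close> are packed into the square of side
  \<open>2 * R\<close> around the ball. The bound holds uniformly for finite subsets of
  \<open>B\<close>, which makes \<open>B\<close> itself finite.\<close>

lemma element_count:
  assumes R: "0 \<le> R" and c: "0 < c" "\<And>\<kappa>. \<kappa> \<in> elems T \<Longrightarrow> c \<le> measure lebesgue \<kappa>"
  defines "B \<equiv> {\<kappa>\<in>elems T. \<kappa> \<subseteq> cball 0 R}"
  shows "finite B" "c * real (card B) \<le> 4 * R\<^sup>2"
proof -
  have bound: "c * real (card A) \<le> 4 * R\<^sup>2" if A: "finite A" "A \<subseteq> B" for A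
  proof -
    have meas: "\<kappa> \<in> lmeasurable" if "\<kappa> \<in> A" for \<kappa>
    proof -
      have \<kappa>: "\<kappa> \<in> elems T" using that A by (auto simp: B_def)
      have "open \<kappa>" by (rule open_element[OF \<kappa>])
      then show ?thesis using bounded_element[OF \<kappa>] by (intro lmeasurable_open)
    qed
    have disj: "pairwise disjnt A"
      by (rule pairwise_subset[OF disjnt_elements]) (use A in \<open>auto simp: B_def\<close>)
    have "c * real (card A) = (\<Sum>\<kappa>\<in>A. c)" by simp
    also have "\<dots> \<le> (\<Sum>\<kappa>\<in>A. measure lebesgue \<kappa>)"
      by (rule sum_mono) (use c A in \<open>auto simp: B_def\<close>)
    also have "\<dots> = measure lebesgue (\<Union>A)"
      using measure_Union'[OF A(1) meas disj] by simp
    also have "\<dots> \<le> measure lebesgue (cbox (- (\<chi> i. R)) (\<chi> i. R) :: (real^2) set)"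
    proof (rule measure_mono_fmeasurable)
      show "\<Union>A \<subseteq> cbox (- (\<chi> i. R)) (\<chi> i. R)"
      proof
        fix x :: "real^2" assume "x \<in> \<Union>A"
        then have "x \<in> cball 0 R" using A unfolding B_def by blast
        then have "norm x \<le> R" by simp
        then have "\<bar>x $ i\<bar> \<le> R" for i using component_le_norm_cart[of x i] by linarith
        then show "x \<in> cbox (- (\<chi> i. R)) (\<chi> i. R)" by (auto simp: mem_box_cart abs_le_iff minus_le_iff)
      qed
      show "\<Union>A \<in> sets lebesgue" using meas A(1) by (auto intro!: sets.finite_Union simp: fmeasurable_def)
    qed auto
    also have "\<dots> = 4 * R\<^sup>2"
      using R by (simp add: content_cbox_if_cart interval_eq_empty_cart UNIV_2 power2_eq_square)
    finally show ?thesis .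
  qed
  have "finite B \<and> card B \<le> nat \<lfloor>4 * R\<^sup>2 / c\<rfloor>"
  proof (rule finite_if_finite_subsets_card_bdd)
    fix A assume "A \<subseteq> B" "finite A"
    then have "real (card A) \<le> 4 * R\<^sup>2 / c" using bound[of A] c(1) by (simp add: field_simps)
    then show "card A \<le> nat \<lfloor>4 * R\<^sup>2 / c\<rfloor>" by (simp add: le_nat_iff le_floor_iff)
  qed
  then show "finite B" by blast
  then show "c * real (card B) \<le> 4 * R\<^sup>2" using bound by blast
qed

lemma card_edges_le: "card (edges p \<xi> T \<kappa>) \<le> 4"
proof -
  have "card (edges p \<xi> T \<kappa>) \<le> card (UNIV :: side set)" unfolding edges_eq by (rule card_image_le) simp
  also have "\<dots> = 4" by (simp add: UNIV_side)
  finally show ?thesis .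
qed

text \<open>On pairs whose neighbour also lies in \<open>B\<close>, passing from
  \<open>(\<kappa>, e)\<close> to \<open>(nb \<kappa> e, e)\<close> is an involution that reverses
  the sign of the summand.\<close>

lemma sum_faces_telescope:
  assumes B: "finite B" "B \<subseteq> elems T"
    and anti: "\<And>\<kappa> e. \<kappa> \<in> elems T \<Longrightarrow> e \<in> edges p \<xi> T \<kappa> \<Longrightarrow> F (nb \<kappa> e) e = - F \<kappa> e"
  shows "(\<Sum>\<kappa>\<in>B. \<Sum>e\<in>edges p \<xi> T \<kappa>. F \<kappa> e) =
    (\<Sum>(\<kappa>, e)\<in>{(\<kappa>, e). \<kappa> \<in> B \<and> e \<in> edges p \<xi> T \<kappa> \<and> nb \<kappa> e \<notin> B}. (F \<kappa> e :: real))"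
proof -
  let ?E = "Sigma B (edges p \<xi> T)"
  let ?I = "{(\<kappa>, e)\<in>?E. nb \<kappa> e \<in> B}" and ?O = "{(\<kappa>, e). \<kappa> \<in> B \<and> e \<in> edges p \<xi> T \<kappa> \<and> nb \<kappa> e \<notin> B}"
  have fin: "finite ?E" using B by (intro finite_SigmaI) auto
  have "(\<Sum>\<kappa>\<in>B. \<Sum>e\<in>edges p \<xi> T \<kappa>. F \<kappa> e) = (\<Sum>(\<kappa>, e)\<in>?E. F \<kappa> e)"
    by (rule sum.Sigma) (use B in auto)
  also have "?E = ?I \<union> ?O" by auto
  also have "(\<Sum>(\<kappa>, e)\<in>?I \<union> ?O. F \<kappa> e) = (\<Sum>(\<kappa>, e)\<in>?I. F \<kappa> e) + (\<Sum>(\<kappa>, e)\<in>?O. F \<kappa> e)"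
    by (rule sum.union_disjoint) (auto intro: finite_subset[OF _ fin])
  also have "(\<Sum>(\<kappa>, e)\<in>?I. F \<kappa> e) = 0"
  proof -
    have "(\<Sum>(\<kappa>, e)\<in>?I. F \<kappa> e) = (\<Sum>(\<kappa>, e)\<in>?I. - F \<kappa> e)"
      by (rule sum.reindex_bij_witness[of _ "\<lambda>(\<kappa>, e). (nb \<kappa> e, e)" "\<lambda>(\<kappa>, e). (nb \<kappa> e, e)"])
         (use B in \<open>auto simp: neighbour_neighbour neighbour anti subset_iff\<close>)
    then show ?thesis by (simp add: sum_negf split_beta)
  qed
  finally show ?thesis by simp
qed

end

context dgsem_geometry
begin

text \<open>The balance is applied to the elements inside the ball of radius
  \<open>(N + 1) * H\<close>. On an outgoing face the inner element is not inside the ball of radius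
  \<open>N * H\<close>, and the outer one is inside that of radius \<open>(N + 2) * H\<close>. With
  at most four edges per element, the mass is bounded by \<open>4 * C\<close> times that of two
  layers.\<close>

lemma layer_propagation:
  assumes H: "0 < H" "\<And>\<kappa>. \<kappa> \<in> elems T \<Longrightarrow> diameter \<kappa> \<le> H"
    and c: "0 < c" "\<And>\<kappa>. \<kappa> \<in> elems T \<Longrightarrow> c \<le> measure lebesgue \<kappa>"
    and \<mu>: "\<And>\<kappa>. \<kappa> \<in> elems T \<Longrightarrow> 0 \<le> \<mu> \<kappa> \<and> \<mu> \<kappa> \<le> (K :: real)"
    and C: "0 < C"
    and balance: "\<And>B. finite B \<Longrightarrow> B \<subseteq> elems T \<Longrightarrow> (\<Sum>\<kappa>\<in>B. \<mu> \<kappa>) \<le>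
       C * (\<Sum>(\<kappa>, e)\<in>{(\<kappa>, e). \<kappa> \<in> B \<and> e \<in> edges p \<xi> T \<kappa> \<and> nb \<kappa> e \<notin> B}. \<mu> \<kappa> + \<mu> (nb \<kappa> e))"
    and \<kappa>: "\<kappa> \<in> elems T"
  shows "\<mu> \<kappa> = 0"
proof -
  define B where "B N = {\<kappa>\<in>elems T. \<kappa> \<subseteq> cball 0 (real N * H)}" for N :: nat
  define S where "S N = (\<Sum>\<kappa>\<in>B N. \<mu> \<kappa>)" for N
  have fin: "finite (B N)" and cnt: "c * real (card (B N)) \<le> 4 * (real N * H)\<^sup>2" for N
    using element_count[OF _ c, of "real N * H"] H by (simp_all add: B_def)
  have sub: "B N \<subseteq> elems T" for N by (auto simp: B_def)
  have Suc: "B N \<subseteq> B (Suc N)" for N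
  proof -
    have "cball 0 (real N * H) \<subseteq> cball (0 :: real^2) (real (Suc N) * H)"
      using H by (intro subset_cball) (simp add: distrib_right)
    then show ?thesis unfolding B_def by blast
  qed
  have nbB: "nb \<kappa> e \<in> B (Suc N)" if "\<kappa> \<in> B N" "e \<in> edges p \<xi> T \<kappa>" for \<kappa> e N
  proof -
    have \<kappa>: "\<kappa> \<in> elems T" "\<kappa> \<subseteq> cball 0 (real N * H)" using that by (auto simp: B_def)
    have "nb \<kappa> e \<subseteq> cball 0 (real N * H + H)"
      by (rule neighbour_in_cball[OF \<kappa>(1) that(2) \<kappa>(2) H(2)[OF neighbour(1)[OF \<kappa>(1) that(2)]]])
    then show ?thesis using neighbour(1)[OF \<kappa>(1) that(2)] by (simp add: B_def distrib_right add.commute)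
  qed
  have diff: "(\<Sum>\<kappa>\<in>B (Suc N) - B N. \<mu> \<kappa>) = S (Suc N) - S N" for N
    unfolding S_def by (rule sum_diff[OF fin Suc])
  have edges_sum: "(\<Sum>(\<kappa>, e)\<in>Sigma (B (Suc N) - B N) (edges p \<xi> T). \<mu> \<kappa>) \<le> 4 * (S (Suc N) - S N)" for N
  proof -
    have "(\<Sum>(\<kappa>, e)\<in>Sigma (B (Suc N) - B N) (edges p \<xi> T). \<mu> \<kappa>) =
        (\<Sum>\<kappa>\<in>B (Suc N) - B N. \<Sum>e\<in>edges p \<xi> T \<kappa>. \<mu> \<kappa>)"
      by (rule sum.Sigma[symmetric]) (use fin in auto)
    also have "\<dots> \<le> (\<Sum>\<kappa>\<in>B (Suc N) - B N. 4 * \<mu> \<kappa>)"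
    proof (rule sum_mono)
      fix \<kappa> assume "\<kappa> \<in> B (Suc N) - B N"
      then have "0 \<le> \<mu> \<kappa>" using \<mu> sub by blast
      then show "(\<Sum>e\<in>edges p \<xi> T \<kappa>. \<mu> \<kappa>) \<le> 4 * \<mu> \<kappa>"
        using card_edges_le[of \<kappa>] by (simp add: mult_right_mono)
    qed
    also have "\<dots> = 4 * (S (Suc N) - S N)" by (simp add: sum_distrib_left[symmetric] diff)
    finally show ?thesis .
  qed
  have step: "S (Suc N) \<le> (4 * C) * (S (Suc (Suc N)) - S N)" for N
  proof -
    define D where "D = {(\<kappa>, e). \<kappa> \<in> B (Suc N) \<and> e \<in> edges p \<xi> T \<kappa> \<and> nb \<kappa> e \<notin> B (Suc N)}"
    let ?E = "\<lambda>N. Sigma (B (Suc N) - B N) (edges p \<xi> T)"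
    let ?\<phi> = "\<lambda>(\<kappa>, e). (nb \<kappa> e, e)"
    have finE: "finite (?E N)" for N using fin by (intro finite_SigmaI) auto
    \<comment> \<open>An element of \<open>B N\<close> has all its neighbours in
      \<open>B (Suc N)\<close>, so it owns no outgoing face.\<close>
    have DE: "D \<subseteq> ?E N" using nbB by (auto simp: D_def)
    have nn: "0 \<le> \<mu> (fst x)" if "x \<in> ?E N" for x N using that \<mu> sub[of "Suc N"] by auto
    have "(\<Sum>(\<kappa>, e)\<in>D. \<mu> \<kappa>) \<le> (\<Sum>(\<kappa>, e)\<in>?E N. \<mu> \<kappa>)"
      unfolding split_beta by (rule sum_mono2[OF finE DE]) (use nn in blast)
    also have "\<dots> \<le> 4 * (S (Suc N) - S N)" by (rule edges_sum)
    finally have 1: "(\<Sum>(\<kappa>, e)\<in>D. \<mu> \<kappa>) \<le> 4 * (S (Suc N) - S N)" .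
    have De: "\<kappa> \<in> elems T \<and> e \<in> edges p \<xi> T \<kappa> \<and> nb \<kappa> e \<notin> B (Suc N) \<and> nb \<kappa> e \<in> B (Suc (Suc N))"
      if "(\<kappa>, e) \<in> D" for \<kappa> e
      using that sub[of "Suc N"] nbB[of \<kappa> "Suc N" e] by (auto simp: D_def)
    have inj: "inj_on ?\<phi> D"
    proof (rule inj_onI)
      fix x y assume xy: "x \<in> D" "y \<in> D" "?\<phi> x = ?\<phi> y"
      obtain \<kappa> e \<kappa>' e' where x: "x = (\<kappa>, e)" and y: "y = (\<kappa>', e')" by (cases x, cases y)
      have eq: "nb \<kappa> e = nb \<kappa>' e'" "e = e'" using xy(3) unfolding x y prod.case prod.inject by blast+
      have "\<kappa> = nb (nb \<kappa> e) e" "\<kappa>' = nb (nb \<kappa>' e') e'"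
        using De xy neighbour_neighbour by (simp_all add: x y)
      then show "x = y" using eq unfolding x y by metis
    qed
    have im: "?\<phi> ` D \<subseteq> ?E (Suc N)"
      using De neighbour(3) by fastforce
    have "(\<Sum>(\<kappa>, e)\<in>D. \<mu> (nb \<kappa> e)) = (\<Sum>x\<in>?\<phi> ` D. \<mu> (fst x))"
      by (subst sum.reindex[OF inj]) (simp add: split_beta)
    also have "\<dots> \<le> (\<Sum>x\<in>?E (Suc N). \<mu> (fst x))"
      by (rule sum_mono2[OF finE im]) (use nn in blast)
    also have "\<dots> \<le> 4 * (S (Suc (Suc N)) - S (Suc N))" using edges_sum[of "Suc N"] by (simp add: split_beta)
    finally have 2: "(\<Sum>(\<kappa>, e)\<in>D. \<mu> (nb \<kappa> e)) \<le> 4 * (S (Suc (Suc N)) - S (Suc N))" .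
    have "S (Suc N) \<le> C * (\<Sum>(\<kappa>, e)\<in>D. \<mu> \<kappa> + \<mu> (nb \<kappa> e))"
      unfolding S_def D_def by (rule balance[OF fin sub])
    also have "(\<Sum>(\<kappa>, e)\<in>D. \<mu> \<kappa> + \<mu> (nb \<kappa> e)) = (\<Sum>(\<kappa>, e)\<in>D. \<mu> \<kappa>) + (\<Sum>(\<kappa>, e)\<in>D. \<mu> (nb \<kappa> e))"
      by (simp add: split_beta sum.distrib)
    also have "C * \<dots> \<le> C * (4 * (S (Suc (Suc N)) - S N))"
      using 1 2 C by (intro mult_left_mono) auto
    finally show ?thesis by (simp only: mult_ac)
  qed
  have nonneg: "0 \<le> S N" for N unfolding S_def using \<mu> sub by (intro sum_nonneg) blast
  have mono: "S N \<le> S (Suc N)" for N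
    unfolding S_def by (rule sum_mono2[OF fin Suc]) (use \<mu> sub in blast)
  have K: "0 \<le> K" using \<mu>[OF \<kappa>] by linarith
  have growth: "S N \<le> (K * (4 * H\<^sup>2 / c)) * (real N)\<^sup>2" for N
  proof -
    have "S N \<le> (\<Sum>\<kappa>\<in>B N. K)" unfolding S_def by (rule sum_mono) (use \<mu> sub in blast)
    also have "\<dots> = K * real (card (B N))" by simp
    also have "\<dots> \<le> K * (4 * (real N * H)\<^sup>2 / c)"
      using cnt[of N] c(1) K by (intro mult_left_mono) (simp_all add: field_simps)
    finally show ?thesis by (simp add: power_mult_distrib mult_ac)
  qed
  have S0: "S N = 0" for N
    by (rule quadratic_growth_imp_zero[OF nonneg _ step mono growth]) (use C in simp)
  obtain R where R: "\<And>x. x \<in> \<kappa> \<Longrightarrow> norm x \<le> R"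
    using bounded_element[OF \<kappa>] by (auto simp: bounded_iff)
  obtain N :: nat where "R < real N * H" using reals_Archimedean3[OF H(1)] by blast
  then have "\<kappa> \<subseteq> cball 0 (real N * H)" using R by fastforce
  then have "\<kappa> \<in> B N" using \<kappa> by (simp add: B_def)
  moreover have "\<forall>\<kappa>\<in>B N. \<mu> \<kappa> = 0"
    using S0[of N] unfolding S_def by (subst (asm) sum_nonneg_eq_0_iff[OF fin]) (use \<mu> sub in blast)+
  ultimately show ?thesis by blast
qed

end

section \<open>The nonlinear system on a time slab\<close>

locale dgsem_problem = dgsem_geometry p \<xi> \<omega> \<Omega> T + ec_flux_on_interval f \<theta> g m M hec
  for p \<xi> \<omega> \<Omega> T f \<theta> g m M hec +
  fixes q :: nat and \<tau> \<rho> :: "nat \<Rightarrow> real" and h :: "real \<Rightarrow> real \<Rightarrow> real^2 \<Rightarrow> real"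
    and dk :: "(real^2) set \<Rightarrow> real" and dn dt :: real and U0 :: "(real^2) set \<Rightarrow> nat \<Rightarrow> nat \<Rightarrow> real"
  assumes q: "1 \<le> q" and time_rule: "gauss_lobatto q \<tau> \<rho>"
    and interface: "interface_flux f m M h"
    and space_viscosity: "\<And>\<kappa>. \<kappa> \<in> elems T \<Longrightarrow> 4 * Lf f m M * Lu \<theta> m M * max_D_over_weight p \<xi> \<omega> \<le> dk \<kappa>"
    and time_viscosity: "2 * Lu \<theta> m M * max_D_over_weight q \<tau> \<rho> \<le> dn"
    and dt: "0 < dt"
    and U0: "\<And>\<kappa> i j. \<kappa> \<in> elems T \<Longrightarrow> i \<le> p \<Longrightarrow> j \<le> p \<Longrightarrow> m \<le> U0 \<kappa> i j \<and> U0 \<kappa> i j \<le> M"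
begin

abbreviation "A \<equiv> dof_index p q T"
abbreviation "L \<equiv> Lu \<theta> m M * Lf f m M"
abbreviation "slice U r \<equiv> (\<lambda>\<kappa> i j. U (\<kappa>, i, j, r :: nat) :: real)"
abbreviation "history U \<kappa> i j \<equiv> (\<lambda>l. U (\<kappa> :: (real^2) set, i :: nat, j :: nat, l :: nat) :: real)"

definition residual :: "((real^2) set \<times> nat \<times> nat \<times> nat \<Rightarrow> real) \<Rightarrow> (real^2) set \<times> nat \<times> nat \<times> nat \<Rightarrow> real" where
  "residual U = (\<lambda>(\<kappa>, i, j, r).
     \<omega> i * \<omega> j * J \<kappa> i j * T_op q \<tau> \<rho> \<theta> dn (U0 \<kappa> i j) (history U \<kappa> i j) r
     + \<rho> r * dt / 2 * (R_op p \<xi> \<omega> T f hec h (slice U r) \<kappa> i j + V_op p \<xi> \<omega> T dk (slice U r) \<kappa> i j))"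

lemma dgsem_slab_iff:
  "dgsem_slab p \<xi> \<omega> q \<tau> \<rho> T f \<theta> hec h dk dn dt U0 U \<longleftrightarrow> (\<forall>a\<in>A. residual U a = 0)"
  by (auto simp: dgsem_slab_def residual_def dof_index_def)

lemma Lu_nonneg: "0 \<le> Lu \<theta> m M"
proof (cases "m = M")
  case True
  then show ?thesis by (auto simp: Lu_def cong: conj_cong)
next
  case False
  then show ?thesis using Lu_pos mM by simp
qed

lemma time_weight_pos: "r \<le> q \<Longrightarrow> 0 < \<rho> r"
  by (rule gauss_lobatto_weight_pos[OF time_rule])

text \<open>The viscosity outweighs the increments of \<open>Uec\<close> by the fraction
  \<open>1 - K\<close>, and this surplus survives as \<open>\<epsilon>\<close>. The constants are
  independent of the states and of \<open>w0\<close>, so they serve all elements at once.\<close>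

lemma T_op_increment:
  assumes r: "r \<le> q"
  shows "\<exists>C\<ge>0. \<exists>\<epsilon>\<ge>0. (m < M \<longrightarrow> 0 < \<epsilon>) \<and>
    (\<forall>w w' w0. (\<forall>l\<le>q. m \<le> w l \<and> w l \<le> w' l \<and> w' l \<le> M) \<longrightarrow>
       T_op q \<tau> \<rho> \<theta> dn w0 w' r - T_op q \<tau> \<rho> \<theta> dn w0 w r \<le> C * (w' r - w r) - \<epsilon> * (\<Sum>l\<le>q. w' l - w l))"
proof -
  obtain K where K: "0 \<le> K" "K < 1" and inc:
    "\<And>a b b'. a \<in> {m..M} \<Longrightarrow> b \<in> {m..M} \<Longrightarrow> b' \<in> {m..M} \<Longrightarrow> b \<le> b' \<Longrightarrow>
       0 \<le> Uec \<theta> a b' - Uec \<theta> a b \<and> Uec \<theta> a b' - Uec \<theta> a b \<le> Lu \<theta> m M * K * (b' - b)"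
    using Uec_increment by blast
  define D where "D = max_D_over_weight q \<tau> \<rho>"
  define \<rho>l where "\<rho>l = Min (\<rho> ` {..q})"
  have \<rho>l: "0 < \<rho>l" unfolding \<rho>l_def by (subst Min_gr_iff) (auto simp: time_weight_pos)
  have \<rho>l_le: "\<rho>l \<le> \<rho> l" if "l \<le> q" for l using that by (simp add: \<rho>l_def)
  have D: "0 < D" unfolding D_def by (rule max_D_over_weight_pos[OF time_rule q])
  have \<rho>r: "0 < \<rho> r" by (rule time_weight_pos[OF r])
  \<comment> \<open>The margin \<open>1 - K\<close> times a lower bound, uniform in
    \<open>l\<close>, of the viscosity weights \<open>c l\<close>.\<close>
  define \<epsilon> where "\<epsilon> = (1 - K) * (2 * Lu \<theta> m M * D * \<rho> r * \<rho>l)"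
  define c where "c l = dn * \<rho> r * \<rho> l" for l
  define B where "B l = 2 * \<bar>Qmat q \<tau> \<rho> r l\<bar> + \<epsilon> + c l * (1 + K)" for l
  have \<epsilon>0: "0 \<le> \<epsilon>" using K Lu_nonneg D \<rho>l \<rho>r by (simp add: \<epsilon>_def)
  have dn0: "0 \<le> dn"
    using time_viscosity Lu_nonneg D unfolding D_def[symmetric]
    by (meson mult_nonneg_nonneg order_trans less_imp_le zero_le_numeral)
  have c0: "0 \<le> c l" if "l \<le> q" for l using dn0 \<rho>r time_weight_pos[OF that] by (simp add: c_def)
  have c\<epsilon>: "\<epsilon> \<le> (1 - K) * c l" if l: "l \<le> q" for l
  proof -
    have "2 * Lu \<theta> m M * D * \<rho> r * \<rho>l \<le> dn * \<rho> r * \<rho> l"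
      using time_viscosity \<rho>l_le[OF l] \<rho>l \<rho>r Lu_nonneg D dn0 unfolding D_def[symmetric]
      by (intro mult_mono) auto
    then show ?thesis unfolding \<epsilon>_def c_def using K by (intro mult_left_mono) auto
  qed
  \<comment> \<open>Here the threshold for \<open>dn\<close> is spent: the viscosity weight covers
    the weight of the two-point function times its largest slope.\<close>
  have cQ: "2 * \<bar>Qmat q \<tau> \<rho> r l\<bar> * Lu \<theta> m M \<le> c l" if l: "l \<le> q" "l \<noteq> r" for l
  proof -
    have "\<bar>Dmat q \<tau> r l\<bar> / \<rho> l \<le> D" unfolding D_def using l r by (intro max_D_over_weight_ge) auto
    then have "\<bar>Dmat q \<tau> r l\<bar> \<le> D * \<rho> l" using time_weight_pos[OF l(1)] by (simp add: field_simps)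
    then have "2 * Lu \<theta> m M * \<rho> r * \<bar>Dmat q \<tau> r l\<bar> \<le> 2 * Lu \<theta> m M * \<rho> r * (D * \<rho> l)"
      using Lu_nonneg \<rho>r by (intro mult_left_mono) auto
    also have "\<dots> = (2 * Lu \<theta> m M * D) * (\<rho> r * \<rho> l)" by simp
    also have "\<dots> \<le> dn * (\<rho> r * \<rho> l)"
      using time_viscosity \<rho>r time_weight_pos[OF l(1)] unfolding D_def[symmetric] by (intro mult_right_mono) auto
    finally show ?thesis using \<rho>r by (simp add: c_def Qmat_def abs_mult mult_ac)
  qed
  define t where "t w l = 2 * Qmat q \<tau> \<rho> r l * Uec \<theta> (w r) (w l) + c l * (w r - w l)" for w l
  have T: "T_op q \<tau> \<rho> \<theta> dn w0 w r = (\<Sum>l\<le>q. t w l) + (if r = 0 then w 0 - w0 else 0)" for w w0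
    by (simp add: T_op_def t_def c_def sum.distrib sum_distrib_left mult_ac)
  have main: "T_op q \<tau> \<rho> \<theta> dn w0 w' r - T_op q \<tau> \<rho> \<theta> dn w0 w r \<le>
      (1 + (\<Sum>l\<le>q. B l)) * (w' r - w r) - \<epsilon> * (\<Sum>l\<le>q. w' l - w l)"
    if box: "\<And>l. l \<le> q \<Longrightarrow> m \<le> w l \<and> w l \<le> w' l \<and> w' l \<le> M" for w w' w0
  proof -
    have \<Delta>r: "0 \<le> w' r - w r" using box[OF r] by simp
    have t: "t w' l - t w l \<le> B l * (w' r - w r) - \<epsilon> * (w' l - w l)" if l: "l \<le> q" for l
    proof (cases "l = r")
      case True
      have "t w' l - t w l = 2 * Qmat q \<tau> \<rho> r r * (w' r - w r)"
        by (simp add: t_def True Uec_refl algebra_simps)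
      also have "\<dots> \<le> 2 * \<bar>Qmat q \<tau> \<rho> r r\<bar> * (w' r - w r)" using \<Delta>r by (intro mult_right_mono) auto
      also have "\<dots> \<le> (2 * \<bar>Qmat q \<tau> \<rho> r r\<bar> + c r * (1 + K)) * (w' r - w r)"
        using \<Delta>r c0[OF r] K by (intro mult_right_mono) auto
      also have "\<dots> = B r * (w' r - w r) - \<epsilon> * (w' r - w r)" by (simp add: B_def algebra_simps)
      finally show ?thesis using True by simp
    next
      case False
      let ?Q = "Qmat q \<tau> \<rho> r l" and ?r = "w' r - w r" and ?l = "w' l - w l"
      have bx: "w r \<in> {m..M}" "w' r \<in> {m..M}" "w l \<in> {m..M}" "w' l \<in> {m..M}" "w r \<le> w' r" "w l \<le> w' l"
        using box[OF r] box[OF l] by auto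
      have 1: "0 \<le> Uec \<theta> (w r) (w' l) - Uec \<theta> (w r) (w l) \<and>
          Uec \<theta> (w r) (w' l) - Uec \<theta> (w r) (w l) \<le> Lu \<theta> m M * K * ?l"
        by (rule inc[OF bx(1,3,4,6)])
      have 2: "0 \<le> Uec \<theta> (w' r) (w' l) - Uec \<theta> (w r) (w' l) \<and>
          Uec \<theta> (w' r) (w' l) - Uec \<theta> (w r) (w' l) \<le> Lu \<theta> m M * K * ?r"
        using inc[OF bx(4,1,2,5)] by (simp only: Uec_commute[of "w' l"])
      have "2 * ?Q * (Uec \<theta> (w' r) (w' l) - Uec \<theta> (w r) (w l)) \<le>
          \<bar>2 * ?Q\<bar> * (Uec \<theta> (w' r) (w' l) - Uec \<theta> (w r) (w l))"
        using 1 2 by (intro mult_right_mono) auto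
      also have "\<dots> \<le> \<bar>2 * ?Q\<bar> * (Lu \<theta> m M * K * (?r + ?l))"
        using 1 2 by (intro mult_left_mono) (auto simp: distrib_left)
      also have "\<dots> = (2 * \<bar>?Q\<bar> * Lu \<theta> m M) * (K * (?r + ?l))" by (simp add: abs_mult)
      also have "\<dots> \<le> c l * (K * (?r + ?l))"
        using cQ[OF l False] K bx by (intro mult_right_mono) auto
      finally have "t w' l - t w l \<le> c l * (K * (?r + ?l)) + c l * (?r - ?l)"
        by (simp add: t_def algebra_simps)
      \<comment> \<open>The increment at node \<open>l\<close> enters with \<open>K * c l\<close>
        from the two-point function and \<open>- c l\<close> from the viscosity, which leaves the
        strictly negative balance \<open>- (1 - K) * c l\<close> whenever \<open>c l\<close> is
        positive.\<close>
      also have "\<dots> = c l * (1 + K) * ?r - (1 - K) * c l * ?l" by (simp add: algebra_simps)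
      also have "\<dots> \<le> B l * ?r - \<epsilon> * ?l"
        using \<epsilon>0 c\<epsilon>[OF l] bx by (intro diff_mono mult_right_mono) (auto simp: B_def)
      finally show ?thesis .
    qed
    have "T_op q \<tau> \<rho> \<theta> dn w0 w' r - T_op q \<tau> \<rho> \<theta> dn w0 w r \<le> (\<Sum>l\<le>q. t w' l - t w l) + (w' r - w r)"
      using \<Delta>r by (auto simp: T sum_subtractf)
    also have "\<dots> \<le> (\<Sum>l\<le>q. B l * (w' r - w r) - \<epsilon> * (w' l - w l)) + (w' r - w r)"
      by (intro add_right_mono sum_mono) (use t in simp)
    also have "\<dots> = (1 + (\<Sum>l\<le>q. B l)) * (w' r - w r) - \<epsilon> * (\<Sum>l\<le>q. w' l - w l)"
    proof -
      have "(\<Sum>l\<le>q. B l * (w' r - w r) - \<epsilon> * (w' l - w l)) =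
          (\<Sum>l\<le>q. B l * (w' r - w r)) - (\<Sum>l\<le>q. \<epsilon> * (w' l - w l))"
        by (rule sum_subtractf)
      also have "\<dots> = (\<Sum>l\<le>q. B l) * (w' r - w r) - \<epsilon> * (\<Sum>l\<le>q. w' l - w l)"
        by (simp only: sum_distrib_right sum_distrib_left)
      finally show ?thesis by (simp add: distrib_right)
    qed
    finally show ?thesis .
  qed
  have "0 \<le> B l" if "l \<le> q" for l using c0[OF that] K \<epsilon>0 by (simp add: B_def)
  then have C0: "0 \<le> 1 + (\<Sum>l\<le>q. B l)" by (intro add_nonneg_nonneg sum_nonneg) auto
  have "0 < \<epsilon>" if "m < M" using K Lu_pos[OF that] D \<rho>l \<rho>r by (simp add: \<epsilon>_def)
  then show ?thesis
    by (intro exI[of _ "1 + (\<Sum>l\<le>q. B l)"] exI[of _ \<epsilon>] conjI allI impI C0 \<epsilon>0 main) auto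
qed

text \<open>Summation by parts leaves \<open>w q - w 0\<close>; the jump term at the first node
  replaces \<open>w 0\<close> by \<open>w0\<close>.\<close>

lemma sum_T_op: "(\<Sum>r\<le>q. T_op q \<tau> \<rho> \<theta> dn w0 w r) = w q - w0"
proof -
  have "(\<Sum>r\<le>q. \<Sum>l\<le>q. 2 * (Qmat q \<tau> \<rho> r l * Uec \<theta> (w r) (w l))) = w q - w 0"
    using Qmat_symmetric_sum[OF time_rule q, of "\<lambda>r l. Uec \<theta> (w r) (w l)"] Uec_commute
    by (simp add: Uec_refl)
  moreover have "(\<Sum>r\<le>q. \<Sum>l\<le>q. \<rho> r * \<rho> l * (w r - w l)) = 0"
    by (rule sum_sum_symmetric_diff) simp
  then have "(\<Sum>r\<le>q. dn * \<rho> r * (\<Sum>l\<le>q. \<rho> l * (w r - w l))) = 0"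
    by (simp add: mult.assoc sum_distrib_left[symmetric])
  ultimately show ?thesis
    by (simp add: T_op_def sum.distrib mult.assoc)
qed

end

section \<open>Quasimonotonicity of the residual and the greatest solution\<close>

context dgsem_problem
begin

text \<open>A one-sided Lipschitz condition along ordered pairs. It says at once that
  \<open>\<Phi>\<close> is nonincreasing in every unknown of the box other than \<open>a\<close> and
  Lipschitz from above in \<open>a\<close>, and it is stable under sums, so each term of the
  residual can be treated alone.\<close>

definition upper_lip ::
  "(real^2) set \<times> nat \<times> nat \<times> nat \<Rightarrow> (((real^2) set \<times> nat \<times> nat \<times> nat \<Rightarrow> real) \<Rightarrow> real) \<Rightarrow> bool" where
  "upper_lip a \<Phi> \<longleftrightarrow> (\<exists>C\<ge>0. \<forall>U W. (\<forall>b\<in>A. m \<le> U b \<and> U b \<le> W b \<and> W b \<le> M) \<longrightarrow>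
     \<Phi> W - \<Phi> U \<le> C * (W a - U a))"

lemma upper_lipI:
  assumes "0 \<le> C" "\<And>U W. (\<And>b. b \<in> A \<Longrightarrow> m \<le> U b \<and> U b \<le> W b \<and> W b \<le> M) \<Longrightarrow>
     \<Phi> W - \<Phi> U \<le> C * (W a - U a)"
  shows "upper_lip a \<Phi>"
  using assms unfolding upper_lip_def by blast

lemma upper_lip_add:
  assumes "upper_lip a \<Phi>" "upper_lip a \<Psi>"
  shows "upper_lip a (\<lambda>U. \<Phi> U + \<Psi> U)"
proof -
  obtain C D where "0 \<le> C" "0 \<le> D"
    and C: "\<And>U W. (\<forall>b\<in>A. m \<le> U b \<and> U b \<le> W b \<and> W b \<le> M) \<Longrightarrow> \<Phi> W - \<Phi> U \<le> C * (W a - U a)"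
    and D: "\<And>U W. (\<forall>b\<in>A. m \<le> U b \<and> U b \<le> W b \<and> W b \<le> M) \<Longrightarrow> \<Psi> W - \<Psi> U \<le> D * (W a - U a)"
    using assms unfolding upper_lip_def by blast
  show ?thesis
  proof (rule upper_lipI[of "C + D"])
    fix U W assume "\<And>b. b \<in> A \<Longrightarrow> m \<le> U b \<and> U b \<le> W b \<and> W b \<le> M"
    then show "(\<Phi> W + \<Psi> W) - (\<Phi> U + \<Psi> U) \<le> (C + D) * (W a - U a)"
      using C[of U W] D[of U W] by (simp add: distrib_right)
  qed (use \<open>0 \<le> C\<close> \<open>0 \<le> D\<close> in simp)
qed

lemma upper_lip_cmult:
  assumes "0 \<le> c" "upper_lip a \<Phi>"
  shows "upper_lip a (\<lambda>U. c * \<Phi> U)"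
proof -
  obtain C where "0 \<le> C"
    and C: "\<And>U W. (\<forall>b\<in>A. m \<le> U b \<and> U b \<le> W b \<and> W b \<le> M) \<Longrightarrow> \<Phi> W - \<Phi> U \<le> C * (W a - U a)"
    using assms unfolding upper_lip_def by blast
  show ?thesis
  proof (rule upper_lipI[of "c * C"])
    fix U W assume "\<And>b. b \<in> A \<Longrightarrow> m \<le> U b \<and> U b \<le> W b \<and> W b \<le> M"
    then have "c * (\<Phi> W - \<Phi> U) \<le> c * (C * (W a - U a))"
      using C[of U W] assms(1) by (intro mult_left_mono) auto
    then show "c * \<Phi> W - c * \<Phi> U \<le> c * C * (W a - U a)"
      by (simp only: right_diff_distrib mult.assoc)
  qed (use assms \<open>0 \<le> C\<close> in simp)
qed

lemma upper_lip_zero: "upper_lip a (\<lambda>U. 0)"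
  by (rule upper_lipI[of 0]) auto

lemma upper_lip_sum: "(\<And>x. x \<in> X \<Longrightarrow> upper_lip a (\<Phi> x)) \<Longrightarrow> upper_lip a (\<lambda>U. \<Sum>x\<in>X. \<Phi> x U)"
  by (induction X rule: infinite_finite_induct) (auto intro: upper_lip_zero upper_lip_add)

lemma hec_pair_increment:
  assumes "a \<in> {m..M}" "b \<in> {m..M}" "a' \<in> {m..M}" "b' \<in> {m..M}"
  shows "\<bar>hec a' b' n - hec a b n\<bar> \<le> Lu \<theta> m M * (Lf f m M * norm n) * (\<bar>a' - a\<bar> + \<bar>b' - b\<bar>)"
proof -
  have "\<bar>hec b' a' n - hec b' a n\<bar> \<le> Lu \<theta> m M * (Lf f m M * norm n) * \<bar>a' - a\<bar>"
    by (rule hec_increment[OF assms(4,1,3)])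
  moreover have "\<bar>hec a b' n - hec a b n\<bar> \<le> Lu \<theta> m M * (Lf f m M * norm n) * \<bar>b' - b\<bar>"
    by (rule hec_increment[OF assms(1,2,4)])
  ultimately show ?thesis
    unfolding hec_commute[of b' a'] hec_commute[of b' a] distrib_left by linarith
qed

text \<open>The viscous term contributes \<open>- c\<close> times the increment at \<open>b\<close>,
  which cancels the worst case of the flux. What remains is at most \<open>2 * c\<close> times the
  increment at \<open>a\<close>.\<close>

lemma upper_lip_hec:
  assumes a: "a \<in> A" and b: "b \<in> A" and c: "\<bar>s\<bar> * (Lu \<theta> m M * (Lf f m M * norm n)) \<le> c"
  shows "upper_lip a (\<lambda>U. s * hec (U a) (U b) n + c * (U a - U b))"
proof (rule upper_lipI[of "2 * c"])
  have "0 \<le> \<bar>s\<bar> * (Lu \<theta> m M * (Lf f m M * norm n))" using Lu_nonneg Lf_nonneg by simp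
  then show "0 \<le> 2 * c" using c by simp
  fix U W :: "(real^2) set \<times> nat \<times> nat \<times> nat \<Rightarrow> real"
  assume box: "\<And>b. b \<in> A \<Longrightarrow> m \<le> U b \<and> U b \<le> W b \<and> W b \<le> M"
  have le: "U a \<le> W a" "U b \<le> W b" using box a b by auto
  have inc: "\<bar>hec (W a) (W b) n - hec (U a) (U b) n\<bar> \<le>
      Lu \<theta> m M * (Lf f m M * norm n) * (\<bar>W a - U a\<bar> + \<bar>W b - U b\<bar>)"
    by (rule hec_pair_increment) (use box[OF a] box[OF b] in auto)
  have "s * (hec (W a) (W b) n - hec (U a) (U b) n) \<le> \<bar>s\<bar> * \<bar>hec (W a) (W b) n - hec (U a) (U b) n\<bar>"
    by (simp add: abs_mult[symmetric])
  also have "\<dots> \<le> \<bar>s\<bar> * (Lu \<theta> m M * (Lf f m M * norm n) * (\<bar>W a - U a\<bar> + \<bar>W b - U b\<bar>))"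
    by (rule mult_left_mono[OF inc]) simp
  also have "\<dots> = \<bar>s\<bar> * (Lu \<theta> m M * (Lf f m M * norm n)) * (\<bar>W a - U a\<bar> + \<bar>W b - U b\<bar>)" by simp
  also have "\<dots> \<le> c * (\<bar>W a - U a\<bar> + \<bar>W b - U b\<bar>)" by (rule mult_right_mono[OF c]) simp
  finally have "s * (hec (W a) (W b) n - hec (U a) (U b) n) \<le> c * ((W a - U a) + (W b - U b))"
    using le by simp
  then show "(s * hec (W a) (W b) n + c * (W a - W b)) - (s * hec (U a) (U b) n + c * (U a - U b))
      \<le> 2 * c * (W a - U a)"
    by (simp add: algebra_simps)
qed

lemma upper_lip_hec_diag:
  assumes "a \<in> A"
  shows "upper_lip a (\<lambda>U. s * hec (U a) (U a) n)"
  using upper_lip_hec[OF assms assms order_refl, of s n] by simp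

lemma interface_bounds:
  obtains L1 L2 where "0 \<le> L1" "0 \<le> L2"
    "\<And>a a' b n. a \<in> {m..M} \<Longrightarrow> a' \<in> {m..M} \<Longrightarrow> b \<in> {m..M} \<Longrightarrow> n \<in> sphere 0 1 \<Longrightarrow>
       \<bar>h a' b n - h a b n\<bar> \<le> L1 * \<bar>a' - a\<bar>"
    "\<And>a b b' n. a \<in> {m..M} \<Longrightarrow> b \<in> {m..M} \<Longrightarrow> b' \<in> {m..M} \<Longrightarrow> n \<in> sphere 0 1 \<Longrightarrow>
       \<bar>h a b' n - h a b n\<bar> \<le> L2 * \<bar>b' - b\<bar>"
proof -
  have "\<exists>L1 L2. Lf f m M \<le> L1 + L2 \<and>
        (\<forall>b\<in>{m..M}. \<forall>n\<in>sphere 0 1. L1-lipschitz_on {m..M} (\<lambda>a. h a b n)) \<and>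
        (\<forall>a\<in>{m..M}. \<forall>n\<in>sphere 0 1. L2-lipschitz_on {m..M} (\<lambda>b. h a b n))"
    using interface unfolding interface_flux_def by (elim conjE)
  then obtain L1 L2 where L:
    "\<And>b n. b \<in> {m..M} \<Longrightarrow> n \<in> sphere 0 1 \<Longrightarrow> L1-lipschitz_on {m..M} (\<lambda>a. h a b n)"
    "\<And>a n. a \<in> {m..M} \<Longrightarrow> n \<in> sphere 0 1 \<Longrightarrow> L2-lipschitz_on {m..M} (\<lambda>b. h a b n)"
    by blast
  have mm: "m \<in> {m..M}" using mM by simp
  have n0: "axis 1 1 \<in> sphere (0 :: real^2) 1" by (simp add: norm_axis_1)
  show thesis
  proof (rule that[of L1 L2])
    show "0 \<le> L1" by (rule lipschitz_on_nonneg[OF L(1)[OF mm n0]])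
    show "0 \<le> L2" by (rule lipschitz_on_nonneg[OF L(2)[OF mm n0]])
    show "\<bar>h a' b n - h a b n\<bar> \<le> L1 * \<bar>a' - a\<bar>"
      if "a \<in> {m..M}" "a' \<in> {m..M}" "b \<in> {m..M}" "n \<in> sphere 0 1" for a a' b n
      using lipschitz_onD[OF L(1)[OF that(3,4)] that(2,1)] by (simp add: dist_real_def)
    show "\<bar>h a b' n - h a b n\<bar> \<le> L2 * \<bar>b' - b\<bar>"
      if "a \<in> {m..M}" "b \<in> {m..M}" "b' \<in> {m..M}" "n \<in> sphere 0 1" for a b b' n
      using lipschitz_onD[OF L(2)[OF that(1,4)] that(3,2)] by (simp add: dist_real_def)
  qed
qed

lemma interface_antimono:
  assumes "a \<in> {m..M}" "b \<in> {m..M}" "b' \<in> {m..M}" "n \<in> sphere 0 1" "b \<le> b'"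
  shows "h a b' n \<le> h a b n"
proof -
  have "\<forall>a\<in>{m..M}. \<forall>n\<in>sphere 0 1. antimono_on {m..M} (\<lambda>b. h a b n)"
    using interface unfolding interface_flux_def by (elim conjE)
  then have "antimono_on {m..M} (\<lambda>b. h a b n)" using assms(1,4) by blast
  then show ?thesis using monotone_onD assms(2,3,5) by fastforce
qed

lemma interface_conservative: "n \<in> sphere 0 1 \<Longrightarrow> h a b n = - h b a (- n)"
proof -
  assume "n \<in> sphere 0 1"
  moreover have "\<forall>a b. \<forall>n\<in>sphere 0 1. h a b n = - h b a (- n)"
    using interface unfolding interface_flux_def by (elim conjE)
  ultimately show ?thesis by blast
qed

lemma interface_consistent: "n \<in> sphere 0 1 \<Longrightarrow> h u u n = f u \<bullet> n"
proof -
  assume "n \<in> sphere 0 1"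
  moreover have "\<forall>u. \<forall>n\<in>sphere 0 1. h u u n = f u \<bullet> n"
    using interface unfolding interface_flux_def by (elim conjE)
  ultimately show ?thesis by blast
qed

text \<open>The monotone flux already decreases in the neighbour's state, so the face terms need no
  viscosity.\<close>

lemma upper_lip_face:
  assumes a: "a \<in> A" and b: "b \<in> A" and n: "n \<in> sphere 0 1" and w: "0 \<le> w"
  shows "upper_lip a (\<lambda>U. w * (h (U a) (U b) n - f (U a) \<bullet> n))"
proof (rule upper_lip_cmult[OF w])
  obtain L1 L2 where L: "0 \<le> L1" "0 \<le> L2"
    "\<And>a a' b n. a \<in> {m..M} \<Longrightarrow> a' \<in> {m..M} \<Longrightarrow> b \<in> {m..M} \<Longrightarrow> n \<in> sphere 0 1 \<Longrightarrow>
       \<bar>h a' b n - h a b n\<bar> \<le> L1 * \<bar>a' - a\<bar>"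
    "\<And>a b b' n. a \<in> {m..M} \<Longrightarrow> b \<in> {m..M} \<Longrightarrow> b' \<in> {m..M} \<Longrightarrow> n \<in> sphere 0 1 \<Longrightarrow>
       \<bar>h a b' n - h a b n\<bar> \<le> L2 * \<bar>b' - b\<bar>"
    using interface_bounds by blast
  show "upper_lip a (\<lambda>U. h (U a) (U b) n - f (U a) \<bullet> n)"
  proof (rule upper_lipI[of "L1 + Lf f m M"])
    fix U W :: "(real^2) set \<times> nat \<times> nat \<times> nat \<Rightarrow> real"
    assume box: "\<And>b. b \<in> A \<Longrightarrow> m \<le> U b \<and> U b \<le> W b \<and> W b \<le> M"
    have bx: "U a \<in> {m..M}" "W a \<in> {m..M}" "U b \<in> {m..M}" "W b \<in> {m..M}" "U a \<le> W a" "U b \<le> W b"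
      using box[OF a] box[OF b] by auto
    have "h (U a) (W b) n \<le> h (U a) (U b) n" by (rule interface_antimono[OF bx(1,3,4) n bx(6)])
    moreover have "\<bar>h (W a) (W b) n - h (U a) (W b) n\<bar> \<le> L1 * \<bar>W a - U a\<bar>" by (rule L(3)[OF bx(1,2,4) n])
    moreover have "\<bar>f (W a) \<bullet> n - f (U a) \<bullet> n\<bar> \<le> Lf f m M * norm n * \<bar>W a - U a\<bar>" by (rule Lf_ge[OF bx(1,2)])
    moreover have "norm n = 1" using n by simp
    ultimately show "(h (W a) (W b) n - f (W a) \<bullet> n) - (h (U a) (U b) n - f (U a) \<bullet> n) \<le> (L1 + Lf f m M) * (W a - U a)"
      using bx(5) by (simp add: distrib_right)
  qed (use L Lf_nonneg in simp)
qed

text \<open>The factor 4 in the threshold is the 2 in front of the volume fluxes divided by the 1/2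
  in the graph viscosity.\<close>

lemma viscosity_dominates:
  assumes \<kappa>: "\<kappa> \<in> elems T" and ij: "i \<le> p" "j \<le> p" "k \<le> p" "k \<noteq> i" and x: "0 \<le> x"
  shows "\<bar>2 * \<omega> j * Qmat p \<xi> \<omega> i k\<bar> * (Lu \<theta> m M * (Lf f m M * x)) \<le> dk \<kappa> * \<omega> i * \<omega> j * (\<omega> k / 2 * x)"
proof -
  have w: "0 < \<omega> i" "0 < \<omega> j" "0 < \<omega> k" using weight_pos ij by auto
  define D where "D = max_D_over_weight p \<xi> \<omega>"
  have "\<bar>Dmat p \<xi> i k\<bar> / \<omega> k \<le> D" unfolding D_def using ij by (intro max_D_over_weight_ge) auto
  then have "\<bar>Dmat p \<xi> i k\<bar> \<le> D * \<omega> k" using w by (simp add: field_simps)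
  then have "(2 * \<omega> i * \<omega> j * Lu \<theta> m M * Lf f m M * x) * \<bar>Dmat p \<xi> i k\<bar> \<le>
      (2 * \<omega> i * \<omega> j * Lu \<theta> m M * Lf f m M * x) * (D * \<omega> k)"
    using w Lu_nonneg Lf_nonneg x by (intro mult_left_mono mult_nonneg_nonneg) auto
  also have "\<dots> = (4 * Lf f m M * Lu \<theta> m M * D) * (\<omega> i * \<omega> j * (\<omega> k / 2 * x))" by simp
  also have "\<dots> \<le> dk \<kappa> * (\<omega> i * \<omega> j * (\<omega> k / 2 * x))"
    using space_viscosity[OF \<kappa>] w x unfolding D_def by (intro mult_right_mono) auto
  finally show ?thesis using w by (simp add: Qmat_def abs_mult mult_ac)
qed

text \<open>Every flux is placed next to the viscous difference of the same pair of nodes, so that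
  domination can be checked term by term. The order of the weights in the second sum matches
  \<open>viscosity_dominates\<close> with \<open>i\<close> and \<open>j\<close> exchanged.\<close>

lemma R_V_eq:
  assumes \<kappa>: "\<kappa> \<in> elems T" and ij: "i \<le> p" "j \<le> p"
  shows "R_op p \<xi> \<omega> T f hec h W \<kappa> i j + V_op p \<xi> \<omega> T dk W \<kappa> i j =
    (\<Sum>k\<le>p. 2 * \<omega> j * Qmat p \<xi> \<omega> i k * hec (W \<kappa> i j) (W \<kappa> k j) (n1 \<kappa> i k j)
       + dk \<kappa> * \<omega> i * \<omega> j * (\<omega> k / 2 * norm (n1 \<kappa> i k j)) * (W \<kappa> i j - W \<kappa> k j)) +
    (\<Sum>k\<le>p. 2 * \<omega> i * Qmat p \<xi> \<omega> j k * hec (W \<kappa> i j) (W \<kappa> i k) (n2 \<kappa> i j k)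
       + dk \<kappa> * \<omega> j * \<omega> i * (\<omega> k / 2 * norm (n2 \<kappa> i j k)) * (W \<kappa> i j - W \<kappa> i k)) +
    (\<Sum>e\<in>edges p \<xi> T \<kappa>. \<Sum>k\<le>p. if (i, j) = fn \<kappa> e k then
          \<omega> k * Jedge \<xi> T e k * (h (at_face W \<kappa> e k) (at_face W (nb \<kappa> e) e k) (enormal T \<kappa> e k)
           - f (at_face W \<kappa> e k) \<bullet> enormal T \<kappa> e k) else 0)"
  unfolding R_op_eq[OF assms] V_op_def
  by (simp add: sum.distrib sum_distrib_left distrib_left mult_ac)

lemma upper_lip_residual:
  assumes a: "a \<in> A"
  shows "upper_lip a (\<lambda>U. residual U a)"
proof -
  obtain \<kappa> i j r where a_eq: "a = (\<kappa>, i, j, r)" by (cases a) auto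
  have \<kappa>: "\<kappa> \<in> elems T" and ij: "i \<le> p" "j \<le> p" and r: "r \<le> q" using a by (auto simp: a_eq dof_index_def)
  have mem: "(\<kappa>', i', j', r) \<in> A" if "\<kappa>' \<in> elems T" "i' \<le> p" "j' \<le> p" for \<kappa>' i' j'
    using that r by (simp add: dof_index_def)
  have T: "upper_lip a (\<lambda>U. T_op q \<tau> \<rho> \<theta> dn (U0 \<kappa> i j) (history U \<kappa> i j) r)"
  proof -
    obtain C \<epsilon> where C: "0 \<le> C" "0 \<le> \<epsilon>" and inc:
      "\<And>w w' w0. \<forall>l\<le>q. m \<le> w l \<and> w l \<le> w' l \<and> w' l \<le> M \<Longrightarrow>
       T_op q \<tau> \<rho> \<theta> dn w0 w' r - T_op q \<tau> \<rho> \<theta> dn w0 w r \<le> C * (w' r - w r) - \<epsilon> * (\<Sum>l\<le>q. w' l - w l)"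
      using T_op_increment[OF r] by blast
    show ?thesis
    proof (rule upper_lipI[OF C(1)])
      fix U W :: "(real^2) set \<times> nat \<times> nat \<times> nat \<Rightarrow> real"
      assume box: "\<And>b. b \<in> A \<Longrightarrow> m \<le> U b \<and> U b \<le> W b \<and> W b \<le> M"
      have bx: "m \<le> history U \<kappa> i j l \<and> history U \<kappa> i j l \<le> history W \<kappa> i j l \<and> history W \<kappa> i j l \<le> M"
        if "l \<le> q" for l by (rule box) (use \<kappa> ij that in \<open>simp add: dof_index_def\<close>)
      have "0 \<le> \<epsilon> * (\<Sum>l\<le>q. history W \<kappa> i j l - history U \<kappa> i j l)"
        using C(2) bx by (intro mult_nonneg_nonneg sum_nonneg) auto
      then show "T_op q \<tau> \<rho> \<theta> dn (U0 \<kappa> i j) (history W \<kappa> i j) r - T_op q \<tau> \<rho> \<theta> dn (U0 \<kappa> i j) (history U \<kappa> i j) r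
          \<le> C * (W a - U a)"
        using inc[of "history U \<kappa> i j" "history W \<kappa> i j" "U0 \<kappa> i j"] bx unfolding a_eq by fastforce
    qed
  qed
  have V1: "upper_lip a (\<lambda>U. 2 * \<omega> j * Qmat p \<xi> \<omega> i k * hec (slice U r \<kappa> i j) (slice U r \<kappa> k j) (n1 \<kappa> i k j)
       + dk \<kappa> * \<omega> i * \<omega> j * (\<omega> k / 2 * norm (n1 \<kappa> i k j)) * (slice U r \<kappa> i j - slice U r \<kappa> k j))"
    if k: "k \<le> p" for k
  proof (cases "k = i")
    case True
    then show ?thesis using upper_lip_hec_diag[OF a] by (simp add: a_eq)
  next
    case False
    then show ?thesis
      using upper_lip_hec[OF a mem[OF \<kappa> k ij(2)] viscosity_dominates[OF \<kappa> ij k False norm_ge_zero]]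
      by (simp add: a_eq)
  qed
  have V2: "upper_lip a (\<lambda>U. 2 * \<omega> i * Qmat p \<xi> \<omega> j k * hec (slice U r \<kappa> i j) (slice U r \<kappa> i k) (n2 \<kappa> i j k)
       + dk \<kappa> * \<omega> j * \<omega> i * (\<omega> k / 2 * norm (n2 \<kappa> i j k)) * (slice U r \<kappa> i j - slice U r \<kappa> i k))"
    if k: "k \<le> p" for k
  proof (cases "k = j")
    case True
    then show ?thesis using upper_lip_hec_diag[OF a] by (simp add: a_eq)
  next
    case False
    then show ?thesis
      using upper_lip_hec[OF a mem[OF \<kappa> ij(1) k] viscosity_dominates[OF \<kappa> ij(2,1) k False norm_ge_zero]]
      by (simp add: a_eq)
  qed
  have face: "upper_lip a (\<lambda>U. if (i, j) = fn \<kappa> e k then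
          \<omega> k * Jedge \<xi> T e k * (h (at_face (slice U r) \<kappa> e k) (at_face (slice U r) (nb \<kappa> e) e k) (enormal T \<kappa> e k)
           - f (at_face (slice U r) \<kappa> e k) \<bullet> enormal T \<kappa> e k) else 0)"
    if e: "e \<in> edges p \<xi> T \<kappa>" and k: "k \<le> p" for e k
  proof (cases "(i, j) = fn \<kappa> e k")
    case True
    have w: "0 \<le> \<omega> k * Jedge \<xi> T e k" using weight_pos[OF k] Jedge_pos[OF \<kappa> e k] by simp
    have "fst (fn \<kappa> e k) = i" "snd (fn \<kappa> e k) = j" by (simp_all add: True[symmetric])
    then show ?thesis
      using upper_lip_face[OF a mem[OF neighbour(1)[OF \<kappa> e] face_node_le[OF k]] enormal_unit[OF \<kappa> e k] w, of "nb \<kappa> e" e "nb \<kappa> e" e]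
      by (simp add: a_eq True)
  next
    case False
    then show ?thesis by (simp add: upper_lip_zero)
  qed
  have w: "0 \<le> \<omega> i * \<omega> j * J \<kappa> i j" "0 \<le> \<rho> r * dt / 2"
    using weight_pos[OF ij(1)] weight_pos[OF ij(2)] J_pos[OF \<kappa> ij] time_weight_pos[OF r] dt by simp_all
  have "upper_lip a (\<lambda>U. \<omega> i * \<omega> j * J \<kappa> i j * T_op q \<tau> \<rho> \<theta> dn (U0 \<kappa> i j) (history U \<kappa> i j) r
     + \<rho> r * dt / 2 * (R_op p \<xi> \<omega> T f hec h (slice U r) \<kappa> i j + V_op p \<xi> \<omega> T dk (slice U r) \<kappa> i j))"
    unfolding R_V_eq[OF \<kappa> ij]
    by (intro upper_lip_add upper_lip_cmult upper_lip_sum T V1 V2 face w) auto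
  then show ?thesis by (simp add: residual_def a_eq)
qed

text \<open>Preservation of constant states: the metric identities remove the volume fluxes,
  consistency the face terms, and the row sums of \<open>Dmat\<close> the time derivative. Only the
  jump from the previous slab is left, whose sign makes \<open>m\<close> and \<open>M\<close> a sub-
  and a supersolution.\<close>

lemma residual_const:
  assumes a: "a \<in> A" and a_eq: "a = (\<kappa>, i, j, r)"
  shows "residual (\<lambda>_. c) a = \<omega> i * \<omega> j * J \<kappa> i j * (if r = 0 then c - U0 \<kappa> i j else 0)"
proof -
  have \<kappa>: "\<kappa> \<in> elems T" and ij: "i \<le> p" "j \<le> p" and r: "r \<le> q" using a by (auto simp: a_eq dof_index_def)
  have "(\<Sum>l\<le>q. Qmat q \<tau> \<rho> r l) = 0"
    by (simp add: Qmat_def sum_distrib_left[symmetric] Dmat_row_sum[OF gauss_lobatto_inj_on[OF time_rule]])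
  then have "(\<Sum>l\<le>q. 2 * Qmat q \<tau> \<rho> r l * c) = 0"
    by (simp add: sum_distrib_left[symmetric] sum_distrib_right[symmetric])
  then have T: "T_op q \<tau> \<rho> \<theta> dn (U0 \<kappa> i j) (\<lambda>l. c) r = (if r = 0 then c - U0 \<kappa> i j else 0)"
    by (simp add: T_op_def Uec_refl)
  have "(\<Sum>k\<le>p. Dmat p \<xi> i k *\<^sub>R n1 \<kappa> i k j + Dmat p \<xi> j k *\<^sub>R n2 \<kappa> i j k) = 0"
    using mi \<kappa> ij unfolding metric_identities_def by blast
  then have "f c \<bullet> (\<Sum>k\<le>p. Dmat p \<xi> i k *\<^sub>R n1 \<kappa> i k j + Dmat p \<xi> j k *\<^sub>R n2 \<kappa> i j k) = 0" by simp
  then have "(\<Sum>k\<le>p. Dmat p \<xi> i k * (f c \<bullet> n1 \<kappa> i k j)) + (\<Sum>k\<le>p. Dmat p \<xi> j k * (f c \<bullet> n2 \<kappa> i j k)) = 0"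
    by (simp add: inner_sum_right inner_add_right sum.distrib)
  then have "2 * \<omega> i * \<omega> j * ((\<Sum>k\<le>p. Dmat p \<xi> i k * (f c \<bullet> n1 \<kappa> i k j)) + (\<Sum>k\<le>p. Dmat p \<xi> j k * (f c \<bullet> n2 \<kappa> i j k))) = 0"
    by simp
  then have vol: "(\<Sum>k\<le>p. 2 * \<omega> j * Qmat p \<xi> \<omega> i k * hec c c (n1 \<kappa> i k j)) +
      (\<Sum>k\<le>p. 2 * \<omega> i * Qmat p \<xi> \<omega> j k * hec c c (n2 \<kappa> i j k)) = 0"
    by (simp add: hec_refl Qmat_def distrib_left sum_distrib_left mult_ac)
  have face: "(\<Sum>e\<in>edges p \<xi> T \<kappa>. \<Sum>k\<le>p. if (i, j) = fn \<kappa> e k then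
          \<omega> k * Jedge \<xi> T e k * (h c c (enormal T \<kappa> e k) - f c \<bullet> enormal T \<kappa> e k) else 0) = 0"
    by (intro sum.neutral ballI) (simp add: interface_consistent[OF enormal_unit[OF \<kappa>]])
  have "R_op p \<xi> \<omega> T f hec h (\<lambda>_ _ _. c) \<kappa> i j + V_op p \<xi> \<omega> T dk (\<lambda>_ _ _. c) \<kappa> i j = 0"
    unfolding R_V_eq[OF \<kappa> ij] using vol face by simp
  then show ?thesis by (simp add: residual_def a_eq T)
qed

lemma greatest_solution:
  obtains G where "G \<in> extensional A" "\<And>a. a \<in> A \<Longrightarrow> m \<le> G a \<and> G a \<le> M \<and> residual G a = 0"
    "\<And>U a. (\<And>b. b \<in> A \<Longrightarrow> m \<le> U b \<and> U b \<le> M \<and> residual U b = 0) \<Longrightarrow> a \<in> A \<Longrightarrow> U a \<le> G a"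
proof -
  have "\<forall>a. \<exists>C. a \<in> A \<longrightarrow> 0 \<le> C \<and> (\<forall>U W. (\<forall>b\<in>A. m \<le> U b \<and> U b \<le> W b \<and> W b \<le> M) \<longrightarrow>
     residual W a - residual U a \<le> C * (W a - U a))"
    using upper_lip_residual unfolding upper_lip_def by blast
  then obtain C where C: "\<And>a. a \<in> A \<Longrightarrow> 0 \<le> C a"
    "\<And>a U W. a \<in> A \<Longrightarrow> (\<forall>b\<in>A. m \<le> U b \<and> U b \<le> W b \<and> W b \<le> M) \<Longrightarrow>
       residual W a - residual U a \<le> C a * (W a - U a)"
    by metis
  have const: "residual (\<lambda>_. m) a \<le> 0" "0 \<le> residual (\<lambda>_. M) a" if a: "a \<in> A" for a
  proof -
    obtain \<kappa> i j r where a_eq: "a = (\<kappa>, i, j, r)" by (cases a) auto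
    have \<kappa>: "\<kappa> \<in> elems T" and ij: "i \<le> p" "j \<le> p" using a by (auto simp: a_eq dof_index_def)
    have w: "0 \<le> \<omega> i * \<omega> j * J \<kappa> i j"
      using weight_pos[OF ij(1)] weight_pos[OF ij(2)] J_pos[OF \<kappa> ij] by simp
    show "residual (\<lambda>_. m) a \<le> 0" "0 \<le> residual (\<lambda>_. M) a"
      unfolding residual_const[OF a a_eq] using w U0[OF \<kappa> ij]
      by (auto intro: mult_nonneg_nonpos mult_nonneg_nonneg)
  qed
  show thesis
  \<comment> \<open>The \<open>1\<close> is added because a positive constant is required, whereas
    \<open>C a\<close> may vanish.\<close>
  proof (rule greatest_box_solution[OF mM, of A residual "\<lambda>a. C a + 1"])
    fix U W :: "(real^2) set \<times> nat \<times> nat \<times> nat \<Rightarrow> real" and a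
    assume a: "a \<in> A" and box: "\<And>b. b \<in> A \<Longrightarrow> m \<le> U b \<and> U b \<le> W b \<and> W b \<le> M"
    then have "residual W a - residual U a \<le> C a * (W a - U a)" using C(2)[OF a, of U W] by blast
    moreover have "0 \<le> W a - U a" using box[OF a] by simp
    ultimately have "residual W a - residual U a + 0 \<le> C a * (W a - U a) + (W a - U a)"
      by (rule add_mono)
    then show "residual W a - residual U a \<le> (C a + 1) * (W a - U a)"
      by (simp only: distrib_right mult_1 add_0_right)
  next
    fix G assume "G \<in> extensional A" "\<And>a. a \<in> A \<Longrightarrow> m \<le> G a \<and> G a \<le> M \<and> residual G a = 0"
      "\<And>U a. (\<And>b. b \<in> A \<Longrightarrow> m \<le> U b \<and> U b \<le> M \<and> residual U b \<le> 0) \<Longrightarrow> a \<in> A \<Longrightarrow> U a \<le> G a"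
    then show thesis by (intro that[of G]) auto
  qed (use C const in \<open>auto simp: add_nonneg_pos\<close>)
qed

lemma sum_residual:
  assumes \<kappa>: "\<kappa> \<in> elems T"
  shows "(\<Sum>i\<le>p. \<Sum>j\<le>p. residual U (\<kappa>, i, j, r)) =
    (\<Sum>i\<le>p. \<Sum>j\<le>p. \<omega> i * \<omega> j * J \<kappa> i j * T_op q \<tau> \<rho> \<theta> dn (U0 \<kappa> i j) (history U \<kappa> i j) r) +
    \<rho> r * dt / 2 * (\<Sum>e\<in>edges p \<xi> T \<kappa>. face_flux h (slice U r) \<kappa> e)"
proof -
  let ?R = "R_op p \<xi> \<omega> T f hec h (slice U r) \<kappa>" and ?V = "V_op p \<xi> \<omega> T dk (slice U r) \<kappa>"
  have "(\<Sum>i\<le>p. \<Sum>j\<le>p. \<rho> r * dt / 2 * (?R i j + ?V i j)) =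
      \<rho> r * dt / 2 * ((\<Sum>i\<le>p. \<Sum>j\<le>p. ?R i j) + (\<Sum>i\<le>p. \<Sum>j\<le>p. ?V i j))"
    by (simp only: sum_distrib_left sum.distrib distrib_left)
  also have "\<dots> = \<rho> r * dt / 2 * (\<Sum>e\<in>edges p \<xi> T \<kappa>. face_flux h (slice U r) \<kappa> e)"
    by (simp add: sum_R_op[where f = f and hec = hec, OF \<kappa> hec_commute hec_refl] sum_V_op)
  finally show ?thesis by (simp add: residual_def sum.distrib)
qed

end

section \<open>Comparison of two ordered solutions\<close>

context dgsem_problem
begin

text \<open>The two bounds serve different purposes. A larger neighbouring state lowers the flux, so
  from above only the element's own difference counts, which suffices inside one element; the
  two-sided bound is for the outer faces of a finite set of elements.\<close>

lemma face_flux_increment: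
  fixes L1 L2 c0 c2 :: real
  assumes \<kappa>: "\<kappa> \<in> elems T" and e: "e \<in> edges p \<xi> T \<kappa>" and r: "r \<le> q"
    and box: "\<And>a. a \<in> A \<Longrightarrow> m \<le> U a \<and> U a \<le> G a \<and> G a \<le> M"
    and L: "0 \<le> L1" "0 \<le> L2"
    "\<And>a a' b n. a \<in> {m..M} \<Longrightarrow> a' \<in> {m..M} \<Longrightarrow> b \<in> {m..M} \<Longrightarrow> n \<in> sphere 0 1 \<Longrightarrow>
       \<bar>h a' b n - h a b n\<bar> \<le> L1 * \<bar>a' - a\<bar>"
    "\<And>a b b' n. a \<in> {m..M} \<Longrightarrow> b \<in> {m..M} \<Longrightarrow> b' \<in> {m..M} \<Longrightarrow> n \<in> sphere 0 1 \<Longrightarrow>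
       \<bar>h a b' n - h a b n\<bar> \<le> L2 * \<bar>b' - b\<bar>"
    and c2: "\<And>k. k \<le> p \<Longrightarrow> \<omega> k * Jedge \<xi> T e k \<le> c2"
    and x: "\<And>i j. i \<le> p \<Longrightarrow> j \<le> p \<Longrightarrow> G (\<kappa>, i, j, r) - U (\<kappa>, i, j, r) \<le> x"
    and y: "\<And>i j. i \<le> p \<Longrightarrow> j \<le> p \<Longrightarrow> G (nb \<kappa> e, i, j, r) - U (nb \<kappa> e, i, j, r) \<le> y"
  shows "face_flux h (slice G r) \<kappa> e - face_flux h (slice U r) \<kappa> e \<le> real (p + 1) * (c2 * (L1 * x))"
    and "\<bar>face_flux h (slice G r) \<kappa> e - face_flux h (slice U r) \<kappa> e\<bar> \<le> real (p + 1) * (c2 * (L1 * x + L2 * y))"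
proof -
  define t where "t k = h (at_face (slice G r) \<kappa> e k) (at_face (slice G r) (nb \<kappa> e) e k) (enormal T \<kappa> e k)
     - h (at_face (slice U r) \<kappa> e k) (at_face (slice U r) (nb \<kappa> e) e k) (enormal T \<kappa> e k)" for k
  have diff: "face_flux h (slice G r) \<kappa> e - face_flux h (slice U r) \<kappa> e = (\<Sum>k\<le>p. \<omega> k * Jedge \<xi> T e k * t k)"
    by (simp add: face_flux_def t_def sum_subtractf right_diff_distrib)
  have t: "t k \<le> L1 * x \<and> \<bar>t k\<bar> \<le> L1 * x + L2 * y \<and> 0 \<le> x \<and> 0 \<le> y" if k: "k \<le> p" for k
  proof -
    let ?a = "(\<kappa>, fst (fn \<kappa> e k), snd (fn \<kappa> e k), r)"
      and ?b = "(nb \<kappa> e, fst (fn (nb \<kappa> e) e k), snd (fn (nb \<kappa> e) e k), r)"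
    let ?n = "enormal T \<kappa> e k"
    have A: "?a \<in> A" "?b \<in> A"
      using \<kappa> neighbour(1)[OF \<kappa> e] face_node_le[OF k] r by (simp_all add: dof_index_def)
    have n: "?n \<in> sphere 0 1" by (rule enormal_unit[OF \<kappa> e k])
    have bx: "U ?a \<in> {m..M}" "G ?a \<in> {m..M}" "U ?b \<in> {m..M}" "G ?b \<in> {m..M}" "U ?a \<le> G ?a" "U ?b \<le> G ?b"
      using box[OF A(1)] box[OF A(2)] by auto
    have xy: "G ?a - U ?a \<le> x" "G ?b - U ?b \<le> y"
      using x y face_node_le[OF k] by blast+
    have 1: "\<bar>h (G ?a) (G ?b) ?n - h (U ?a) (G ?b) ?n\<bar> \<le> L1 * \<bar>G ?a - U ?a\<bar>" by (rule L(3)[OF bx(1,2,4) n])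
    have 2: "\<bar>h (U ?a) (G ?b) ?n - h (U ?a) (U ?b) ?n\<bar> \<le> L2 * \<bar>G ?b - U ?b\<bar>" by (rule L(4)[OF bx(1,3,4) n])
    have 3: "h (U ?a) (G ?b) ?n \<le> h (U ?a) (U ?b) ?n" by (rule interface_antimono[OF bx(1,3,4) n bx(6)])
    have "L1 * \<bar>G ?a - U ?a\<bar> \<le> L1 * x" "L2 * \<bar>G ?b - U ?b\<bar> \<le> L2 * y"
      using xy bx(5,6) L(1,2) by (auto intro!: mult_left_mono)
    moreover have "0 \<le> x" "0 \<le> y" using xy bx(5,6) by auto
    ultimately show ?thesis using 1 2 3 unfolding t_def by linarith
  qed
  have w: "0 \<le> \<omega> k * Jedge \<xi> T e k" if "k \<le> p" for k
    using weight_pos[OF that] Jedge_pos[OF \<kappa> e that] by simp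
  have "(\<Sum>k\<le>p. \<omega> k * Jedge \<xi> T e k * t k) \<le> (\<Sum>k\<le>p. c2 * (L1 * x))"
  proof (rule sum_mono)
    fix k assume "k \<in> {..p}"
    then have k: "k \<le> p" by simp
    have "\<omega> k * Jedge \<xi> T e k * t k \<le> \<omega> k * Jedge \<xi> T e k * (L1 * x)"
      using t[OF k] w[OF k] by (intro mult_left_mono) auto
    also have "\<dots> \<le> c2 * (L1 * x)" using t[OF k] L(1) c2[OF k] by (intro mult_right_mono) auto
    finally show "\<omega> k * Jedge \<xi> T e k * t k \<le> c2 * (L1 * x)" .
  qed
  then show "face_flux h (slice G r) \<kappa> e - face_flux h (slice U r) \<kappa> e \<le> real (p + 1) * (c2 * (L1 * x))"
    unfolding diff by (simp add: add.commute)
  have "\<bar>\<Sum>k\<le>p. \<omega> k * Jedge \<xi> T e k * t k\<bar> \<le> (\<Sum>k\<le>p. c2 * (L1 * x + L2 * y))"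
  proof (rule order_trans[OF sum_abs sum_mono])
    fix k assume "k \<in> {..p}"
    then have k: "k \<le> p" by simp
    have "\<bar>\<omega> k * Jedge \<xi> T e k * t k\<bar> = \<omega> k * Jedge \<xi> T e k * \<bar>t k\<bar>"
      unfolding abs_mult[of "\<omega> k * Jedge \<xi> T e k"] using w[OF k] by (simp only: abs_of_nonneg)
    also have "\<dots> \<le> \<omega> k * Jedge \<xi> T e k * (L1 * x + L2 * y)"
      using t[OF k] w[OF k] by (intro mult_left_mono) auto
    also have "\<dots> \<le> c2 * (L1 * x + L2 * y)" using t[OF k] L c2[OF k] by (intro mult_right_mono) auto
    finally show "\<bar>\<omega> k * Jedge \<xi> T e k * t k\<bar> \<le> c2 * (L1 * x + L2 * y)" .
  qed
  then show "\<bar>face_flux h (slice G r) \<kappa> e - face_flux h (slice U r) \<kappa> e\<bar> \<le> real (p + 1) * (c2 * (L1 * x + L2 * y))"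
    unfolding diff by (simp add: add.commute)
qed

text \<open>The weighted mass \<open>\<mu>\<close> of the difference of two ordered solutions is controlled at all time nodes
  by its value at the end of the slab, where it can only change through the faces. By
  \<open>layer_propagation\<close> it would have to grow exponentially with the distance, but the
  area of the elements only grows quadratically.\<close>

lemma ordered_solutions_eq:
  assumes mM': "m < M"
    and box: "\<And>a. a \<in> A \<Longrightarrow> m \<le> U a \<and> U a \<le> G a \<and> G a \<le> M"
    and sol: "\<And>a. a \<in> A \<Longrightarrow> residual U a = 0 \<and> residual G a = 0"
    and a: "a \<in> A"
  shows "U a = G a"
proof -
  obtain H c0 c1 c2 where H: "0 < H" "\<And>\<kappa>. \<kappa> \<in> elems T \<Longrightarrow> diameter \<kappa> \<le> H" and c0: "0 < c0"
    and c01: "\<And>\<kappa> i j. \<kappa> \<in> elems T \<Longrightarrow> i \<le> p \<Longrightarrow> j \<le> p \<Longrightarrow> c0 \<le> \<omega> i * \<omega> j * J \<kappa> i j \<and> \<omega> i * \<omega> j * J \<kappa> i j \<le> c1"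
    and c2: "\<And>\<kappa> e k. \<kappa> \<in> elems T \<Longrightarrow> e \<in> edges p \<xi> T \<kappa> \<Longrightarrow> k \<le> p \<Longrightarrow> \<omega> k * Jedge \<xi> T e k \<le> c2"
    using mesh_constants by blast
  obtain L1 L2 where L: "0 \<le> L1" "0 \<le> L2"
    "\<And>a a' b n. a \<in> {m..M} \<Longrightarrow> a' \<in> {m..M} \<Longrightarrow> b \<in> {m..M} \<Longrightarrow> n \<in> sphere 0 1 \<Longrightarrow>
       \<bar>h a' b n - h a b n\<bar> \<le> L1 * \<bar>a' - a\<bar>"
    "\<And>a b b' n. a \<in> {m..M} \<Longrightarrow> b \<in> {m..M} \<Longrightarrow> b' \<in> {m..M} \<Longrightarrow> n \<in> sphere 0 1 \<Longrightarrow>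
       \<bar>h a b' n - h a b n\<bar> \<le> L2 * \<bar>b' - b\<bar>"
    using interface_bounds by blast
  define w where "w \<kappa> i j = \<omega> i * \<omega> j * J \<kappa> i j" for \<kappa> i j
  define D where "D \<kappa> i j r = G (\<kappa>, i, j, r) - U (\<kappa>, i, j, r)" for \<kappa> i j r
  define \<mu> where "\<mu> \<kappa> r = (\<Sum>i\<le>p. \<Sum>j\<le>p. w \<kappa> i j * D \<kappa> i j r)" for \<kappa> r
  define \<Delta> where "\<Delta> \<kappa> e r = face_flux h (slice G r) \<kappa> e - face_flux h (slice U r) \<kappa> e" for \<kappa> e r
  have memA: "(\<kappa>, i, j, r) \<in> A" if "\<kappa> \<in> elems T" "i \<le> p" "j \<le> p" "r \<le> q" for \<kappa> i j r
    using that by (simp add: dof_index_def)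
  have w: "c0 \<le> w \<kappa> i j" "w \<kappa> i j \<le> c1" "0 \<le> w \<kappa> i j" if "\<kappa> \<in> elems T" "i \<le> p" "j \<le> p" for \<kappa> i j
    using c01[OF that] c0 by (auto simp: w_def)
  have D: "0 \<le> D \<kappa> i j r" "D \<kappa> i j r \<le> M - m" if "\<kappa> \<in> elems T" "i \<le> p" "j \<le> p" "r \<le> q" for \<kappa> i j r
    using box[OF memA[OF that]] by (auto simp: D_def)
  have wD: "0 \<le> w \<kappa> i j * D \<kappa> i j r" if "\<kappa> \<in> elems T" "i \<le> p" "j \<le> p" "r \<le> q" for \<kappa> i j r
    using w(3)[OF that(1-3)] D(1)[OF that] by simp
  have \<mu>0: "0 \<le> \<mu> \<kappa> r" if "\<kappa> \<in> elems T" "r \<le> q" for \<kappa> r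
    unfolding \<mu>_def using wD that by (intro sum_nonneg) auto
  \<comment> \<open>The nodal weights are bounded below by \<open>c0\<close>, so the mass of an
    element controls each of its degrees of freedom.\<close>
  have D\<mu>: "D \<kappa> i j r \<le> \<mu> \<kappa> r / c0" if \<kappa>: "\<kappa> \<in> elems T" and ij: "i \<le> p" "j \<le> p" and r: "r \<le> q" for \<kappa> i j r
  proof -
    have "c0 * D \<kappa> i j r \<le> w \<kappa> i j * D \<kappa> i j r"
      using w(1)[OF \<kappa> ij] D(1)[OF \<kappa> ij r] by (rule mult_right_mono)
    also have "\<dots> \<le> (\<Sum>j\<le>p. w \<kappa> i j * D \<kappa> i j r)"
      by (rule member_le_sum) (use ij wD \<kappa> r in auto)
    also have "\<dots> \<le> \<mu> \<kappa> r"
      unfolding \<mu>_def by (rule member_le_sum) (use ij wD \<kappa> r in \<open>auto intro!: sum_nonneg\<close>)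
    finally show ?thesis using c0 by (simp add: field_simps)
  qed
  define K1 where "K1 = real (p + 1) * (c2 * (L1 / c0))"
  define K2 where "K2 = real (p + 1) * (c2 * ((L1 + L2) / c0))"
  have flux: "\<Delta> \<kappa> e r \<le> K1 * \<mu> \<kappa> r" "\<bar>\<Delta> \<kappa> e r\<bar> \<le> K2 * (\<mu> \<kappa> r + \<mu> (nb \<kappa> e) r)" "0 \<le> K1" "0 \<le> K2"
    if \<kappa>: "\<kappa> \<in> elems T" and e: "e \<in> edges p \<xi> T \<kappa>" and r: "r \<le> q" for \<kappa> e r
  proof -
    have x: "G (\<kappa>, i, j, r) - U (\<kappa>, i, j, r) \<le> \<mu> \<kappa> r / c0" if "i \<le> p" "j \<le> p" for i j
      using D\<mu>[OF \<kappa> that r] by (simp add: D_def)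
    have y: "G (nb \<kappa> e, i, j, r) - U (nb \<kappa> e, i, j, r) \<le> \<mu> (nb \<kappa> e) r / c0" if "i \<le> p" "j \<le> p" for i j
      using D\<mu>[OF neighbour(1)[OF \<kappa> e] that r] by (simp add: D_def)
    have inc: "\<Delta> \<kappa> e r \<le> real (p + 1) * (c2 * (L1 * (\<mu> \<kappa> r / c0)))"
      "\<bar>\<Delta> \<kappa> e r\<bar> \<le> real (p + 1) * (c2 * (L1 * (\<mu> \<kappa> r / c0) + L2 * (\<mu> (nb \<kappa> e) r / c0)))"
      unfolding \<Delta>_def
      by (rule face_flux_increment[where ?U = U and ?G = G and ?L1.0 = L1 and ?L2.0 = L2 and ?c2.0 = c2
            and x = "\<mu> \<kappa> r / c0" and y = "\<mu> (nb \<kappa> e) r / c0"];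
          fact \<kappa> e r box L c2[OF \<kappa> e] x y)+
    have "0 \<le> \<omega> 0 * Jedge \<xi> T e 0" using weight_pos[of 0] Jedge_pos[OF \<kappa> e, of 0] by simp
    then have c20: "0 \<le> c2" using c2[OF \<kappa> e, of 0] by simp
    show "0 \<le> K1" "0 \<le> K2" using c20 c0 L by (simp_all add: K1_def K2_def)
    show "\<Delta> \<kappa> e r \<le> K1 * \<mu> \<kappa> r" using inc(1) by (simp add: K1_def mult.assoc)
    have "\<bar>\<Delta> \<kappa> e r\<bar> \<le> real (p + 1) * (c2 * (L1 * (\<mu> \<kappa> r / c0) + L2 * (\<mu> (nb \<kappa> e) r / c0)))"
      by (rule inc(2))
    also have "\<dots> \<le> real (p + 1) * (c2 * ((L1 + L2) / c0 * (\<mu> \<kappa> r + \<mu> (nb \<kappa> e) r)))"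
    proof (intro mult_left_mono c20)
      have "L1 * \<mu> \<kappa> r + L2 * \<mu> (nb \<kappa> e) r \<le> (L1 + L2) * (\<mu> \<kappa> r + \<mu> (nb \<kappa> e) r)"
        using L \<mu>0[OF \<kappa> r] \<mu>0[OF neighbour(1)[OF \<kappa> e] r] by (simp add: algebra_simps)
      then have "(L1 * \<mu> \<kappa> r + L2 * \<mu> (nb \<kappa> e) r) / c0 \<le> (L1 + L2) * (\<mu> \<kappa> r + \<mu> (nb \<kappa> e) r) / c0"
        using c0 by (intro divide_right_mono) auto
      moreover have "L1 * (\<mu> \<kappa> r / c0) + L2 * (\<mu> (nb \<kappa> e) r / c0) =
          (L1 * \<mu> \<kappa> r + L2 * \<mu> (nb \<kappa> e) r) / c0"
        by (simp add: add_divide_distrib)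
      moreover have "(L1 + L2) / c0 * (\<mu> \<kappa> r + \<mu> (nb \<kappa> e) r) =
          (L1 + L2) * (\<mu> \<kappa> r + \<mu> (nb \<kappa> e) r) / c0"
        by (rule times_divide_eq_left)
      ultimately show "L1 * (\<mu> \<kappa> r / c0) + L2 * (\<mu> (nb \<kappa> e) r / c0) \<le>
          (L1 + L2) / c0 * (\<mu> \<kappa> r + \<mu> (nb \<kappa> e) r)"
        by (simp only:)
    qed simp
    finally show "\<bar>\<Delta> \<kappa> e r\<bar> \<le> K2 * (\<mu> \<kappa> r + \<mu> (nb \<kappa> e) r)" by (simp add: K2_def mult.assoc)
  qed
  define \<Theta> where "\<Theta> \<kappa> i j r = T_op q \<tau> \<rho> \<theta> dn (U0 \<kappa> i j) (history G \<kappa> i j) r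
     - T_op q \<tau> \<rho> \<theta> dn (U0 \<kappa> i j) (history U \<kappa> i j) r" for \<kappa> i j r
  have eq: "(\<Sum>i\<le>p. \<Sum>j\<le>p. w \<kappa> i j * \<Theta> \<kappa> i j r) + \<rho> r * dt / 2 * (\<Sum>e\<in>edges p \<xi> T \<kappa>. \<Delta> \<kappa> e r) = 0"
    if \<kappa>: "\<kappa> \<in> elems T" and r: "r \<le> q" for \<kappa> r
  proof -
    have "(\<Sum>i\<le>p. \<Sum>j\<le>p. residual W (\<kappa>, i, j, r)) = 0" if "W = U \<or> W = G" for W
      using that sol memA[OF \<kappa> _ _ r] by (auto intro!: sum.neutral)
    from this[of G] this[of U] show ?thesis
      unfolding sum_residual[OF \<kappa>] w_def[symmetric]
      by (simp add: \<Theta>_def \<Delta>_def sum_subtractf right_diff_distrib)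
  qed
  \<comment> \<open>In the equation at the last time node, the strict dissipation leaves
    \<open>\<epsilon>\<close> times the masses at all time nodes. The fluxes are needed from above
    only, so no neighbour enters.\<close>
  obtain Ca where Ca: "0 \<le> Ca" "\<And>\<kappa> l. \<kappa> \<in> elems T \<Longrightarrow> l \<le> q \<Longrightarrow> \<mu> \<kappa> l \<le> Ca * \<mu> \<kappa> q"
  proof -
    obtain C \<epsilon> where C: "0 \<le> C" "0 < \<epsilon>" and inc:
      "\<And>w w' w0. \<forall>l\<le>q. m \<le> w l \<and> w l \<le> w' l \<and> w' l \<le> M \<Longrightarrow>
       T_op q \<tau> \<rho> \<theta> dn w0 w' q - T_op q \<tau> \<rho> \<theta> dn w0 w q \<le> C * (w' q - w q) - \<epsilon> * (\<Sum>l\<le>q. w' l - w l)"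
      using T_op_increment[OF order_refl] mM' by blast
    \<comment> \<open>\<open>K1\<close> is known to be nonnegative only once an element with an edge
      is given, hence the absolute value.\<close>
    define Ca where "Ca = (C + \<rho> q * dt / 2 * (4 * \<bar>K1\<bar>)) / \<epsilon>"
    have \<rho>dt: "0 \<le> \<rho> q * dt / 2" using time_weight_pos[of q] dt by simp
    have "\<mu> \<kappa> l \<le> Ca * \<mu> \<kappa> q" if \<kappa>: "\<kappa> \<in> elems T" and l: "l \<le> q" for \<kappa> l
    proof -
      have "(\<Sum>i\<le>p. \<Sum>j\<le>p. w \<kappa> i j * \<Theta> \<kappa> i j q) \<le>
          (\<Sum>i\<le>p. \<Sum>j\<le>p. w \<kappa> i j * (C * D \<kappa> i j q - \<epsilon> * (\<Sum>l\<le>q. D \<kappa> i j l)))"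
      proof (intro sum_mono mult_left_mono)
        fix i j assume ij: "i \<in> {..p}" "j \<in> {..p}"
        then have "\<forall>l\<le>q. m \<le> history U \<kappa> i j l \<and> history U \<kappa> i j l \<le> history G \<kappa> i j l \<and> history G \<kappa> i j l \<le> M"
          using box memA \<kappa> by simp
        then show "\<Theta> \<kappa> i j q \<le> C * D \<kappa> i j q - \<epsilon> * (\<Sum>l\<le>q. D \<kappa> i j l)"
          unfolding \<Theta>_def D_def by (rule inc)
        show "0 \<le> w \<kappa> i j" using w(3)[OF \<kappa>] ij by simp
      qed
      also have "\<dots> = C * \<mu> \<kappa> q - \<epsilon> * (\<Sum>l\<le>q. \<mu> \<kappa> l)"
      proof -
        have "(\<Sum>l\<le>q. \<mu> \<kappa> l) = (\<Sum>i\<le>p. \<Sum>l\<le>q. \<Sum>j\<le>p. w \<kappa> i j * D \<kappa> i j l)"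
          unfolding \<mu>_def by (rule sum.swap)
        also have "\<dots> = (\<Sum>i\<le>p. \<Sum>j\<le>p. \<Sum>l\<le>q. w \<kappa> i j * D \<kappa> i j l)"
          by (intro sum.cong refl sum.swap)
        finally have "(\<Sum>l\<le>q. \<mu> \<kappa> l) = (\<Sum>i\<le>p. \<Sum>j\<le>p. w \<kappa> i j * (\<Sum>l\<le>q. D \<kappa> i j l))"
          by (simp add: sum_distrib_left)
        then show ?thesis
          by (simp add: \<mu>_def right_diff_distrib sum_subtractf sum_distrib_left mult_ac)
      qed
      finally have 1: "(\<Sum>i\<le>p. \<Sum>j\<le>p. w \<kappa> i j * \<Theta> \<kappa> i j q) \<le> C * \<mu> \<kappa> q - \<epsilon> * (\<Sum>l\<le>q. \<mu> \<kappa> l)" .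
      have "(\<Sum>e\<in>edges p \<xi> T \<kappa>. \<Delta> \<kappa> e q) \<le> (\<Sum>e\<in>edges p \<xi> T \<kappa>. \<bar>K1\<bar> * \<mu> \<kappa> q)"
      proof (rule sum_mono)
        fix e assume "e \<in> edges p \<xi> T \<kappa>"
        from flux(1,3)[OF \<kappa> this order_refl] show "\<Delta> \<kappa> e q \<le> \<bar>K1\<bar> * \<mu> \<kappa> q" by simp
      qed
      also have "\<dots> \<le> 4 * (\<bar>K1\<bar> * \<mu> \<kappa> q)"
        using card_edges_le[of \<kappa>] \<mu>0[OF \<kappa> order_refl] by (simp add: mult_right_mono)
      finally have "\<rho> q * dt / 2 * (\<Sum>e\<in>edges p \<xi> T \<kappa>. \<Delta> \<kappa> e q) \<le> \<rho> q * dt / 2 * (4 * (\<bar>K1\<bar> * \<mu> \<kappa> q))"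
        by (rule mult_left_mono[OF _ \<rho>dt])
      then have "\<epsilon> * (\<Sum>l\<le>q. \<mu> \<kappa> l) \<le> C * \<mu> \<kappa> q + \<rho> q * dt / 2 * (4 * (\<bar>K1\<bar> * \<mu> \<kappa> q))"
        using 1 eq[OF \<kappa> order_refl] by linarith
      also have "\<dots> = (C + \<rho> q * dt / 2 * (4 * \<bar>K1\<bar>)) * \<mu> \<kappa> q" by (simp only: distrib_right mult.assoc)
      finally have "(\<Sum>l\<le>q. \<mu> \<kappa> l) \<le> Ca * \<mu> \<kappa> q" using C(2) by (simp add: Ca_def field_simps)
      moreover have "\<mu> \<kappa> l \<le> (\<Sum>l\<le>q. \<mu> \<kappa> l)"
        by (rule member_le_sum) (use l \<mu>0[OF \<kappa>] in auto)
      ultimately show ?thesis by linarith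
    qed
    moreover have "0 \<le> Ca"
      unfolding Ca_def using C time_weight_pos[of q] dt by (intro divide_nonneg_pos add_nonneg_nonneg mult_nonneg_nonneg) auto
    ultimately show thesis by (rule that[rotated])
  qed
  \<comment> \<open>Summed over the time nodes, the time operator telescopes to the end of the slab;
    the common datum \<open>U0\<close> cancels in the difference.\<close>
  have slab: "\<mu> \<kappa> q = - (\<Sum>r\<le>q. \<rho> r * dt / 2 * (\<Sum>e\<in>edges p \<xi> T \<kappa>. \<Delta> \<kappa> e r))" if \<kappa>: "\<kappa> \<in> elems T" for \<kappa>
  proof -
    have "(\<Sum>r\<le>q. \<Sum>i\<le>p. \<Sum>j\<le>p. w \<kappa> i j * \<Theta> \<kappa> i j r) = (\<Sum>i\<le>p. \<Sum>r\<le>q. \<Sum>j\<le>p. w \<kappa> i j * \<Theta> \<kappa> i j r)"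
      by (rule sum.swap)
    also have "\<dots> = (\<Sum>i\<le>p. \<Sum>j\<le>p. \<Sum>r\<le>q. w \<kappa> i j * \<Theta> \<kappa> i j r)"
      by (intro sum.cong refl sum.swap)
    also have "\<dots> = \<mu> \<kappa> q"
      unfolding \<mu>_def sum_distrib_left[symmetric]
      by (intro sum.cong refl) (simp add: \<Theta>_def sum_subtractf sum_T_op D_def)
    finally have "(\<Sum>r\<le>q. \<Sum>i\<le>p. \<Sum>j\<le>p. w \<kappa> i j * \<Theta> \<kappa> i j r) = \<mu> \<kappa> q" .
    moreover have "(\<Sum>r\<le>q. (\<Sum>i\<le>p. \<Sum>j\<le>p. w \<kappa> i j * \<Theta> \<kappa> i j r) +
        \<rho> r * dt / 2 * (\<Sum>e\<in>edges p \<xi> T \<kappa>. \<Delta> \<kappa> e r)) = 0"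
      by (rule sum.neutral) (use eq[OF \<kappa>] in simp)
    ultimately show ?thesis by (simp add: sum.distrib)
  qed
  \<comment> \<open>The summand \<open>1\<close> ensures positivity, as
    \<open>layer_propagation\<close> requires.\<close>
  define C where "C = (\<Sum>r\<le>q. \<rho> r * dt / 2 * (\<bar>K2\<bar> * Ca)) + 1"
  have \<rho>dt: "0 \<le> \<rho> r * dt / 2" if "r \<le> q" for r using time_weight_pos[OF that] dt by simp
  have C: "0 < C"
    unfolding C_def by (intro add_nonneg_pos sum_nonneg mult_nonneg_nonneg) (use time_weight_pos dt Ca in \<open>auto simp: less_imp_le\<close>)
  have balance: "(\<Sum>\<kappa>\<in>B. \<mu> \<kappa> q) \<le>
      C * (\<Sum>(\<kappa>, e)\<in>{(\<kappa>, e). \<kappa> \<in> B \<and> e \<in> edges p \<xi> T \<kappa> \<and> nb \<kappa> e \<notin> B}. \<mu> \<kappa> q + \<mu> (nb \<kappa> e) q)"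
    if B: "finite B" "B \<subseteq> elems T" for B
  proof -
    define E where "E = {(\<kappa>, e). \<kappa> \<in> B \<and> e \<in> edges p \<xi> T \<kappa> \<and> nb \<kappa> e \<notin> B}"
    define Z where "Z = (\<Sum>(\<kappa>, e)\<in>E. \<mu> \<kappa> q + \<mu> (nb \<kappa> e) q)"
    have E: "\<kappa> \<in> elems T \<and> e \<in> edges p \<xi> T \<kappa>" if "(\<kappa>, e) \<in> E" for \<kappa> e using that B by (auto simp: E_def)
    have Z0: "0 \<le> Z"
      unfolding Z_def using E \<mu>0 neighbour(1) by (intro sum_nonneg) fastforce
    have anti: "face_flux h W (nb \<kappa> e) e = - face_flux h W \<kappa> e"
      if "\<kappa> \<in> elems T" "e \<in> edges p \<xi> T \<kappa>" for W \<kappa> e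
      by (rule face_flux_neighbour[OF that]) (rule interface_conservative)
    have tele: "(\<Sum>\<kappa>\<in>B. \<Sum>e\<in>edges p \<xi> T \<kappa>. \<Delta> \<kappa> e r) = (\<Sum>(\<kappa>, e)\<in>E. \<Delta> \<kappa> e r)" for r
      unfolding E_def
      by (rule sum_faces_telescope[OF B, of "\<lambda>\<kappa> e. \<Delta> \<kappa> e r"])
         (simp add: \<Delta>_def anti)
    have bound: "- (\<Sum>(\<kappa>, e)\<in>E. \<Delta> \<kappa> e r) \<le> \<bar>K2\<bar> * Ca * Z" if r: "r \<le> q" for r
    proof -
      have "- (\<Sum>(\<kappa>, e)\<in>E. \<Delta> \<kappa> e r) = (\<Sum>(\<kappa>, e)\<in>E. - \<Delta> \<kappa> e r)" by (simp add: sum_negf split_beta)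
      also have "\<dots> \<le> (\<Sum>(\<kappa>, e)\<in>E. \<bar>K2\<bar> * Ca * (\<mu> \<kappa> q + \<mu> (nb \<kappa> e) q))"
      proof (rule sum_mono, clarify)
        fix \<kappa> e assume "(\<kappa>, e) \<in> E"
        then have \<kappa>: "\<kappa> \<in> elems T" and e: "e \<in> edges p \<xi> T \<kappa>" using E by auto
        have "- \<Delta> \<kappa> e r \<le> K2 * (\<mu> \<kappa> r + \<mu> (nb \<kappa> e) r)" using flux(2)[OF \<kappa> e r] by linarith
        also have "\<dots> \<le> K2 * (Ca * \<mu> \<kappa> q + Ca * \<mu> (nb \<kappa> e) q)"
          using Ca(2)[OF \<kappa> r] Ca(2)[OF neighbour(1)[OF \<kappa> e] r] flux(4)[OF \<kappa> e r]
          by (intro mult_left_mono add_mono) auto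
        also have "\<dots> = \<bar>K2\<bar> * Ca * (\<mu> \<kappa> q + \<mu> (nb \<kappa> e) q)"
          using flux(4)[OF \<kappa> e r] by (simp add: distrib_left mult.assoc)
        finally show "- \<Delta> \<kappa> e r \<le> \<bar>K2\<bar> * Ca * (\<mu> \<kappa> q + \<mu> (nb \<kappa> e) q)" .
      qed
      also have "\<dots> = \<bar>K2\<bar> * Ca * Z" by (simp add: Z_def sum_distrib_left split_beta)
      finally show ?thesis .
    qed
    have "(\<Sum>\<kappa>\<in>B. \<mu> \<kappa> q) = (\<Sum>\<kappa>\<in>B. - (\<Sum>r\<le>q. \<rho> r * dt / 2 * (\<Sum>e\<in>edges p \<xi> T \<kappa>. \<Delta> \<kappa> e r)))"
      by (rule sum.cong[OF refl]) (use slab B in blast)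
    also have "\<dots> = - (\<Sum>r\<le>q. \<Sum>\<kappa>\<in>B. \<rho> r * dt / 2 * (\<Sum>e\<in>edges p \<xi> T \<kappa>. \<Delta> \<kappa> e r))"
      by (subst sum.swap) (simp only: sum_negf)
    also have "\<dots> = (\<Sum>r\<le>q. \<rho> r * dt / 2 * - (\<Sum>(\<kappa>, e)\<in>E. \<Delta> \<kappa> e r))"
      by (simp only: sum_distrib_left[of "\<rho> _ * dt / 2" _ B, symmetric] tele sum_negf mult_minus_right)
    also have "\<dots> \<le> (\<Sum>r\<le>q. \<rho> r * dt / 2 * (\<bar>K2\<bar> * Ca * Z))"
      by (intro sum_mono mult_left_mono bound \<rho>dt) auto
    also have "\<dots> = (\<Sum>r\<le>q. \<rho> r * dt / 2 * (\<bar>K2\<bar> * Ca)) * Z"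
      by (simp add: sum_distrib_right mult.assoc)
    also have "\<dots> \<le> C * Z" using Z0 by (simp add: C_def distrib_right)
    finally show ?thesis unfolding Z_def E_def .
  qed
  \<comment> \<open>The nodal Jacobian bound becomes an area bound, which limits how many elements
    fit into a ball.\<close>
  have area: "c0 \<le> measure lebesgue \<kappa>" if \<kappa>: "\<kappa> \<in> elems T" for \<kappa>
  proof -
    have "c0 \<le> w \<kappa> 0 0" using w(1)[OF \<kappa>] by simp
    also have "\<dots> \<le> (\<Sum>j\<le>p. w \<kappa> 0 j)" by (rule member_le_sum) (use w(3)[OF \<kappa>] in auto)
    also have "\<dots> \<le> (\<Sum>i\<le>p. \<Sum>j\<le>p. w \<kappa> i j)"
      by (rule member_le_sum) (use w(3)[OF \<kappa>] in \<open>auto intro!: sum_nonneg\<close>)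
    also have "\<dots> \<le> measure lebesgue \<kappa>" unfolding w_def by (rule element_area[OF gl p mp \<kappa>])
    finally show ?thesis .
  qed
  have \<mu>_bound: "0 \<le> \<mu> \<kappa> q \<and> \<mu> \<kappa> q \<le> (\<Sum>i\<le>p. \<Sum>j\<le>p. c1 * (M - m))" if \<kappa>: "\<kappa> \<in> elems T" for \<kappa>
  proof
    show "\<mu> \<kappa> q \<le> (\<Sum>i\<le>p. \<Sum>j\<le>p. c1 * (M - m))"
      unfolding \<mu>_def
    proof (intro sum_mono mult_mono)
      fix i j assume "i \<in> {..p}" "j \<in> {..p}"
      then have ij: "i \<le> p" "j \<le> p" by auto
      show "w \<kappa> i j \<le> c1" "D \<kappa> i j q \<le> M - m" "0 \<le> D \<kappa> i j q"
        using w(2)[OF \<kappa> ij] D[OF \<kappa> ij order_refl] by auto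
      show "0 \<le> c1" using w(2,3)[OF \<kappa> ij] by linarith
    qed
  qed (rule \<mu>0[OF \<kappa> order_refl])
  have zero: "\<mu> \<kappa> q = 0" if \<kappa>: "\<kappa> \<in> elems T" for \<kappa>
    by (rule layer_propagation[OF H c0 area \<mu>_bound C balance \<kappa>])
  obtain \<kappa> i j r where a_eq: "a = (\<kappa>, i, j, r)" by (cases a) auto
  have \<kappa>: "\<kappa> \<in> elems T" and ij: "i \<le> p" "j \<le> p" and r: "r \<le> q" using a by (auto simp: a_eq dof_index_def)
  have "\<mu> \<kappa> r \<le> 0" using Ca(2)[OF \<kappa> r] zero[OF \<kappa>] by simp
  then have "\<mu> \<kappa> r / c0 \<le> 0" using c0 by (simp add: divide_le_0_iff)
  then have "D \<kappa> i j r = 0" using D\<mu>[OF \<kappa> ij r] D(1)[OF \<kappa> ij r] by simp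
  then show ?thesis by (simp add: D_def a_eq)
qed

lemma unique_solution:
  "\<exists>!U. U \<in> extensional A \<and> dgsem_slab p \<xi> \<omega> q \<tau> \<rho> T f \<theta> hec h dk dn dt U0 U \<and>
     (\<forall>\<kappa>\<in>elems T. \<forall>i\<le>p. \<forall>j\<le>p. \<forall>r\<le>q. m \<le> U (\<kappa>, i, j, r) \<and> U (\<kappa>, i, j, r) \<le> M)"
proof -
  obtain G where G: "G \<in> extensional A" "\<And>a. a \<in> A \<Longrightarrow> m \<le> G a \<and> G a \<le> M \<and> residual G a = 0"
    "\<And>U a. (\<And>b. b \<in> A \<Longrightarrow> m \<le> U b \<and> U b \<le> M \<and> residual U b = 0) \<Longrightarrow> a \<in> A \<Longrightarrow> U a \<le> G a"
    using greatest_solution by blast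
  have box_iff: "(\<forall>\<kappa>\<in>elems T. \<forall>i\<le>p. \<forall>j\<le>p. \<forall>r\<le>q. m \<le> U (\<kappa>, i, j, r) \<and> U (\<kappa>, i, j, r) \<le> M) \<longleftrightarrow>
     (\<forall>a\<in>A. m \<le> U a \<and> U a \<le> M)" for U :: "(real^2) set \<times> nat \<times> nat \<times> nat \<Rightarrow> real"
    by (auto simp: dof_index_def)
  show ?thesis
    unfolding box_iff dgsem_slab_iff
  proof (rule ex1I[of _ G])
    show "G \<in> extensional A \<and> (\<forall>a\<in>A. residual G a = 0) \<and> (\<forall>a\<in>A. m \<le> G a \<and> G a \<le> M)"
      using G(1,2) by blast
    fix U assume U: "U \<in> extensional A \<and> (\<forall>a\<in>A. residual U a = 0) \<and> (\<forall>a\<in>A. m \<le> U a \<and> U a \<le> M)"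
    have UG: "U a \<le> G a" if "a \<in> A" for a using G(3)[of U a] U that by blast
    have "U a = G a" if a: "a \<in> A" for a
    \<comment> \<open>For \<open>m = M\<close> the constant \<open>Lu\<close> is \<open>0\<close>
      and the margin in time is lost, but then the box is a single point.\<close>
    proof (cases "m = M")
      case True
      then show ?thesis using U G(2)[OF a] a by force
    next
      case False
      then have "m < M" using mM by simp
      then show ?thesis by (rule ordered_solutions_eq[OF _ _ _ a]) (use U UG G(2) in auto)
    qed
    then show "U = G" using U G(1) by (intro extensionalityI) auto
  qed
qed

end

theorem theorem4p2:
  fixes p q :: nat
    and \<xi> \<omega> \<tau> \<rho> :: "nat \<Rightarrow> real"
    and \<Omega> :: "(real^2) set"
    and T :: mesh
    and f g :: "real \<Rightarrow> real^2"
    and u0 :: "real^2 \<Rightarrow> real"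
    and m M :: real
    and \<theta> :: "real \<Rightarrow> real"
    and hec h :: "real \<Rightarrow> real \<Rightarrow> real^2 \<Rightarrow> real"
    and dk :: "(real^2) set \<Rightarrow> real"
    and t dn :: "nat \<Rightarrow> real"
  assumes "1 \<le> p" and "1 \<le> q"
    and space_rule: "gauss_lobatto p \<xi> \<omega>"
    and time_rule: "gauss_lobatto q \<tau> \<rho>"
    and domain: "open \<Omega>"
    and mesh: "dgsem_mesh p \<xi> \<Omega> T"
    and flux: "locally_Lipschitz f"
    and initial: "u0 \<in> borel_measurable (lebesgue_on \<Omega>)"
      "ereal m = essinf (lebesgue_on \<Omega>) (\<lambda>x. ereal (u0 x))"
      "ereal M = esssup (lebesgue_on \<Omega>) (\<lambda>x. ereal (u0 x))"
    and entropy: "entropy_pair f \<theta> g"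
    and cell_flux: "ec_flux f \<theta> g hec"
    and interface_flux: "interface_flux f m M h"
    and time_levels: "t 0 = 0" "\<forall>n. t n < t (Suc n)"
    and space_viscosity:
      "\<forall>\<kappa>\<in>elems T. dk \<kappa> \<ge> 4 * Lf f m M * Lu \<theta> m M * max_D_over_weight p \<xi> \<omega>"
    and time_viscosity: "\<forall>n. dn n \<ge> 2 * Lu \<theta> m M * max_D_over_weight q \<tau> \<rho>"
  shows "\<forall>n U0. (\<forall>\<kappa>\<in>elems T. \<forall>i\<le>p. \<forall>j\<le>p. m \<le> U0 \<kappa> i j \<and> U0 \<kappa> i j \<le> M) \<longrightarrow>
     (\<exists>!U. U \<in> extensional (dof_index p q T) \<and>
        dgsem_slab p \<xi> \<omega> q \<tau> \<rho> T f \<theta> hec h dk (dn n) (t (Suc n) - t n) U0 U \<and>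
        (\<forall>\<kappa>\<in>elems T. \<forall>i\<le>p. \<forall>j\<le>p. \<forall>r\<le>q. m \<le> U (\<kappa>, i, j, r) \<and> U (\<kappa>, i, j, r) \<le> M))"
proof (intro allI impI)
  fix n U0
  assume U0: "\<forall>\<kappa>\<in>elems T. \<forall>i\<le>p. \<forall>j\<le>p. m \<le> U0 \<kappa> i j \<and> U0 \<kappa> i j \<le> M"
  let ?P = "\<lambda>U. U \<in> extensional (dof_index p q T) \<and>
        dgsem_slab p \<xi> \<omega> q \<tau> \<rho> T f \<theta> hec h dk (dn n) (t (Suc n) - t n) U0 U \<and>
        (\<forall>\<kappa>\<in>elems T. \<forall>i\<le>p. \<forall>j\<le>p. \<forall>r\<le>q. m \<le> U (\<kappa>, i, j, r) \<and> U (\<kappa>, i, j, r) \<le> M)"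
  show "\<exists>!U. ?P U"
  \<comment> \<open>An empty mesh offers no datum from which \<open>m \<le> M\<close> could be read
    off; there the only extensional function is the solution.\<close>
  proof (cases "elems T = {}")
    case True
    then show ?thesis by (simp add: dof_index_def dgsem_slab_def)
  next
    case False
    then obtain \<kappa> where "\<kappa> \<in> elems T" by blast
    then have "m \<le> U0 \<kappa> 0 0 \<and> U0 \<kappa> 0 0 \<le> M" using U0 by blast
    then have "m \<le> M" by linarith
    then interpret dgsem_problem p \<xi> \<omega> \<Omega> T f \<theta> g m M hec q \<tau> \<rho> h dk "dn n" "t (Suc n) - t n" U0
      using assms U0 by unfold_locales auto
    show ?thesis by (rule unique_solution)
  qed
qed

end
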